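(* Let $\alpha>0$, let $w\in A^{\mathrm{restricted}}_{\infty}$, and let $\mu$ be a positive Borel measure on $\mathbb{C}$. Then there exists $\delta\in(0,1)$ such that the following conditions are equivalent: (a) $T_{\mu}$ is compact on $F^2_{\alpha,w}$; (b) $\widetilde{\mu}(z)\to0$ as $|z|\to\infty$; (c) for some (or any) $r\in(0,\delta)$, $\widehat{\mu}_{w,r}(z)\to0$ as $|z|\to\infty$.
   Context: A weight is a non-negative locally integrable function $w$ on $\mathbb{C}$; $dA$ (and $A(\cdot)$) is Lebesgue measure on $\mathbb{C}$; $w(E):=\int_E w\,dA$; $D(z,r)$ is the disk with center $z$ and radius $r$. Squares $Q\subset\mathbb{C}$ have sides parallel to the axes, with side length $\ell(Q)$. For $1<p<\infty$ with $1/p+1/p'=1$, $w\in A_p^{\mathrm{restricted}}$ if for some (or any) fixed $r>0$, $\sup_{\ell(Q)=r}\big(\frac1{A(Q)}\int_Q w\,dA\big)\big(\frac1{A(Q)}\int_Q w^{-p'/p}dA\big)^{p/p'}<\infty$; $w\in A_1^{\mathrm{restricted}}$ if for some (or any) fixed $r>0$, $\sup_{\ell(Q)=r}\big(\frac1{A(Q)}\int_Q w\,dA\big)\|w^{-1}\|_{L^\infty(Q)}<\infty$. Set $A_\infty^{\mathrm{restricted}}:=\bigcup_{1\le p<\infty}A_p^{\mathrm{restricted}}$. $F^2_{\alpha,w}$ is the Hilbert space of entire functions $f$ with $\|f\|^2_{F^2_{\alpha,w}}=\int_{\mathbb{C}}|f(z)|^2e^{-\alpha|z|^2}w(z)\,dA(z)<\infty$,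 with inner product $\langle f,g\rangle_{F^2_{\alpha,w}}=\int_{\mathbb{C}}f\overline{g}\,e^{-\alpha|z|^2}w\,dA$. $B^w_z$ is its reproducing kernel at $z$ (so $f(z)=\langle f,B^w_z\rangle_{F^2_{\alpha,w}}$), and $b^w_z:=B^w_z/\|B^w_z\|_{F^2_{\alpha,w}}$. For a positive Borel measure $\mu$, the Toeplitz operator $T_\mu$ is formally defined for entire functions $f$ by $T_\mu f(z):=\int_{\mathbb{C}}f(\xi)\overline{B^w_z(\xi)}e^{-\alpha|\xi|^2}d\mu(\xi)$, $z\in\mathbb{C}$. The average function is $\widehat{\mu}_{w,r}(z):=\mu(D(z,r))/w(D(z,r))$; the Berezin transform is $\widetilde{\mu}(z):=\int_{\mathbb{C}}|b^w_z(\xi)|^2e^{-\alpha|\xi|^2}d\mu(\xi)$.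
   Formalization: The positive Borel measure μ is assumed finite on compact sets (for an infinite point mass at 0, (c) holds but (a) and (b) fail), and weights vanishing almost everywhere are excluded. *)

theory Defs
  imports
    "HOL-Complex_Analysis.Complex_Analysis"
    "HOL-Probability.Essential_Supremum"
begin

section \<open>Weights and the restricted Muckenhoupt classes\<close>

text \<open>A weight that vanishes almost everywhere is excluded explicitly: it only passes
  the conditions below through the convention \<open>0 * \<infinity> = 0\<close> on \<^typ>\<open>ennreal\<close>, and
  the weighted Fock norm of such a weight is not a norm.\<close>

definition weight :: "(complex \<Rightarrow> real) \<Rightarrow> bool" where
  "weight w \<longleftrightarrow>
     (\<forall>z. 0 \<le> w z) \<and>
     (\<forall>K. compact K \<longrightarrow> w absolutely_integrable_on K) \<and>
     \<not> (AE z in lebesgue. w z = 0)"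

definition wmass :: "(complex \<Rightarrow> real) \<Rightarrow> complex set \<Rightarrow> ennreal" where
  "wmass w E = (\<integral>\<^sup>+ z\<in>E. ennreal (w z) \<partial>lebesgue)"

text \<open>The closed axis-parallel square with lower left corner \<open>c\<close> and side length \<open>r\<close>.\<close>

definition square :: "complex \<Rightarrow> real \<Rightarrow> complex set" where
  "square c r = cbox c (c + Complex r r)"

definition avg :: "complex set \<Rightarrow> (complex \<Rightarrow> ennreal) \<Rightarrow> ennreal" where
  "avg Q f = (\<integral>\<^sup>+ z\<in>Q. f z \<partial>lebesgue) / emeasure lebesgue Q"

text \<open>Powers on \<open>[0, \<infinity>]\<close> with a positive exponent.  The negative power \<open>w powr (- a)\<close> is
  written \<open>epowr (inverse w) a\<close>, which is \<open>\<infinity>\<close> where \<open>w\<close> vanishes; the real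
  function \<open>powr\<close> would give \<open>0\<close> there.\<close>

definition epowr :: "ennreal \<Rightarrow> real \<Rightarrow> ennreal" where
  "epowr x a = (if x = \<infinity> then \<infinity> else ennreal (enn2real x powr a))"

definition conj_exponent :: "real \<Rightarrow> real" where
  "conj_exponent p = p / (p - 1)"

definition Ap_restricted :: "real \<Rightarrow> (complex \<Rightarrow> real) set" where
  "Ap_restricted p =
     {w. weight w \<and>
         (\<exists>r>0. (SUP c.
            avg (square c r) (\<lambda>z. ennreal (w z)) *
            epowr (avg (square c r)
                     (\<lambda>z. epowr (inverse (ennreal (w z))) (conj_exponent p / p)))
              (p / conj_exponent p)) < \<infinity>)}"

definition A1_restricted :: "(complex \<Rightarrow> real) set" where
  "A1_restricted =
     {w. weight w \<and>
         (\<exists>r>0. (SUP c.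
            avg (square c r) (\<lambda>z. ennreal (w z)) *
            esssup (restrict_space lebesgue (square c r)) (\<lambda>z. inverse (ennreal (w z)))) < \<infinity>)}"

definition Ainf_restricted :: "(complex \<Rightarrow> real) set" where
  "Ainf_restricted = A1_restricted \<union> (\<Union>p\<in>{1<..}. Ap_restricted p)"

section \<open>The weighted Fock space\<close>

definition fock :: "real \<Rightarrow> (complex \<Rightarrow> real) \<Rightarrow> (complex \<Rightarrow> complex) set" where
  "fock \<alpha> w =
     {f. f holomorphic_on UNIV \<and>
         integrable lebesgue (\<lambda>z. (cmod (f z))\<^sup>2 * exp (- \<alpha> * (cmod z)\<^sup>2) * w z)}"

definition fock_norm :: "real \<Rightarrow> (complex \<Rightarrow> real) \<Rightarrow> (complex \<Rightarrow> complex) \<Rightarrow> real" where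
  "fock_norm \<alpha> w f =
     sqrt (LINT z|lebesgue. (cmod (f z))\<^sup>2 * exp (- \<alpha> * (cmod z)\<^sup>2) * w z)"

definition fock_inner ::
    "real \<Rightarrow> (complex \<Rightarrow> real) \<Rightarrow> (complex \<Rightarrow> complex) \<Rightarrow> (complex \<Rightarrow> complex) \<Rightarrow> complex" where
  "fock_inner \<alpha> w f g =
     (LINT z|lebesgue. f z * cnj (g z) * of_real (exp (- \<alpha> * (cmod z)\<^sup>2) * w z))"

definition fock_dist ::
    "real \<Rightarrow> (complex \<Rightarrow> real) \<Rightarrow> (complex \<Rightarrow> complex) \<Rightarrow> (complex \<Rightarrow> complex) \<Rightarrow> real" where
  "fock_dist \<alpha> w f g = fock_norm \<alpha> w (\<lambda>z. f z - g z)"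

definition fock_kernel :: "real \<Rightarrow> (complex \<Rightarrow> real) \<Rightarrow> complex \<Rightarrow> complex \<Rightarrow> complex" where
  "fock_kernel \<alpha> w z =
     (THE B. B \<in> fock \<alpha> w \<and> (\<forall>f\<in>fock \<alpha> w. f z = fock_inner \<alpha> w f B))"

definition fock_kernel_normalized ::
    "real \<Rightarrow> (complex \<Rightarrow> real) \<Rightarrow> complex \<Rightarrow> complex \<Rightarrow> complex" where
  "fock_kernel_normalized \<alpha> w z =
     (\<lambda>\<xi>. fock_kernel \<alpha> w z \<xi> / of_real (fock_norm \<alpha> w (fock_kernel \<alpha> w z)))"

definition compact_operator_on_fock ::
    "real \<Rightarrow> (complex \<Rightarrow> real) \<Rightarrow> ((complex \<Rightarrow> complex) \<Rightarrow> complex \<Rightarrow> complex) \<Rightarrow> bool" where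
  "compact_operator_on_fock \<alpha> w T \<longleftrightarrow>
     T ` fock \<alpha> w \<subseteq> fock \<alpha> w \<and>
     (\<forall>f\<in>fock \<alpha> w. \<forall>g\<in>fock \<alpha> w. \<forall>a b.
        T (\<lambda>z. a * f z + b * g z) = (\<lambda>z. a * T f z + b * T g z)) \<and>
     (let X = Metric_space.mtopology (fock \<alpha> w) (fock_dist \<alpha> w)
      in compactin X (X closure_of (T ` {f \<in> fock \<alpha> w. fock_norm \<alpha> w f \<le> 1})))"

section \<open>Toeplitz operators, averages and Berezin transforms\<close>

definition toeplitz_integrand ::
    "real \<Rightarrow> (complex \<Rightarrow> real) \<Rightarrow> (complex \<Rightarrow> complex) \<Rightarrow> complex \<Rightarrow> complex \<Rightarrow> complex" where
  "toeplitz_integrand \<alpha> w f z \<xi> =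
     f \<xi> * cnj (fock_kernel \<alpha> w z \<xi>) * of_real (exp (- \<alpha> * (cmod \<xi>)\<^sup>2))"

definition toeplitz ::
    "real \<Rightarrow> (complex \<Rightarrow> real) \<Rightarrow> complex measure \<Rightarrow> (complex \<Rightarrow> complex) \<Rightarrow> complex \<Rightarrow> complex" where
  "toeplitz \<alpha> w \<mu> f z = (LINT \<xi>|\<mu>. toeplitz_integrand \<alpha> w f z \<xi>)"

text \<open>The integral defining the Toeplitz operator need not converge for a general measure
  (and \<^const>\<open>lebesgue_integral\<close> is \<open>0\<close> when it does not), so compactness includes that
  the operator is defined on the whole space.\<close>

definition toeplitz_compact ::
    "real \<Rightarrow> (complex \<Rightarrow> real) \<Rightarrow> complex measure \<Rightarrow> bool" where
  "toeplitz_compact \<alpha> w \<mu> \<longleftrightarrow>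
     (\<forall>f\<in>fock \<alpha> w. \<forall>z. integrable \<mu> (toeplitz_integrand \<alpha> w f z)) \<and>
     compact_operator_on_fock \<alpha> w (toeplitz \<alpha> w \<mu>)"

definition average_function ::
    "(complex \<Rightarrow> real) \<Rightarrow> complex measure \<Rightarrow> real \<Rightarrow> complex \<Rightarrow> ennreal" where
  "average_function w \<mu> r z = emeasure \<mu> (ball z r) / wmass w (ball z r)"

definition berezin ::
    "real \<Rightarrow> (complex \<Rightarrow> real) \<Rightarrow> complex measure \<Rightarrow> complex \<Rightarrow> ennreal" where
  "berezin \<alpha> w \<mu> z =
     (\<integral>\<^sup>+ \<xi>. ennreal ((cmod (fock_kernel_normalized \<alpha> w z \<xi>))\<^sup>2 * exp (- \<alpha> * (cmod \<xi>)\<^sup>2)) \<partial>\<mu>)"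

text \<open>A positive Borel measure on the plane, finite on compact sets.  Local finiteness is
  needed: decay of the averages at infinity says nothing about an infinite point mass at the
  origin, for which the Berezin transform is infinite wherever the kernel does not vanish there.\<close>

definition positive_borel_measure :: "complex measure \<Rightarrow> bool" where
  "positive_borel_measure \<mu> \<longleftrightarrow>
     sets \<mu> = sets borel \<and> (\<forall>K. compact K \<longrightarrow> emeasure \<mu> K < \<infinity>)"

end

(*
  A restricted Muckenhoupt weight enters only through one estimate: w(D(z,1)) s^m is at most
  C exp(kappa |z - zeta|) w(D(zeta,s)) for 0 < s <= 1. Maximising |g|^2 (rho - |xi - z|)^m over a
  disc and using the Lipschitz bound near the maximum then gives |g(z)|^2 w(D(z,1)) <= K times the
  integral of |g|^2 w over D(z,rho) for entire g, and multiplication of f by a Gaussian factor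
  exp(-alpha xi conj(z)) transfers this to the Fock weight. Testing against exp(alpha xi conj(z))
  bounds the kernel from below on the diagonal by exp(alpha |z|^2) / w(D(z,1)), up to a constant.

  (a) => (b): the Berezin transform at z is T b_z (z) / |B_z|. A norm limit F of a subsequence of
  the functions T b_z satisfies |F(z)| / |B_z| -> 0.
  (b) => (c): |b_z|^2 exp(-alpha |xi|^2) is at least c / w(D(z,1)) on D(z,delta).
  (c) => (a): integrating the point estimate against mu (Fubini) shows that mu restricted to
  |xi| > R is a Carleson measure with constant tending to 0; a bounded sequence in the Fock space
  has a locally uniformly convergent subsequence (Montel), on which T therefore converges in norm.
*)
theory Submission
  imports Defs
begin

section \<open>Square integrable functions\<close>

text \<open>The obstacle is that \<open>w\<close> may vanish or oscillate at small scales, so entire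
  functions cannot be averaged against it by subharmonicity. What survives of the Muckenhoupt
  condition on squares of one fixed size is a power bound: a subset of a square carries at least a
  fixed multiple of the mass of the square times a power of the area of the subset. Discs have area
  a multiple of s^2, which gives the exponent \<open>m\<close>; chaining overlapping squares gives
  \<open>\<kappa>\<close>, and any exponential rate is harmless against a Gaussian. The Gaussian is
  put into the measures, so the functional analysis only sees entire functions with bounded point
  evaluations; there Montel and Fatou do the work of weak compactness and completeness. With J the
  embedding of the Fock space into L2 of the Gaussian-weighted \<mu>, the Toeplitz operator is J* J
  whenever J is bounded, so compactness can be tested on J. The radius \<open>\<delta>\<close> is
  the size of the discs on which the kernel at the centre is known to stay away from zero.\<close>

definition sq_int :: "complex measure \<Rightarrow> (complex \<Rightarrow> complex) \<Rightarrow> bool" where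
  "sq_int M f \<longleftrightarrow> f \<in> borel_measurable M \<and> integrable M (\<lambda>x. (cmod (f x))\<^sup>2)"

definition sqn :: "complex measure \<Rightarrow> (complex \<Rightarrow> complex) \<Rightarrow> real" where
  "sqn M f = (LINT x|M. (cmod (f x))\<^sup>2)"

definition ip :: "complex measure \<Rightarrow> (complex \<Rightarrow> complex) \<Rightarrow> (complex \<Rightarrow> complex) \<Rightarrow> complex" where
  "ip M f g = (LINT x|M. f x * cnj (g x))"

lemma sqn_nonneg: "0 \<le> sqn M f"
  unfolding sqn_def by simp

lemma norm_mult_le_squares: "cmod (a * cnj b) \<le> (cmod a)\<^sup>2 + (cmod b)\<^sup>2"
proof -
  have "0 \<le> cmod a * cmod b" by simp
  then show ?thesis
    using sum_squares_bound[of "cmod a" "cmod b"] by (simp add: norm_mult del: mult_nonneg_nonneg zero_le_mult_iff)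
qed

lemma integrable_ip:
  assumes "sq_int M f" "sq_int M g"
  shows "integrable M (\<lambda>x. f x * cnj (g x))"
proof (rule Bochner_Integration.integrable_bound)
  show "integrable M (\<lambda>x. (cmod (f x))\<^sup>2 + (cmod (g x))\<^sup>2)"
    using assms by (simp add: sq_int_def)
  have [measurable]: "f \<in> borel_measurable M" "g \<in> borel_measurable M"
    using assms by (auto simp: sq_int_def)
  have "cnj \<in> borel_measurable borel"
    by (intro borel_measurable_continuous_onI continuous_intros)
  then have [measurable]: "(\<lambda>x. cnj (g x)) \<in> borel_measurable M"
    by (rule measurable_compose[rotated]) fact
  show "(\<lambda>x. f x * cnj (g x)) \<in> borel_measurable M"
    by measurable
qed (use norm_mult_le_squares in auto)

lemma sq_int_scale: "sq_int M f \<Longrightarrow> sq_int M (\<lambda>x. a * f x)"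
  by (auto simp: sq_int_def norm_mult power_mult_distrib)

lemma sq_int_add:
  assumes "sq_int M f" "sq_int M g"
  shows "sq_int M (\<lambda>x. f x + g x)"
proof -
  have [measurable]: "f \<in> borel_measurable M" "g \<in> borel_measurable M"
    using assms by (auto simp: sq_int_def)
  have "integrable M (\<lambda>x. (cmod (f x + g x))\<^sup>2)"
  proof (rule Bochner_Integration.integrable_bound)
    show "integrable M (\<lambda>x. 2 * (cmod (f x))\<^sup>2 + 2 * (cmod (g x))\<^sup>2)"
      using assms by (auto simp: sq_int_def)
    have "(cmod (a + b))\<^sup>2 \<le> 2 * (cmod a)\<^sup>2 + 2 * (cmod b)\<^sup>2" for a b :: complex
    proof -
      have "(cmod (a + b))\<^sup>2 \<le> (cmod a + cmod b)\<^sup>2"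
        by (intro power_mono norm_triangle_ineq) auto
      also have "\<dots> \<le> 2 * (cmod a)\<^sup>2 + 2 * (cmod b)\<^sup>2"
        using sum_squares_bound[of "cmod a" "cmod b"] by (simp add: power2_sum)
      finally show ?thesis .
    qed
    then show "AE x in M. norm ((cmod (f x + g x))\<^sup>2) \<le> norm (2 * (cmod (f x))\<^sup>2 + 2 * (cmod (g x))\<^sup>2)"
      by simp
  qed measurable
  then show ?thesis by (simp add: sq_int_def)
qed

lemma sq_int_lincomb:
  "sq_int M f \<Longrightarrow> sq_int M g \<Longrightarrow> sq_int M (\<lambda>x. a * f x + b * g x)"
  by (intro sq_int_add sq_int_scale)

lemma ip_lincomb_left:
  assumes "sq_int M f" "sq_int M g" "sq_int M h"
  shows "ip M (\<lambda>x. a * f x + b * g x) h = a * ip M f h + b * ip M g h"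
proof -
  have "ip M (\<lambda>x. a * f x + b * g x) h
      = (LINT x|M. a * (f x * cnj (h x)) + b * (g x * cnj (h x)))"
    unfolding ip_def by (simp add: algebra_simps)
  also have "\<dots> = a * ip M f h + b * ip M g h"
    unfolding ip_def using assms by (subst Bochner_Integration.integral_add) (auto intro: integrable_ip)
  finally show ?thesis .
qed

lemma ip_cnj: "ip M g f = cnj (ip M f g)"
proof -
  have "cnj (ip M f g) = (LINT x|M. cnj (f x * cnj (g x)))"
    unfolding ip_def by (rule Bochner_Integration.integral_cnj[symmetric])
  then show ?thesis by (simp add: ip_def mult.commute)
qed

lemma ip_self: "ip M f f = of_real (sqn M f)"
  unfolding ip_def sqn_def
  by (subst integral_complex_of_real[symmetric]) (simp only: complex_norm_square)

text \<open>The expansion from which Cauchy-Schwarz, the triangle inequality, the parallelogram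
  identity and the orthogonality in \<open>riesz\<close> are read off by a choice of
  \<open>t\<close>.\<close>

lemma sqn_add_scale:
  assumes "sq_int M f" "sq_int M g"
  shows "sqn M (\<lambda>x. f x + t * g x)
       = sqn M f + (cmod t)\<^sup>2 * sqn M g + 2 * Re (cnj t * ip M f g)"
proof -
  have "(cmod (a + t * b))\<^sup>2 = (cmod a)\<^sup>2 + (cmod t)\<^sup>2 * (cmod b)\<^sup>2 + 2 * Re (cnj t * (a * cnj b))"
    for a b
    unfolding cmod_power2 by (simp add: power2_eq_square algebra_simps)
  then have "sqn M (\<lambda>x. f x + t * g x)
     = (LINT x|M. (cmod (f x))\<^sup>2 + (cmod t)\<^sup>2 * (cmod (g x))\<^sup>2 + 2 * Re (cnj t * (f x * cnj (g x))))"
    unfolding sqn_def by presburger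
  also have "\<dots> = sqn M f + (cmod t)\<^sup>2 * sqn M g + 2 * (LINT x|M. Re (cnj t * (f x * cnj (g x))))"
  proof -
    have i: "integrable M (\<lambda>x. Re (cnj t * (f x * cnj (g x))))"
      using assms by (intro integrable_Re integrable_mult_right integrable_ip)
    have "integrable M (\<lambda>x. (cmod (f x))\<^sup>2)" "integrable M (\<lambda>x. (cmod (g x))\<^sup>2)"
      using assms by (auto simp: sq_int_def)
    then show ?thesis
      unfolding sqn_def using i
      by (subst Bochner_Integration.integral_add;
          (subst Bochner_Integration.integral_add)?;
          (intro Bochner_Integration.integrable_add integrable_mult_right | simp only: integral_mult_right_zero)?;
          assumption?)
  qed
  also have "(LINT x|M. Re (cnj t * (f x * cnj (g x)))) = Re (LINT x|M. cnj t * (f x * cnj (g x)))"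
    by (rule integral_Re) (use assms integrable_ip in auto)
  also have "(LINT x|M. cnj t * (f x * cnj (g x))) = cnj t * ip M f g"
    unfolding ip_def by simp
  finally show ?thesis .
qed

lemma sqn_scale: "sqn M (\<lambda>x. a * f x) = (cmod a)\<^sup>2 * sqn M f"
  unfolding sqn_def by (simp add: norm_mult power_mult_distrib)

lemma sqn_minus_commute: "sqn M (\<lambda>x. f x - g x) = sqn M (\<lambda>x. g x - f x)"
  unfolding sqn_def by (simp add: norm_minus_commute)

text \<open>Functions are not identified almost everywhere, so \<open>sqn M g = 0\<close> does not
  give \<open>g = 0\<close>; this case is settled by a large \<open>s\<close> instead of the
  minimising one.\<close>

lemma cauchy_schwarz:
  assumes f: "sq_int M f" and g: "sq_int M g"
  shows "(cmod (ip M f g))\<^sup>2 \<le> sqn M f * sqn M g"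
proof -
  define c where "c = ip M f g"
  \<comment> \<open>The phase of \<open>c\<close> in \<open>t = - s * c\<close> makes the cross term
    real, equal to \<open>- 2 * s * (cmod c)\<^sup>2\<close>.\<close>
  have *: "0 \<le> sqn M f + s\<^sup>2 * ((cmod c)\<^sup>2 * sqn M g) - 2 * s * (cmod c)\<^sup>2" for s :: real
  proof -
    have "0 \<le> sqn M (\<lambda>x. f x + (- of_real s * c) * g x)" by (rule sqn_nonneg)
    also have "\<dots> = sqn M f + (cmod (of_real s * c))\<^sup>2 * sqn M g + 2 * Re (- of_real s * (cnj c * c))"
      by (subst sqn_add_scale[OF f g]) (simp add: c_def mult.assoc)
    also have "cnj c * c = of_real ((cmod c)\<^sup>2)"
      by (simp only: complex_norm_square mult.commute)
    also have "Re (- of_real s * of_real ((cmod c)\<^sup>2)) = - s * (cmod c)\<^sup>2"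
      by simp
    finally show ?thesis by (simp add: norm_mult power_mult_distrib algebra_simps)
  qed
  show ?thesis
  proof (cases "sqn M g = 0")
    case True
    have "c = 0"
    proof (rule ccontr)
      assume "c \<noteq> 0"
      then have p: "(cmod c)\<^sup>2 > 0" by simp
      have "2 * ((sqn M f + 1) / (cmod c)\<^sup>2) * (cmod c)\<^sup>2 \<le> sqn M f"
        using *[of "(sqn M f + 1) / (cmod c)\<^sup>2"] True by simp
      then show False using p sqn_nonneg[of M f] by simp
    qed
    then show ?thesis using True by (simp add: c_def)
  next
    case False
    then have p: "sqn M g > 0" using sqn_nonneg[of M g] by simp
    have "0 \<le> sqn M f - (cmod c)\<^sup>2 / sqn M g"
      using *[of "1 / sqn M g"] p by (simp add: power2_eq_square field_simps)
    then show ?thesis using p by (simp add: c_def field_simps)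
  qed
qed

lemma cauchy_schwarz_sqrt:
  assumes "sq_int M f" "sq_int M g"
  shows "cmod (ip M f g) \<le> sqrt (sqn M f) * sqrt (sqn M g)"
  using real_le_rsqrt[OF cauchy_schwarz[OF assms]] by (simp add: real_sqrt_mult)

lemma sqn_triangle:
  assumes "sq_int M f" "sq_int M g"
  shows "sqrt (sqn M (\<lambda>x. f x + g x)) \<le> sqrt (sqn M f) + sqrt (sqn M g)"
proof (rule real_le_lsqrt)
  have "sqn M (\<lambda>x. f x + g x) = sqn M f + sqn M g + 2 * Re (ip M f g)"
    using sqn_add_scale[OF assms, of 1] by simp
  also have "Re (ip M f g) \<le> sqrt (sqn M f) * sqrt (sqn M g)"
    using cauchy_schwarz_sqrt[OF assms] complex_Re_le_cmod order_trans by blast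
  finally show "sqn M (\<lambda>x. f x + g x) \<le> (sqrt (sqn M f) + sqrt (sqn M g))\<^sup>2"
    by (simp add: power2_sum sqn_nonneg)
qed (simp add: sqn_nonneg)

lemma nn_integral_sq:
  assumes "sq_int M f"
  shows "(\<integral>\<^sup>+x. ennreal ((cmod (f x))\<^sup>2) \<partial>M) = ennreal (sqn M f)"
  using assms unfolding sqn_def sq_int_def by (intro nn_integral_eq_integral) auto

lemma sq_intI_nn:
  assumes "f \<in> borel_measurable M" "(\<integral>\<^sup>+x. ennreal ((cmod (f x))\<^sup>2) \<partial>M) \<le> ennreal B" "0 \<le> B"
  shows "sq_int M f" "sqn M f \<le> B"
proof -
  show *: "sq_int M f"
    unfolding sq_int_def
    using assms by (auto intro!: integrableI_bounded simp: le_less_trans)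
  show "sqn M f \<le> B"
    using assms nn_integral_sq[OF *] by simp
qed

text \<open>A sequence in the closure is shadowed by one in \<open>S\<close> at distance below
  \<open>inverse (Suc n)\<close>, so it suffices to extract convergent subsequences from sequences
  in \<open>S\<close>; their limits may lie anywhere in \<open>M\<close>.\<close>

lemma (in Metric_space) compactin_closure_ofI:
  assumes S: "S \<subseteq> M"
    and conv: "\<And>\<sigma> :: nat \<Rightarrow> 'a. range \<sigma> \<subseteq> S \<Longrightarrow>
      \<exists>l r. l \<in> M \<and> strict_mono r \<and> (\<lambda>n. d (\<sigma> (r n)) l) \<longlonglongrightarrow> 0"
  shows "compactin mtopology (mtopology closure_of S)"
  unfolding compactin_sequentially
proof (intro conjI allI impI)
  show cl: "mtopology closure_of S \<subseteq> M"
    using closure_of_subset_topspace by fastforce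
  fix \<sigma> :: "nat \<Rightarrow> 'a"
  assume \<sigma>: "range \<sigma> \<subseteq> mtopology closure_of S"
  then have "\<exists>y \<in> S. d (\<sigma> n) y < inverse(Suc n)" for n
    by (simp add: metric_closure_of image_subset_iff) (metis inverse_Suc of_nat_Suc)
  then obtain \<tau> where \<tau>: "\<And>n. \<tau> n \<in> S \<and> d (\<sigma> n) (\<tau> n) < inverse(Suc n)"
    by metis
  then obtain l r where l: "l \<in> M" "strict_mono r" and lim: "(\<lambda>n. d (\<tau> (r n)) l) \<longlonglongrightarrow> 0"
    using conv[of \<tau>] by blast
  have \<sigma>M: "\<sigma> n \<in> M" and \<tau>M: "\<tau> n \<in> M" for n
    using \<sigma> \<tau> cl S by blast+
  have "limitin mtopology (\<lambda>n. \<tau> (r n)) l sequentially"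
    using l lim \<tau>M by (simp add: limitin_metric_dist_null)
  then have "l \<in> mtopology closure_of S"
    unfolding metric_closure_of limit_metric_sequentially
    using \<tau> by (auto simp: in_mball) (metis commute order_refl)
  moreover have "(\<lambda>n. d (\<sigma> (r n)) l) \<longlonglongrightarrow> 0"
  proof (rule tendsto_sandwich[OF _ _ tendsto_const])
    have "(\<lambda>n. inverse (real (Suc n))) \<longlonglongrightarrow> 0"
      using LIMSEQ_inverse_real_of_nat by simp
    from LIMSEQ_subseq_LIMSEQ[OF this l(2)]
    show "(\<lambda>n. inverse (real (Suc (r n))) + d (\<tau> (r n)) l) \<longlonglongrightarrow> 0"
      using tendsto_add[OF _ lim] by (fastforce simp: o_def)
    show "eventually (\<lambda>n. d (\<sigma> (r n)) l \<le> inverse (real (Suc (r n))) + d (\<tau> (r n)) l) sequentially"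
      using triangle[OF \<sigma>M \<tau>M \<open>l \<in> M\<close>] \<tau> by (smt (verit) always_eventually)
  qed auto
  ultimately show "\<exists>l r. l \<in> mtopology closure_of S \<and> strict_mono r \<and> limitin mtopology (\<sigma> \<circ> r) l sequentially"
    using l \<sigma>M by (auto simp: limitin_metric_dist_null o_def)
qed


section \<open>Hilbert spaces of entire functions\<close>

lemma le_of_le_inverse_Suc:
  fixes x c k :: real
  assumes "\<And>i :: nat. x \<le> c + k / real (Suc i)"
  shows "x \<le> c"
proof (rule LIMSEQ_le_const)
  have "(\<lambda>i. c + k * inverse (real (Suc i))) \<longlonglongrightarrow> c + k * 0"
    by (intro tendsto_intros LIMSEQ_inverse_real_of_nat)
  then show "(\<lambda>i. c + k / real (Suc i)) \<longlonglongrightarrow> c" by (simp add: divide_inverse)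
qed (use assms in blast)

text \<open>\<open>N\<close> is meant to contain the Gaussian factor. The constant in
  \<open>point_bound\<close> depends on \<open>R\<close> alone: this makes the seminorm a norm on
  entire functions and turns norm bounds into the local boundedness that Montel's theorem asks
  for.\<close>

locale entire_space =
  fixes N :: "complex measure"
  assumes sets_N: "sets N = sets borel"
    and point_bound: "\<And>R. \<exists>K. \<forall>f z. f holomorphic_on UNIV \<longrightarrow>
      integrable N (\<lambda>x. (cmod (f x))\<^sup>2) \<longrightarrow> cmod z \<le> R \<longrightarrow> (cmod (f z))\<^sup>2 \<le> K * sqn N f"
begin

definition A :: "(complex \<Rightarrow> complex) set" where
  "A = {f. f holomorphic_on UNIV \<and> integrable N (\<lambda>x. (cmod (f x))\<^sup>2)}"

definition d :: "(complex \<Rightarrow> complex) \<Rightarrow> (complex \<Rightarrow> complex) \<Rightarrow> real" where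
  "d f g = sqrt (sqn N (\<lambda>z. f z - g z))"

lemma measurable_entire:
  assumes "f holomorphic_on UNIV" "sets M = sets borel"
  shows "f \<in> borel_measurable M"
proof -
  have "f \<in> borel_measurable borel"
    using assms holomorphic_on_imp_continuous_on by (intro borel_measurable_continuous_onI) auto
  then show ?thesis using assms measurable_cong_sets by blast
qed

lemma A_sq_int: "f \<in> A \<Longrightarrow> sq_int N f"
  unfolding A_def sq_int_def using measurable_entire sets_N by auto

lemma A_I: "f holomorphic_on UNIV \<Longrightarrow> sq_int N f \<Longrightarrow> f \<in> A"
  unfolding A_def sq_int_def by auto

lemma A_lincomb: "f \<in> A \<Longrightarrow> g \<in> A \<Longrightarrow> (\<lambda>z. a * f z + b * g z) \<in> A"
  using A_sq_int[of f] A_sq_int[of g]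
  by (intro A_I sq_int_lincomb) (auto simp: A_def intro!: holomorphic_intros)

lemma A_diff: "f \<in> A \<Longrightarrow> g \<in> A \<Longrightarrow> (\<lambda>z. f z - g z) \<in> A"
  using A_lincomb[of f g 1 "-1"] by simp

lemma A_scale: "f \<in> A \<Longrightarrow> (\<lambda>z. a * f z) \<in> A"
  using A_lincomb[of f f a 0] by simp

lemma A_zero: "(\<lambda>z. 0) \<in> A"
  unfolding A_def by simp

lemma point_bound_A:
  obtains K where "K \<ge> 0" "\<And>f z. f \<in> A \<Longrightarrow> cmod z \<le> R \<Longrightarrow> (cmod (f z))\<^sup>2 \<le> K * sqn N f"
proof -
  obtain K where K: "\<And>f z. f \<in> A \<Longrightarrow> cmod z \<le> R \<Longrightarrow> (cmod (f z))\<^sup>2 \<le> K * sqn N f"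
    using point_bound[of R] unfolding A_def by auto
  have "(cmod (f z))\<^sup>2 \<le> max K 0 * sqn N f" if "f \<in> A" "cmod z \<le> R" for f z
    using K[OF that] sqn_nonneg[of N f] by (smt (verit) mult_right_mono)
  then show ?thesis by (intro that[of "max K 0"]) auto
qed

lemma sqn_eq_0:
  assumes "f \<in> A" "sqn N f = 0"
  shows "f = (\<lambda>z. 0)"
proof
  fix z
  obtain K where "\<And>f w. f \<in> A \<Longrightarrow> cmod w \<le> cmod z \<Longrightarrow> (cmod (f w))\<^sup>2 \<le> K * sqn N f"
    using point_bound_A by metis
  from this[OF assms(1), of z] show "f z = 0" using assms(2) by simp
qed

sublocale mspace: Metric_space A d
proof
  fix f g h
  show "0 \<le> d f g" "d f g = d g f"
    by (simp_all add: d_def sqn_nonneg sqn_minus_commute[of N f g])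
  show "d f g = 0 \<longleftrightarrow> f = g" if "f \<in> A" "g \<in> A"
  proof
    assume "d f g = 0"
    then have "(\<lambda>z. f z - g z) = (\<lambda>z. 0)"
      using sqn_eq_0[OF A_diff[OF that]] by (simp add: d_def)
    then show "f = g" by (simp add: fun_eq_iff)
  qed (simp add: d_def sqn_def)
  show "d f h \<le> d f g + d g h" if "f \<in> A" "g \<in> A" "h \<in> A"
    using sqn_triangle[OF A_sq_int[OF A_diff[OF that(1,2)]] A_sq_int[OF A_diff[OF that(2,3)]]]
    by (simp add: d_def)
qed

text \<open>Stands in for completeness: a norm bound passes to pointwise limits. Holomorphy of the
  limit is a hypothesis because pointwise convergence does not provide it; in the uses it comes from
  Montel or from membership in \<open>A\<close>.\<close>

lemma fatou_A:
  assumes F: "\<And>n. F n \<in> A" and B: "\<And>n. sqn N (F n) \<le> B"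
    and lim: "\<And>z. (\<lambda>n. F n z) \<longlonglongrightarrow> f z" and hol: "f holomorphic_on UNIV"
  shows "f \<in> A" "sqn N f \<le> B"
proof -
  have B0: "0 \<le> B" using B[of 0] sqn_nonneg[of N "F 0"] by linarith
  have mF: "F n \<in> borel_measurable N" for n using A_sq_int[OF F] by (simp add: sq_int_def)
  have mf: "f \<in> borel_measurable N" by (rule measurable_entire[OF hol sets_N])
  have "(\<integral>\<^sup>+x. ennreal ((cmod (f x))\<^sup>2) \<partial>N) = (\<integral>\<^sup>+x. liminf (\<lambda>n. ennreal ((cmod (F n x))\<^sup>2)) \<partial>N)"
  proof (rule nn_integral_cong)
    fix x
    have "(\<lambda>n. ennreal ((cmod (F n x))\<^sup>2)) \<longlonglongrightarrow> ennreal ((cmod (f x))\<^sup>2)"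
      using lim by (intro tendsto_intros tendsto_ennrealI)
    then show "ennreal ((cmod (f x))\<^sup>2) = liminf (\<lambda>n. ennreal ((cmod (F n x))\<^sup>2))"
      by (rule lim_imp_Liminf[OF trivial_limit_sequentially, symmetric])
  qed
  also have "\<dots> \<le> liminf (\<lambda>n. \<integral>\<^sup>+x. ennreal ((cmod (F n x))\<^sup>2) \<partial>N)"
    using mF by (intro nn_integral_liminf) auto
  also have "\<dots> \<le> liminf (\<lambda>n. ennreal B)"
    using B by (intro Liminf_mono always_eventually)
      (simp add: nn_integral_sq[OF A_sq_int[OF F]] ennreal_leI)
  also have "\<dots> = ennreal B" by (simp add: Liminf_const)
  finally have *: "(\<integral>\<^sup>+x. ennreal ((cmod (f x))\<^sup>2) \<partial>N) \<le> ennreal B" .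
  show "f \<in> A" "sqn N f \<le> B"
    using sq_intI_nn[OF mf * B0] A_I[OF hol] by auto
qed

text \<open>The substitute for weak compactness of balls. Convergence is locally uniform only; mass
  may escape to infinity, so the norm of the limit is merely bounded by \<open>B\<close>.\<close>

lemma montel_A:
  assumes F: "\<And>n. F n \<in> A" and B: "\<And>n. sqn N (F n) \<le> B"
  obtains f r where "f \<in> A" "sqn N f \<le> B" "strict_mono (r :: nat \<Rightarrow> nat)"
    "\<And>z. (\<lambda>n. F (r n) z) \<longlonglongrightarrow> f z"
    "\<And>R. uniform_limit (cball 0 R) (\<lambda>n. F (r n)) f sequentially"
proof -
  have "\<exists>C. \<forall>h\<in>range F. \<forall>z\<in>K. cmod (h z) \<le> C" if K: "compact K" for K
  proof -
    obtain R where R: "\<And>z. z \<in> K \<Longrightarrow> cmod z \<le> R"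
      using compact_imp_bounded[OF K] unfolding bounded_iff by blast
    obtain C where C: "C \<ge> 0" "\<And>f z. f \<in> A \<Longrightarrow> cmod z \<le> R \<Longrightarrow> (cmod (f z))\<^sup>2 \<le> C * sqn N f"
      using point_bound_A by metis
    have "cmod (F n z) \<le> sqrt (C * B)" if "z \<in> K" for n z
      using C(2)[OF F R[OF that], of n] mult_left_mono[OF B[of n] C(1)] by (intro real_le_rsqrt) linarith
    then show ?thesis by blast
  qed
  note bounded = this
  obtain f r where f: "f holomorphic_on UNIV" "strict_mono (r :: nat \<Rightarrow> nat)"
      "\<And>x. (\<lambda>n. F (r n) x) \<longlonglongrightarrow> f x"
      "\<And>K. compact K \<Longrightarrow> uniform_limit K (F \<circ> r) f sequentially"
  proof (rule Montel[of UNIV "range F" F])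
    show "h holomorphic_on UNIV" if "h \<in> range F" for h using that F by (auto simp: A_def)
  qed (use bounded in auto)
  have "f \<in> A" "sqn N f \<le> B"
    using fatou_A[of "\<lambda>n. F (r n)" B f] F B f by auto
  then show ?thesis using that[of f r] f by (auto simp: o_def)
qed

text \<open>The representing function is a multiple of the element of minimal norm on the
  hyperplane \<open>L = 1\<close>.\<close>

lemma riesz:
  assumes lin: "\<And>f g a b. f \<in> A \<Longrightarrow> g \<in> A \<Longrightarrow> L (\<lambda>z. a * f z + b * g z) = a * L f + b * L g"
    and bdd: "\<And>f. f \<in> A \<Longrightarrow> (cmod (L f))\<^sup>2 \<le> M * sqn N f"
  obtains h where "h \<in> A" "\<And>f. f \<in> A \<Longrightarrow> L f = ip N f h"
proof (cases "\<forall>f\<in>A. L f = 0")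
  case True
  then show ?thesis using A_zero by (intro that[of "\<lambda>z. 0"]) (auto simp: ip_def)
next
  case False
  then obtain f0 where f0: "f0 \<in> A" "L f0 \<noteq> 0" by blast
  define S where "S = {f\<in>A. L f = 1}"
  have scale: "L (\<lambda>z. a * f z) = a * L f" if "f \<in> A" for a f
    using lin[OF that that, of a 0] by simp
  have diff: "L (\<lambda>z. f z - g z) = L f - L g" if "f \<in> A" "g \<in> A" for f g
    using lin[OF that, of 1 "-1"] by simp
  have "(\<lambda>z. (1 / L f0) * f0 z) \<in> S"
    unfolding S_def mem_Collect_eq
    using A_scale[OF f0(1), of "1 / L f0"] scale[OF f0(1), of "1 / L f0"] f0(2) by simp
  then have Sne: "sqn N ` S \<noteq> {}" by blast
  define m where "m = Inf (sqn N ` S)"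
  have bb: "bdd_below (sqn N ` S)" using sqn_nonneg by (intro bdd_belowI2[of _ 0])
  have m_le: "m \<le> sqn N f" if "f \<in> S" for f
    unfolding m_def using that bb by (intro cInf_lower) auto
  have "\<exists>f\<in>S. sqn N f < m + 1 / real (Suc n)" for n
    using cInf_lessD[OF Sne, of "m + 1 / real (Suc n)"] by (auto simp: m_def)
  then obtain F where FS: "\<And>n. F n \<in> S" and Fm: "\<And>n. sqn N (F n) < m + 1 / real (Suc n)"
    by metis
  have FA: "F n \<in> A" and LF: "L (F n) = 1" for n using FS[of n] by (auto simp: S_def)
  have Fsq: "sq_int N (F n)" for n using A_sq_int[OF FA] .
  \<comment> \<open>Parallelogram identity: the midpoint of \<open>F i\<close> and
    \<open>F j\<close> is again in \<open>S\<close>, so the sum has squared norm at least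
    \<open>4 * m\<close>, which leaves little for the difference.\<close>
  have para: "sqn N (\<lambda>z. F i z - F j z) \<le> 2 / real (Suc i) + 2 / real (Suc j)" for i j
  proof -
    have 1: "sqn N (\<lambda>z. F i z - F j z) + sqn N (\<lambda>z. F i z + F j z) = 2 * sqn N (F i) + 2 * sqn N (F j)"
      using sqn_add_scale[OF Fsq[of i] Fsq[of j], of "-1"] sqn_add_scale[OF Fsq[of i] Fsq[of j], of 1]
      by simp
    have "(\<lambda>z. (1/2) * F i z + (1/2) * F j z) \<in> S"
      unfolding S_def mem_Collect_eq
      using A_lincomb[OF FA FA, of "1/2" i "1/2" j] lin[OF FA FA, of "1/2" i "1/2" j] LF by simp
    then have "m \<le> sqn N (\<lambda>z. (1/2) * (F i z + F j z))"
      using m_le by (simp add: distrib_left)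
    then have "4 * m \<le> sqn N (\<lambda>z. F i z + F j z)"
      unfolding sqn_scale by (simp add: power2_eq_square)
    moreover have "2 / real (Suc k) = 2 * (1 / real (Suc k))" for k by simp
    ultimately show ?thesis using 1 Fm[of i] Fm[of j] by linarith
  qed
  have "sqn N (F n) \<le> m + 1" for n
  proof -
    have "1 / real (Suc n) \<le> 1" by simp
    then show ?thesis using Fm[of n] by linarith
  qed
  then obtain f r where f: "f \<in> A" and r: "strict_mono (r :: nat \<Rightarrow> nat)"
      and lim: "\<And>z. (\<lambda>n. F (r n) z) \<longlonglongrightarrow> f z"
    using montel_A[of F "m + 1"] FA by metis
  have hol: "f holomorphic_on UNIV" using f by (simp add: A_def)
  \<comment> \<open>\<open>r k \<ge> k\<close> for strictly monotone \<open>r\<close>; shifting the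
    sequence by \<open>i\<close> makes the bounds below uniform in \<open>n\<close>, as
    \<open>fatou_A\<close> requires.\<close>
  have inv_le: "1 / real (Suc (r (n + i))) \<le> 1 / real (Suc i)" for n i
  proof -
    have "i \<le> r (n + i)" using seq_suble[OF r, of "n + i"] by linarith
    then show ?thesis by (simp add: frac_le)
  qed
  have lim': "(\<lambda>n. F (r (n + i)) z) \<longlonglongrightarrow> f z" for i z
    using LIMSEQ_ignore_initial_segment[OF lim] .
  have "sqn N f \<le> m + 1 / real (Suc i)" for i
  proof (rule fatou_A(2)[OF _ _ lim' hol])
    show "F (r (n + i)) \<in> A" for n by (rule FA)
    show "sqn N (F (r (n + i))) \<le> m + 1 / real (Suc i)" for n
      using Fm[of "r (n + i)"] inv_le[of n i] by linarith
  qed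
  then have "sqn N f \<le> m"
    by (rule le_of_le_inverse_Suc)
  \<comment> \<open>Fatou with \<open>i\<close> fixed turns the Cauchy estimate \<open>para\<close>
    into convergence in norm to \<open>f\<close>.\<close>
  have conv: "sqn N (\<lambda>z. f z - F (r i) z) \<le> 4 / real (Suc i)" for i
  proof (rule fatou_A(2))
    show "(\<lambda>z. F (r (n + i)) z - F (r i) z) \<in> A" for n using A_diff[OF FA FA] .
    show "sqn N (\<lambda>z. F (r (n + i)) z - F (r i) z) \<le> 4 / real (Suc i)" for n
      using para[of "r (n + i)" "r i"] inv_le[of n i] inv_le[of 0 i] by simp
    show "(\<lambda>n. F (r (n + i)) z - F (r i) z) \<longlonglongrightarrow> f z - F (r i) z" for z
      by (intro tendsto_intros lim')
    show "(\<lambda>z. f z - F (r i) z) holomorphic_on UNIV"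
      using A_diff[OF f FA[of "r i"]] by (simp add: A_def)
  qed
  have M0: "M \<ge> 0"
    using bdd[OF f0(1)] f0(2) sqn_nonneg[of N f0]
    by (smt (verit) mult_nonneg_nonneg mult_nonneg_nonpos2 mult.commute zero_less_norm_iff zero_less_power2 norm_eq_zero power2_less_eq_zero_iff)
  have "(cmod (L f - 1))\<^sup>2 \<le> 0 + 4 * M / real (Suc i)" for i
  proof -
    have "(cmod (L f - 1))\<^sup>2 = 0 + (cmod (L (\<lambda>z. f z - F (r i) z)))\<^sup>2"
      using diff[OF f FA] LF by simp
    also have "\<dots> \<le> 0 + M * sqn N (\<lambda>z. f z - F (r i) z)"
      by (intro add_left_mono bdd[OF A_diff[OF f FA]])
    also have "\<dots> \<le> 0 + M * (4 / real (Suc i))"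
      using conv M0 by (intro add_left_mono mult_left_mono)
    also have "\<dots> = 0 + 4 * M / real (Suc i)" by simp
    finally show ?thesis .
  qed
  then have "(cmod (L f - 1))\<^sup>2 \<le> 0"
    by (rule le_of_le_inverse_Suc)
  then have Lf: "L f = 1" by simp
  then have fS: "f \<in> S" using f by (simp add: S_def)
  have fpos: "sqn N f > 0"
    using bdd[OF f] Lf sqn_nonneg[of N f] by (cases "sqn N f = 0") auto
  \<comment> \<open>\<open>f\<close> minimises the norm on \<open>S\<close>, and adding multiples of
    \<open>g\<close> stays in \<open>S\<close>; a nonzero inner product would give a direction of
    descent.\<close>
  have orth: "ip N f g = 0" if g: "g \<in> A" "L g = 0" for g
  proof (rule ccontr)
    define c where "c = ip N f g"
    assume "ip N f g \<noteq> 0"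
    then have c: "(cmod c)\<^sup>2 > 0" by (simp add: c_def)
    have *: "0 \<le> s\<^sup>2 * (cmod c)\<^sup>2 * sqn N g - 2 * s * (cmod c)\<^sup>2" for s :: real
    proof -
      have "(\<lambda>z. 1 * f z + (- of_real s * c) * g z) \<in> S"
        using A_lincomb[OF f g(1), of 1 "- of_real s * c"] lin[OF f g(1), of 1 "- of_real s * c"] g Lf
        unfolding S_def by simp
      then have "m \<le> sqn N (\<lambda>z. f z + (- of_real s * c) * g z)" using m_le by simp
      also have "\<dots> = sqn N f + (cmod (of_real s * c))\<^sup>2 * sqn N g + 2 * Re (- of_real s * (cnj c * c))"
        by (subst sqn_add_scale[OF A_sq_int[OF f] A_sq_int[OF g(1)]]) (simp add: c_def mult.assoc)
      also have "cnj c * c = of_real ((cmod c)\<^sup>2)"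
        by (simp only: complex_norm_square mult.commute)
      also have "Re (- of_real s * of_real ((cmod c)\<^sup>2)) = - s * (cmod c)\<^sup>2"
        by simp
      finally show ?thesis using \<open>sqn N f \<le> m\<close>
        by (simp add: norm_mult power_mult_distrib algebra_simps)
    qed
    \<comment> \<open>Any \<open>s > 0\<close> with \<open>s * sqn N g < 2\<close> contradicts
      \<open>*\<close>; the summand 1 covers \<open>sqn N g = 0\<close>.\<close>
    define s where "s = 1 / (1 + sqn N g)"
    have s: "s > 0" "s * sqn N g \<le> 1"
      using sqn_nonneg[of N g] by (auto simp: s_def field_simps)
    have "0 \<le> (s * (cmod c)\<^sup>2) * (s * sqn N g - 2)"
      using *[of s] by (simp add: power2_eq_square algebra_simps)
    moreover have "s * (cmod c)\<^sup>2 > 0" using s c by simp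
    ultimately have "0 \<le> s * sqn N g - 2" by (simp add: zero_le_mult_iff)
    then show False using s by linarith
  qed
  define h where "h = (\<lambda>z. of_real (1 / sqn N f) * f z)"
  have "L g = ip N g h" if g: "g \<in> A" for g
  proof -
    \<comment> \<open>\<open>g\<close> minus \<open>L g\<close> times \<open>f\<close> is
      annihilated by \<open>L\<close>, hence orthogonal to \<open>f\<close>; this explains the
      scalar \<open>1 / sqn N f\<close> in \<open>h\<close>.\<close>
    have "(\<lambda>z. 1 * g z + (- L g) * f z) \<in> A" "L (\<lambda>z. 1 * g z + (- L g) * f z) = 0"
      using A_lincomb[OF g f, of 1 "- L g"] lin[OF g f, of 1 "- L g"] Lf by simp_all
    from orth[OF this] have "ip N (\<lambda>z. 1 * g z + (- L g) * f z) f = 0"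
      using ip_cnj[of N _ f] by (metis complex_cnj_zero)
    then have "ip N g f = L g * of_real (sqn N f)"
      by (subst (asm) ip_lincomb_left) (use A_sq_int f g in \<open>auto simp: ip_self\<close>)
    moreover have "ip N g h = of_real (1 / sqn N f) * ip N g f"
      unfolding ip_def h_def by (subst integral_mult_right_zero[symmetric]) (simp add: mult_ac)
    ultimately show ?thesis using fpos by simp
  qed
  moreover have "h \<in> A" unfolding h_def by (rule A_scale[OF f])
  ultimately show ?thesis using that by blast
qed

section \<open>Reproducing kernels\<close>

definition kernel :: "complex \<Rightarrow> complex \<Rightarrow> complex" where
  "kernel z = (THE B. B \<in> A \<and> (\<forall>f\<in>A. f z = ip N f B))"

lemma kernel_exists1: "\<exists>!B. B \<in> A \<and> (\<forall>f\<in>A. f z = ip N f B)"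
proof -
  obtain K where K: "\<And>f w. f \<in> A \<Longrightarrow> cmod w \<le> cmod z \<Longrightarrow> (cmod (f w))\<^sup>2 \<le> K * sqn N f"
    using point_bound_A by metis
  obtain B where "B \<in> A" "\<And>f. f \<in> A \<Longrightarrow> f z = ip N f B"
    using riesz[of "\<lambda>f. f z" K] K by auto
  moreover have "B = B'" if B: "B \<in> A \<and> (\<forall>f\<in>A. f z = ip N f B)" "B' \<in> A \<and> (\<forall>f\<in>A. f z = ip N f B')" for B B'
  proof -
    define D where "D = (\<lambda>z. B z - B' z)"
    have D: "D \<in> A" using A_diff B by (simp add: D_def)
    have "ip N D D = cnj (ip N (\<lambda>z. 1 * B z + (-1) * B' z) D)"
      using ip_cnj[of N D D] by (simp add: D_def)
    also have "\<dots> = cnj (1 * ip N B D + (-1) * ip N B' D)"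
      using B D by (subst ip_lincomb_left) (auto intro: A_sq_int)
    also have "\<dots> = ip N D B - ip N D B'" using ip_cnj[of N] by (metis (no_types, lifting) complex_cnj_diff diff_conv_add_uminus mult_1 mult_minus1)
    also have "\<dots> = 0" using B D by (metis diff_self)
    finally have "D = (\<lambda>z. 0)" using sqn_eq_0[OF D] by (simp add: ip_self)
    then show ?thesis by (simp add: D_def fun_eq_iff)
  qed
  ultimately show ?thesis by blast
qed

lemma kernel_A: "kernel z \<in> A" and kernel_repr: "f \<in> A \<Longrightarrow> f z = ip N f (kernel z)"
  unfolding kernel_def using theI'[OF kernel_exists1[of z]] by auto

lemma kernel_diag: "kernel z z = of_real (sqn N (kernel z))"
  using kernel_repr[OF kernel_A, of z z] by (simp add: ip_self)

lemma kernel_bound: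
  assumes "f \<in> A"
  shows "cmod (f z) \<le> sqrt (sqn N f) * sqrt (sqn N (kernel z))"
  using cauchy_schwarz_sqrt[OF A_sq_int[OF assms] A_sq_int[OF kernel_A[of z]]]
  by (simp add: kernel_repr[OF assms, of z, symmetric])

end


section \<open>Toeplitz operators\<close>

context entire_space
begin

definition toep :: "complex measure \<Rightarrow> (complex \<Rightarrow> complex) \<Rightarrow> complex \<Rightarrow> complex" where
  "toep \<tau> f z = ip \<tau> f (kernel z)"

definition compact_op :: "((complex \<Rightarrow> complex) \<Rightarrow> complex \<Rightarrow> complex) \<Rightarrow> bool" where
  "compact_op T \<longleftrightarrow> T ` A \<subseteq> A \<and>
     (\<forall>f\<in>A. \<forall>g\<in>A. \<forall>a b. T (\<lambda>z. a * f z + b * g z) = (\<lambda>z. a * T f z + b * T g z)) \<and>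
     compactin mspace.mtopology (mspace.mtopology closure_of (T ` {f \<in> A. sqrt (sqn N f) \<le> 1}))"

text \<open>With J the embedding of \<open>A\<close> into L2 of \<open>\<tau>\<close>, the operator
  is J* J. It is compact once J takes bounded, locally uniformly convergent sequences to norm
  convergent ones: \<open>vanish\<close> controls J near infinity and \<open>fin\<close> on
  discs.\<close>

lemma toep_compact:
  assumes sets: "sets \<tau> = sets borel"
    and fin: "\<And>R. emeasure \<tau> (cball 0 R) < \<infinity>"
    and carl: "\<And>f. f \<in> A \<Longrightarrow> sq_int \<tau> f" "\<And>f. f \<in> A \<Longrightarrow> sqn \<tau> f \<le> M * sqn N f"
    and vanish: "\<And>e. e > 0 \<Longrightarrow> \<exists>R. \<forall>f\<in>A. (\<integral>\<^sup>+x\<in>-cball 0 R. ennreal ((cmod (f x))\<^sup>2) \<partial>\<tau>) \<le> ennreal (e * sqn N f)"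
  shows "compact_op (toep \<tau>)"
proof -
  define C where "C = max M 0"
  have C0: "C \<ge> 0" by (simp add: C_def)
  have carlC: "sqn \<tau> f \<le> C * sqn N f" if "f \<in> A" for f
    using carl(2)[OF that] mult_right_mono[of M C "sqn N f"] sqn_nonneg[of N f] by (simp add: C_def)
  have T: "toep \<tau> f \<in> A \<and> (\<forall>g\<in>A. ip \<tau> g f = ip N g (toep \<tau> f))" if f: "f \<in> A" for f
  proof -
    have 1: "(cmod (ip \<tau> g f))\<^sup>2 \<le> (C * sqn \<tau> f) * sqn N g" if g: "g \<in> A" for g
    proof -
      have "(cmod (ip \<tau> g f))\<^sup>2 \<le> sqn \<tau> g * sqn \<tau> f"
        by (intro cauchy_schwarz carl f g)
      also have "\<dots> \<le> (C * sqn N g) * sqn \<tau> f"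
        by (intro mult_right_mono carlC g sqn_nonneg)
      finally show ?thesis by (simp add: mult_ac)
    qed
    have 2: "ip \<tau> (\<lambda>z. a * g z + b * h z) f = a * ip \<tau> g f + b * ip \<tau> h f"
      if "g \<in> A" "h \<in> A" for g h a b
      by (intro ip_lincomb_left carl that f)
    \<comment> \<open>Riesz represents the form of \<open>\<tau>\<close> by an element
      \<open>h\<close> of \<open>A\<close>; pairing it with kernels identifies \<open>h\<close> with
      the integral defining \<open>toep \<tau> f\<close>.\<close>
    obtain h where h: "h \<in> A" "\<And>g. g \<in> A \<Longrightarrow> ip \<tau> g f = ip N g h"
      using riesz[of "\<lambda>g. ip \<tau> g f" "C * sqn \<tau> f", OF 2 1] by blast
    have "toep \<tau> f z = h z" for z
    proof -
      have "toep \<tau> f z = cnj (ip \<tau> (kernel z) f)" unfolding toep_def by (rule ip_cnj)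
      also have "\<dots> = cnj (ip N (kernel z) h)" using h(2)[OF kernel_A] by simp
      also have "\<dots> = ip N h (kernel z)" by (rule ip_cnj[symmetric])
      also have "\<dots> = h z" using kernel_repr[OF h(1)] by simp
      finally show ?thesis .
    qed
    then have "toep \<tau> f = h" by (rule ext)
    with h show ?thesis by blast
  qed
  note TA = T[THEN conjunct1]
  have lin: "toep \<tau> (\<lambda>z. a * f z + b * g z) = (\<lambda>z. a * toep \<tau> f z + b * toep \<tau> g z)"
    if "f \<in> A" "g \<in> A" for f g a b
    unfolding toep_def by (intro ext ip_lincomb_left carl that kernel_A)
  \<comment> \<open>Testing the duality with \<open>h = toep \<tau> f\<close> itself gives
    \<open>(sqn N h)\<^sup>2\<close> on the left, and one factor \<open>sqn N h\<close>
    cancels.\<close>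
  have Tbound: "sqn N (toep \<tau> f) \<le> C * sqn \<tau> f" if f: "f \<in> A" for f
  proof -
    define h where "h = toep \<tau> f"
    have h: "h \<in> A" "ip \<tau> h f = of_real (sqn N h)"
      using T[OF f] by (auto simp: h_def ip_self)
    have "(sqn N h)\<^sup>2 = (cmod (ip \<tau> h f))\<^sup>2" by (simp add: h)
    also have "\<dots> \<le> sqn \<tau> h * sqn \<tau> f" by (intro cauchy_schwarz carl f h)
    also have "\<dots> \<le> (C * sqn N h) * sqn \<tau> f" by (intro mult_right_mono carlC h sqn_nonneg)
    finally have *: "sqn N h * sqn N h \<le> sqn N h * (C * sqn \<tau> f)"
      by (simp add: power2_eq_square mult_ac)
    show ?thesis
    proof (cases "sqn N h = 0")
      case True
      then show ?thesis using C0 by (simp add: h_def[symmetric] sqn_nonneg)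
    next
      case False
      then have "sqn N h > 0" using sqn_nonneg[of N h] by linarith
      with * show ?thesis by (simp add: h_def[symmetric])
    qed
  qed
  have conv: "(\<lambda>n. sqn \<tau> (\<lambda>z. F n z - f z)) \<longlonglongrightarrow> 0"
    if F: "\<And>n. F n \<in> A" "\<And>n. sqn N (F n) \<le> 1" and f: "f \<in> A" "sqn N f \<le> 1"
      and unif: "\<And>R. uniform_limit (cball 0 R) F f sequentially" for F f
  proof (rule LIMSEQ_I)
    fix e :: real assume e: "e > 0"
    have G: "(\<lambda>z. F n z - f z) \<in> A" for n using A_diff F f by blast
    have G4: "sqn N (\<lambda>z. F n z - f z) \<le> 4" for n
    proof -
      have "sqrt (sqn N (\<lambda>z. F n z - f z)) \<le> sqrt (sqn N (F n)) + sqrt (sqn N f)"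
        using sqn_triangle[OF A_sq_int[OF F(1)[of n]] sq_int_scale[OF A_sq_int[OF f(1)], of "-1"]]
        using sqn_scale[of N "-1" f] by simp
      also have "\<dots> \<le> 1 + 1" using F(2) f(2) by (intro add_mono) auto
      finally have "sqrt (sqn N (\<lambda>z. F n z - f z)) \<le> sqrt 4" by simp
      then show ?thesis by (simp only: real_sqrt_le_iff)
    qed
    \<comment> \<open>The squared norm of the difference is at most 4, so the tail costs at most
      \<open>e / 4\<close>; the disc costs as much, by uniform convergence with error
      \<open>b\<close>.\<close>
    obtain R where R: "\<And>g. g \<in> A \<Longrightarrow>
        (\<integral>\<^sup>+x\<in>-cball 0 R. ennreal ((cmod (g x))\<^sup>2) \<partial>\<tau>) \<le> ennreal (e / 16 * sqn N g)"
      using vanish[of "e / 16"] e by auto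
    define m where "m = measure \<tau> (cball 0 R)"
    have m0: "m \<ge> 0" by (simp add: m_def)
    have em: "emeasure \<tau> (cball 0 R) = ennreal m"
      using fin[of R] by (simp add: m_def emeasure_eq_ennreal_measure less_top[symmetric])
    \<comment> \<open>\<open>m + 1\<close> avoids division by zero and still gives
      \<open>b\<^sup>2 * m\<close> at most \<open>e / 4\<close>.\<close>
    define b where "b = sqrt (e / (4 * (m + 1)))"
    have b: "b > 0" "b\<^sup>2 * m \<le> e / 4"
    proof -
      show "b > 0" using e m0 by (simp add: b_def)
      have "b\<^sup>2 * m = e / 4 * (m / (m + 1))" using e m0 by (simp add: b_def)
      also have "\<dots> \<le> e / 4 * 1" using e m0 by (intro mult_left_mono) auto
      finally show "b\<^sup>2 * m \<le> e / 4" by simp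
    qed
    obtain n0 where n0: "\<And>n x. n \<ge> n0 \<Longrightarrow> x \<in> cball 0 R \<Longrightarrow> dist (F n x) (f x) < b"
      using unif[of R] b(1) unfolding uniform_limit_sequentially_iff by metis
    have "sqn \<tau> (\<lambda>z. F n z - f z) \<le> e / 2" if n: "n \<ge> n0" for n
    proof (rule sq_intI_nn(2))
      define g where "g = (\<lambda>z. F n z - f z)"
      have g: "g \<in> A" using G by (simp add: g_def)
      then show meas: "(\<lambda>z. F n z - f z) \<in> borel_measurable \<tau>"
        using carl(1) by (simp add: sq_int_def g_def)
      then have [measurable]: "g \<in> borel_measurable \<tau>" by (simp add: g_def)
      have [measurable]: "cball 0 R \<in> sets \<tau>" "- cball 0 R \<in> sets \<tau>"
        using sets by auto
      have "(\<integral>\<^sup>+x. ennreal ((cmod (g x))\<^sup>2) \<partial>\<tau>)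
          = (\<integral>\<^sup>+x. ennreal ((cmod (g x))\<^sup>2) * indicator (cball 0 R) x
               + ennreal ((cmod (g x))\<^sup>2) * indicator (- cball 0 R) x \<partial>\<tau>)"
        by (intro nn_integral_cong) (auto split: split_indicator)
      also have "\<dots> = (\<integral>\<^sup>+x\<in>cball 0 R. ennreal ((cmod (g x))\<^sup>2) \<partial>\<tau>)
          + (\<integral>\<^sup>+x\<in>-cball 0 R. ennreal ((cmod (g x))\<^sup>2) \<partial>\<tau>)"
        by (intro nn_integral_add) measurable
      also have "\<dots> \<le> ennreal (e / 4) + ennreal (e / 4)"
      proof (rule add_mono)
        have "(\<integral>\<^sup>+x\<in>cball 0 R. ennreal ((cmod (g x))\<^sup>2) \<partial>\<tau>) \<le> (\<integral>\<^sup>+x\<in>cball 0 R. ennreal (b\<^sup>2) \<partial>\<tau>)"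
        proof (intro nn_integral_mono)
          fix x
          have "(cmod (g x))\<^sup>2 \<le> b\<^sup>2" if "x \<in> cball 0 R"
            using n0[OF n that] by (intro power_mono) (auto simp: g_def dist_norm)
          then show "ennreal ((cmod (g x))\<^sup>2) * indicator (cball 0 R) x \<le> ennreal (b\<^sup>2) * indicator (cball 0 R) x"
            by (auto split: split_indicator intro!: ennreal_leI)
        qed
        also have "\<dots> = ennreal (b\<^sup>2) * ennreal m"
          using em by (subst nn_integral_cmult_indicator) auto
        also have "\<dots> = ennreal (b\<^sup>2 * m)" using m0 by (simp add: ennreal_mult)
        also have "\<dots> \<le> ennreal (e / 4)" by (intro ennreal_leI b)
        finally show "(\<integral>\<^sup>+x\<in>cball 0 R. ennreal ((cmod (g x))\<^sup>2) \<partial>\<tau>) \<le> ennreal (e / 4)" .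
        have "e / 16 * sqn N g \<le> e / 16 * 4"
          using G4[of n] e by (intro mult_left_mono) (auto simp: g_def)
        then show "(\<integral>\<^sup>+x\<in>-cball 0 R. ennreal ((cmod (g x))\<^sup>2) \<partial>\<tau>) \<le> ennreal (e / 4)"
          using R[OF g] by (elim order_trans) (auto intro!: ennreal_leI)
      qed
      also have "\<dots> = ennreal (e / 2)" using e by (simp add: ennreal_plus[symmetric] del: ennreal_plus)
      finally show "(\<integral>\<^sup>+x. ennreal ((cmod (F n x - f x))\<^sup>2) \<partial>\<tau>) \<le> ennreal (e / 2)"
        by (simp add: g_def)
    qed (use e in auto)
    then have "norm (sqn \<tau> (\<lambda>z. F n z - f z) - 0) < e" if "n \<ge> n0" for n
      using that e sqn_nonneg[of \<tau> "\<lambda>z. F n z - f z"] by fastforce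
    then show "\<exists>no. \<forall>n\<ge>no. norm (sqn \<tau> (\<lambda>z. F n z - f z) - 0) < e" by blast
  qed
  have "compactin mspace.mtopology (mspace.mtopology closure_of (toep \<tau> ` {f \<in> A. sqrt (sqn N f) \<le> 1}))"
  proof (rule mspace.compactin_closure_ofI)
    show "toep \<tau> ` {f \<in> A. sqrt (sqn N f) \<le> 1} \<subseteq> A" by (intro image_subsetI TA) simp
    fix \<sigma> :: "nat \<Rightarrow> complex \<Rightarrow> complex"
    assume "range \<sigma> \<subseteq> toep \<tau> ` {f \<in> A. sqrt (sqn N f) \<le> 1}"
    then have "\<forall>n. \<exists>f. f \<in> A \<and> sqn N f \<le> 1 \<and> \<sigma> n = toep \<tau> f"
      by (simp add: image_subset_iff image_iff Bex_def)
    then obtain F where F: "\<And>n. F n \<in> A" "\<And>n. sqn N (F n) \<le> 1" "\<And>n. \<sigma> n = toep \<tau> (F n)"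
      by metis
    obtain f r where f: "f \<in> A" "sqn N f \<le> 1" and r: "strict_mono (r :: nat \<Rightarrow> nat)"
      and "\<And>z. (\<lambda>n. F (r n) z) \<longlonglongrightarrow> f z"
      and unif: "\<And>R. uniform_limit (cball 0 R) (\<lambda>n. F (r n)) f sequentially"
      by (rule montel_A[of F 1, OF F(1,2)]) (rule that)
    have "(\<lambda>n. d (\<sigma> (r n)) (toep \<tau> f)) \<longlonglongrightarrow> 0"
    proof (rule tendsto_sandwich[OF _ _ tendsto_const])
      have "(\<lambda>n. sqn \<tau> (\<lambda>z. F (r n) z - f z)) \<longlonglongrightarrow> 0"
        by (rule conv[OF F(1,2) f unif])
      then have "(\<lambda>n. sqrt (C * sqn \<tau> (\<lambda>z. F (r n) z - f z))) \<longlonglongrightarrow> sqrt (C * 0)"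
        by (intro tendsto_real_sqrt tendsto_mult tendsto_const)
      then show "(\<lambda>n. sqrt (C * sqn \<tau> (\<lambda>z. F (r n) z - f z))) \<longlonglongrightarrow> 0" by simp
      have "d (\<sigma> (r n)) (toep \<tau> f) \<le> sqrt (C * sqn \<tau> (\<lambda>z. F (r n) z - f z))" for n
      proof -
        have "(\<lambda>z. toep \<tau> (F (r n)) z - toep \<tau> f z) = toep \<tau> (\<lambda>z. F (r n) z - f z)"
          using lin[OF F(1) f(1), of 1 "r n" "-1"] by simp
        then show ?thesis
          using Tbound[OF A_diff[OF F(1)[of "r n"] f(1)]] by (simp add: d_def F(3))
      qed
      then show "eventually (\<lambda>n. d (\<sigma> (r n)) (toep \<tau> f) \<le> sqrt (C * sqn \<tau> (\<lambda>z. F (r n) z - f z))) sequentially"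
        by simp
    qed (auto simp: d_def sqn_nonneg)
    then show "\<exists>l r. l \<in> A \<and> strict_mono r \<and> (\<lambda>n. d (\<sigma> (r n)) l) \<longlonglongrightarrow> 0"
      using TA[OF f(1)] r by blast
  qed
  moreover have "toep \<tau> ` A \<subseteq> A" by (intro image_subsetI TA)
  ultimately show ?thesis unfolding compact_op_def by (intro conjI ballI allI lin)
qed

section \<open>Normalised kernels and the Berezin transform\<close>

definition nkernel :: "complex \<Rightarrow> complex \<Rightarrow> complex" where
  "nkernel z = (\<lambda>\<xi>. kernel z \<xi> / of_real (sqrt (sqn N (kernel z))))"

definition ber :: "complex measure \<Rightarrow> complex \<Rightarrow> ennreal" where
  "ber \<tau> z = (\<integral>\<^sup>+\<xi>. ennreal ((cmod (nkernel z \<xi>))\<^sup>2) \<partial>\<tau>)"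

lemma compact_op_maps: "compact_op T \<Longrightarrow> f \<in> A \<Longrightarrow> T f \<in> A"
  unfolding compact_op_def by (drule conjunct1) blast

lemma compact_op_compactin:
  "compact_op T \<Longrightarrow> compactin mspace.mtopology (mspace.mtopology closure_of (T ` {f \<in> A. sqrt (sqn N f) \<le> 1}))"
  unfolding compact_op_def by (elim conjE)

text \<open>Evaluation at \<open>z\<close> costs a factor of the kernel norm, and
  \<open>\<beta>\<close> divides by exactly this norm. So norm convergence of
  \<open>toep \<tau> (nkernel z)\<close> to \<open>F\<close> along a sequence is enough, and
  \<open>van\<close> disposes of \<open>F\<close>.\<close>

lemma ber_tendsto_0:
  assumes pos: "\<And>z. sqn N (kernel z) > 0"
    and int: "\<And>f z. f \<in> A \<Longrightarrow> integrable \<tau> (\<lambda>\<xi>. f \<xi> * cnj (kernel z \<xi>))"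
    and van: "\<And>f. f \<in> A \<Longrightarrow> ((\<lambda>z. (cmod (f z))\<^sup>2 / sqn N (kernel z)) \<longlongrightarrow> 0) at_infinity"
    and comp: "compact_op (toep \<tau>)"
  shows "(ber \<tau> \<longlongrightarrow> 0) at_infinity"
proof -
  define c where "c z = sqrt (sqn N (kernel z))" for z
  have c: "c z > 0" for z using pos by (simp add: c_def)
  have nA: "nkernel z \<in> A" for z
    using A_scale[OF kernel_A, of "1 / of_real (c z)" z] by (simp add: nkernel_def c_def)
  have nn: "sqn N (nkernel z) = 1" for z
    using sqn_scale[of N "1 / of_real (c z)" "kernel z"] pos[of z] c[of z]
    by (simp add: nkernel_def c_def norm_divide power_divide)
  define \<beta> where "\<beta> z = cmod (toep \<tau> (nkernel z) z) / c z" for z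
  \<comment> \<open>\<open>int\<close> is what makes this an identity: for a nonintegrable integrand
    the Bochner integral is 0 by default, while \<open>ber\<close> would be infinite.\<close>
  have ber_eq: "ber \<tau> z = ennreal (\<beta> z)" for z
  proof -
    have eq: "nkernel z \<xi> * cnj (kernel z \<xi>) = of_real (c z * (cmod (nkernel z \<xi>))\<^sup>2)" for \<xi>
    proof -
      have "kernel z \<xi> = of_real (c z) * nkernel z \<xi>"
        using c[of z] by (simp add: nkernel_def c_def)
      then have "nkernel z \<xi> * cnj (kernel z \<xi>) = of_real (c z) * (nkernel z \<xi> * cnj (nkernel z \<xi>))"
        by simp
      also have "nkernel z \<xi> * cnj (nkernel z \<xi>) = of_real ((cmod (nkernel z \<xi>))\<^sup>2)"
        by (simp only: complex_norm_square)
      finally show ?thesis by simp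
    qed
    have "integrable \<tau> (\<lambda>\<xi>. Re (nkernel z \<xi> * cnj (kernel z \<xi>)))"
      using int[OF nA] by (rule integrable_Re)
    then have "integrable \<tau> (\<lambda>\<xi>. (1 / c z) * (c z * (cmod (nkernel z \<xi>))\<^sup>2))"
      unfolding eq Re_complex_of_real by (rule integrable_mult_right)
    then have i: "integrable \<tau> (\<lambda>\<xi>. (cmod (nkernel z \<xi>))\<^sup>2)"
      using c[of z] by simp
    have "toep \<tau> (nkernel z) z = of_real (c z * (LINT \<xi>|\<tau>. (cmod (nkernel z \<xi>))\<^sup>2))"
      unfolding toep_def ip_def eq by (subst integral_complex_of_real) simp
    then have "\<beta> z = (LINT \<xi>|\<tau>. (cmod (nkernel z \<xi>))\<^sup>2)"
      using c[of z] by (simp add: \<beta>_def norm_mult)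
    then show ?thesis
      unfolding ber_def using i by (subst nn_integral_eq_integral) auto
  qed
  have "(\<beta> \<longlongrightarrow> 0) at_infinity"
  proof (rule ccontr)
    assume "\<not> (\<beta> \<longlongrightarrow> 0) at_infinity"
    then obtain e where e: "e > 0" "\<not> eventually (\<lambda>z. dist (\<beta> z) 0 < e) at_infinity"
      unfolding tendsto_iff by blast
    \<comment> \<open>Failure of convergence leaves points with \<open>\<beta> z \<ge> e\<close>
      arbitrarily far out; compactness is applied to the normalised kernels at these points.\<close>
    then have "\<forall>n::nat. \<exists>z. real n \<le> cmod z \<and> \<beta> z \<ge> e"
      unfolding eventually_at_infinity using c
      by (simp add: \<beta>_def not_less abs_of_pos)
    then obtain s where s: "\<And>n::nat. real n \<le> cmod (s n)" "\<And>n. \<beta> (s n) \<ge> e" by metis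
    have s_inf: "filterlim s at_infinity sequentially"
      unfolding filterlim_at_infinity_conv_norm_at_top
      by (rule filterlim_at_top_mono[OF filterlim_real_sequentially]) (use s in auto)
    define S where "S = toep \<tau> ` {f \<in> A. sqrt (sqn N f) \<le> 1}"
    have SA: "S \<subseteq> A" unfolding S_def by (intro image_subsetI compact_op_maps[OF comp]) simp
    have "range (\<lambda>n. toep \<tau> (nkernel (s n))) \<subseteq> mspace.mtopology closure_of S"
      using closure_of_subset[of S mspace.mtopology] SA nA nn by (auto simp: S_def)
    note range = this
    have cpt: "compactin mspace.mtopology (mspace.mtopology closure_of S)"
      unfolding S_def by (rule compact_op_compactin[OF comp])
    obtain F r where "F \<in> mspace.mtopology closure_of S" and r: "strict_mono (r :: nat \<Rightarrow> nat)"
      and lim: "limitin mspace.mtopology ((\<lambda>n. toep \<tau> (nkernel (s n))) \<circ> r) F sequentially"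
      using cpt[unfolded mspace.compactin_sequentially, THEN conjunct2, rule_format, OF range] by blast
    have F: "F \<in> A" and lim0: "(\<lambda>n. d (toep \<tau> (nkernel (s (r n)))) F) \<longlonglongrightarrow> 0"
      using lim unfolding mspace.limitin_metric_dist_null by (auto simp: o_def)
    have "(\<lambda>n. \<beta> (s (r n))) \<longlonglongrightarrow> 0"
    proof (rule tendsto_sandwich[OF _ _ tendsto_const])
      have "((\<lambda>z. sqrt ((cmod (F z))\<^sup>2 / sqn N (kernel z))) \<longlongrightarrow> sqrt 0) at_infinity"
        by (rule tendsto_real_sqrt[OF van[OF F]])
      then have "((\<lambda>z. cmod (F z) / c z) \<longlongrightarrow> 0) at_infinity"
        by (simp add: real_sqrt_divide c_def)
      from filterlim_compose[OF this filterlim_compose[OF s_inf filterlim_subseq[OF r]]]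
      have "(\<lambda>n. cmod (F (s (r n))) / c (s (r n))) \<longlonglongrightarrow> 0" .
      from tendsto_add[OF lim0 this]
      show "(\<lambda>n. d (toep \<tau> (nkernel (s (r n)))) F + cmod (F (s (r n))) / c (s (r n))) \<longlonglongrightarrow> 0" by simp
      have "\<beta> z \<le> d (toep \<tau> (nkernel z)) F + cmod (F z) / c z" for z
      proof -
        have t: "toep \<tau> (nkernel z) \<in> A"
          by (rule compact_op_maps[OF comp nA])
        have "cmod (toep \<tau> (nkernel z) z) \<le> cmod (toep \<tau> (nkernel z) z - F z) + cmod (F z)"
          using norm_triangle_ineq[of "toep \<tau> (nkernel z) z - F z" "F z"] by simp
        also have "cmod (toep \<tau> (nkernel z) z - F z) \<le> d (toep \<tau> (nkernel z)) F * c z"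
          using kernel_bound[OF A_diff[OF t F], of z] by (simp add: d_def c_def)
        finally show ?thesis using c[of z] by (simp add: \<beta>_def field_simps)
      qed
      then show "eventually (\<lambda>n. \<beta> (s (r n)) \<le> d (toep \<tau> (nkernel (s (r n)))) F + cmod (F (s (r n))) / c (s (r n))) sequentially"
        by simp
    qed (use c in \<open>auto simp: \<beta>_def less_imp_le\<close>)
    then have "eventually (\<lambda>n. \<beta> (s (r n)) < e) sequentially"
      using e by (intro order_tendstoD)
    then obtain n where "\<beta> (s (r n)) < e" by (auto simp: eventually_sequentially)
    then show False using s(2)[of "r n"] by simp
  qed
  then show ?thesis
    unfolding ber_eq[abs_def] using tendsto_ennrealI by fastforce
qed

end


section \<open>Gaussian weights on doubling measures\<close>

text \<open>Absorbing the Gaussian into the measure lets the same L2 lemmas serve the weight and the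
  symbol of the Toeplitz operator.\<close>

definition gauss :: "real \<Rightarrow> complex measure \<Rightarrow> complex measure" where
  "gauss a M = density M (\<lambda>\<xi>. ennreal (exp (- a * (cmod \<xi>)\<^sup>2)))"

lemma sets_gauss [simp]: "sets (gauss a M) = sets M"
  by (simp add: gauss_def)

lemma borel_gauss_weight [measurable]: "(\<lambda>\<xi>. exp (- a * (cmod \<xi>)\<^sup>2)) \<in> borel_measurable borel"
  by measurable

lemma nn_integral_gauss:
  assumes "sets M = sets borel" "f \<in> borel_measurable borel"
  shows "(\<integral>\<^sup>+x. f x \<partial>gauss a M) = (\<integral>\<^sup>+x. ennreal (exp (- a * (cmod x)\<^sup>2)) * f x \<partial>M)"
  unfolding gauss_def
  by (rule nn_integral_density) (use assms in \<open>simp_all cong: measurable_cong_sets\<close>)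

lemma entire_borel: "f holomorphic_on UNIV \<Longrightarrow> f \<in> borel_measurable (borel :: complex measure)"
  using holomorphic_on_imp_continuous_on by (intro borel_measurable_continuous_onI) auto

text \<open>Cauchy's estimate for the derivative on circles of radius \<open>r\<close> about points
  of \<open>cball c r\<close>, which stay in \<open>cball c (2 * r)\<close>, followed by the mean
  value inequality on the convex disc.\<close>

lemma entire_lipschitz:
  fixes g :: "complex \<Rightarrow> complex"
  assumes g: "g holomorphic_on UNIV" and r: "r > 0"
    and B: "\<And>x. x \<in> cball c (2 * r) \<Longrightarrow> cmod (g x) \<le> B"
    and xi: "\<xi> \<in> cball c r"
  shows "cmod (g \<xi> - g c) \<le> B / r * cmod (\<xi> - c)"
proof (rule field_differentiable_bound[of "cball c r" g "deriv g"])
  fix x assume x: "x \<in> cball c r"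
  show "(g has_field_derivative deriv g x) (at x within cball c r)"
    using g holomorphic_derivI[of g UNIV x] by (auto intro: has_field_derivative_at_within)
  have "cmod ((deriv ^^ 1) g x) \<le> fact 1 * B / r ^ 1"
  proof (rule Cauchy_inequality)
    show "g holomorphic_on ball x r" "continuous_on (cball x r) g"
      using g holomorphic_on_subset holomorphic_on_imp_continuous_on by blast+
    fix y assume "cmod (x - y) = r"
    then show "cmod (g y) \<le> B"
      using x dist_triangle[of c y x] by (intro B) (auto simp: dist_norm)
  qed (use r in auto)
  then show "cmod (deriv g x) \<le> B / r" by simp
qed (use xi r in auto)

text \<open>A Weyl-type multiplier: entire and zero-free. The summand
  \<open>(cmod z)\<^sup>2 / 2\<close> is chosen so that at \<open>\<xi> = z\<close> the squared
  modulus is that of \<open>f\<close> times the Gaussian, with no further constant.\<close>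

definition twist :: "real \<Rightarrow> complex \<Rightarrow> (complex \<Rightarrow> complex) \<Rightarrow> complex \<Rightarrow> complex" where
  "twist a z f \<xi> = f \<xi> * exp (of_real a * (of_real ((cmod z)\<^sup>2 / 2) - \<xi> * cnj z))"

lemma twist_holomorphic: "f holomorphic_on UNIV \<Longrightarrow> twist a z f holomorphic_on UNIV"
  unfolding twist_def[abs_def] by (intro holomorphic_intros) auto

lemma cmod_diff_square: "(cmod (\<xi> - z))\<^sup>2 = (cmod \<xi>)\<^sup>2 + (cmod z)\<^sup>2 - 2 * Re (\<xi> * cnj z)"
  unfolding cmod_power2 by (simp add: power2_eq_square algebra_simps)

text \<open>This Gaussian gauge transformation makes the estimates at \<open>z\<close> look like estimates at the
  origin.\<close>

lemma cmod_twist: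
  "(cmod (twist a z f \<xi>))\<^sup>2 = (cmod (f \<xi>))\<^sup>2 * exp (- a * (cmod \<xi>)\<^sup>2) * exp (a * (cmod (\<xi> - z))\<^sup>2)"
proof -
  have "Re (of_real a * w) = a * Re w" for w by simp
  then have "(cmod (exp (of_real a * (of_real ((cmod z)\<^sup>2 / 2) - \<xi> * cnj z))))\<^sup>2
      = exp (2 * (a * ((cmod z)\<^sup>2 / 2 - Re (\<xi> * cnj z))))"
    by (simp only: norm_exp_eq_Re exp_double minus_complex.sel Re_complex_of_real)
  also have "\<dots> = exp (- a * (cmod \<xi>)\<^sup>2) * exp (a * (cmod (\<xi> - z))\<^sup>2)"
    unfolding cmod_diff_square exp_add[symmetric] by (simp add: algebra_simps del: times_complex.sel)
  finally show ?thesis by (simp add: twist_def norm_mult power_mult_distrib)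
qed

text \<open>One inequality covers both scales: at \<open>\<zeta> = z\<close> it bounds the mass of
  small discs below by a power of the radius, and at \<open>s = 1\<close> it lets the mass of unit
  discs change at most exponentially with the distance.\<close>

locale doubling_measure =
  fixes \<alpha> C \<kappa> :: real and m :: nat and \<nu> :: "complex measure"
  assumes m: "m > 0" and \<alpha>: "\<alpha> > 0" and C: "C > 0" and \<kappa>: "\<kappa> \<ge> 0"
    and sets_\<nu>: "sets \<nu> = sets borel"
    and fin: "\<And>R. emeasure \<nu> (cball 0 R) < \<infinity>"
    and V_pos: "\<And>z. measure \<nu> (ball z 1) > 0"
    and doubling: "\<And>z \<zeta> s. 0 < s \<Longrightarrow> s \<le> 1 \<Longrightarrow>
      measure \<nu> (ball z 1) * s ^ m \<le> C * exp (\<kappa> * dist z \<zeta>) * measure \<nu> (ball \<zeta> s)"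
begin

definition V :: "complex \<Rightarrow> real" where "V z = measure \<nu> (ball z 1)"

lemma Vpos: "V z > 0" using V_pos by (simp add: V_def)

lemma ball_fmeasurable: "ball z r \<in> fmeasurable \<nu>"
proof (rule fmeasurableI)
  show "ball z r \<in> sets \<nu>" using sets_\<nu> by simp
  have "ball z r \<subseteq> cball 0 (cmod z + r)"
  proof
    fix x assume "x \<in> ball z r"
    then show "x \<in> cball 0 (cmod z + r)"
      using norm_triangle_sub[of x z] by (simp add: dist_norm norm_minus_commute)
  qed
  then have "emeasure \<nu> (ball z r) \<le> emeasure \<nu> (cball 0 (cmod z + r))"
    using sets_\<nu> by (intro emeasure_mono) auto
  then show "emeasure \<nu> (ball z r) < \<infinity>" using fin[of "cmod z + r"] le_less_trans by blast
qed

lemma ball_sets [measurable]: "ball z r \<in> sets \<nu>"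
  using sets_\<nu> by simp

lemma emeasure_ball: "emeasure \<nu> (ball z r) = ennreal (measure \<nu> (ball z r))"
  by (rule emeasure_eq_measure2[OF ball_fmeasurable])

lemma V_le: "dist z \<zeta> \<le> R \<Longrightarrow> V z \<le> C * exp (\<kappa> * R) * V \<zeta>"
proof -
  assume d: "dist z \<zeta> \<le> R"
  have "V z \<le> C * exp (\<kappa> * dist z \<zeta>) * V \<zeta>" using doubling[of 1 z \<zeta>] by (simp add: V_def)
  also have "\<dots> \<le> C * exp (\<kappa> * R) * V \<zeta>"
    using d \<kappa> C Vpos by (intro mult_right_mono mult_left_mono) (auto intro: mult_left_mono less_imp_le)
  finally show ?thesis .
qed

text \<open>Enlarging the radius by 1/2 costs a fixed factor: the larger ball is covered by balls of
  the old radius about \<open>z + d\<close>, with \<open>d\<close> in a finite 1/2-net of the unit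
  disc, and \<open>V\<close> is comparable at these centres.\<close>

lemma ball_growth:
  obtains k where "k \<ge> 1" "\<And>z n. measure \<nu> (ball z (1 + real n / 2)) \<le> k ^ n * V z"
proof -
  have "compact (cball (0::complex) 1)" by simp
  then obtain D :: "complex set" where D: "finite D" "D \<subseteq> cball 0 1" "cball 0 1 \<subseteq> (\<Union>d\<in>D. ball d (1/2))"
    using compactE_image[of "cball (0::complex) 1" "cball (0::complex) 1" "\<lambda>d. ball d (1/2)"] by force
  define k where "k = max 1 (real (card D) * (C * exp \<kappa>))"
  have "measure \<nu> (ball z (1 + real n / 2)) \<le> k ^ n * V z" for z n
  proof (induction n arbitrary: z)
    case 0 then show ?case by (simp add: V_def)
  next
    case (Suc n)
    have sub: "ball z (1 + real (Suc n) / 2) \<subseteq> (\<Union>d\<in>D. ball (z + d) (1 + real n / 2))"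
    proof
      fix p assume p: "p \<in> ball z (1 + real (Suc n) / 2)"
      \<comment> \<open>The radial projection of \<open>p - z\<close> to the closed unit disc. What
        remains of \<open>p - z\<close> is shorter than \<open>1/2 + real n / 2\<close>, and
        replacing \<open>e\<close> by a net point loses less than 1/2.\<close>
      define e where "e = (if cmod (p - z) \<le> 1 then p - z else (p - z) / of_real (cmod (p - z)))"
      have e1: "cmod e \<le> 1" by (auto simp: e_def norm_divide)
      have e2: "cmod (p - z - e) < 1/2 + real n / 2"
      proof (cases "cmod (p - z) \<le> 1")
        case False
        then have nz: "cmod (p - z) > 1" by simp
        then have "p - z - e = (p - z) * of_real (1 - 1 / cmod (p - z))"
          by (simp add: e_def divide_inverse algebra_simps)
        then have "cmod (p - z - e) = cmod (p - z) * (1 - 1 / cmod (p - z))"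
        proof -
          have "1 / cmod (p - z) \<le> 1" using nz by (simp only: divide_le_eq_1_pos[OF less_trans[OF zero_less_one nz]] less_imp_le)
          then have "0 \<le> 1 - 1 / cmod (p - z)" by simp
          then show ?thesis using \<open>p - z - e = _\<close> by (simp only: norm_mult norm_of_real abs_of_nonneg)
        qed
        also have "\<dots> = cmod (p - z) - 1" using nz by (auto simp: right_diff_distrib)
        finally show ?thesis using p by (simp add: dist_norm norm_minus_commute field_simps)
      qed (auto simp: e_def)
      obtain d where d: "d \<in> D" "dist d e < 1/2" using e1 D(3) by (force simp: subset_iff)
      have "dist (z + d) p \<le> cmod (p - z - e) + cmod (e - d)"
        using norm_triangle_ineq[of "p - z - e" "e - d"] by (simp add: dist_norm norm_minus_commute algebra_simps)
      then show "p \<in> (\<Union>d\<in>D. ball (z + d) (1 + real n / 2))"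
        using e2 d by (auto simp: dist_norm norm_minus_commute intro!: bexI[of _ d])
    qed
    have "measure \<nu> (ball z (1 + real (Suc n) / 2)) \<le> measure \<nu> (\<Union>d\<in>D. ball (z + d) (1 + real n / 2))"
      by (rule measure_mono_fmeasurable[OF sub])
         (use sets_\<nu> D(1) ball_fmeasurable in \<open>auto intro!: fmeasurable.finite_UN\<close>)
    also have "\<dots> \<le> (\<Sum>d\<in>D. measure \<nu> (ball (z + d) (1 + real n / 2)))"
      using D(1) sets_\<nu> by (intro measure_UNION_le) auto
    also have "\<dots> \<le> (\<Sum>d\<in>D. k ^ n * (C * exp \<kappa> * V z))"
    proof (rule sum_mono)
      fix d assume "d \<in> D"
      then have "dist (z + d) z \<le> 1" using D(2) by (auto simp: dist_norm)
      from V_le[OF this] have "V (z + d) \<le> C * exp \<kappa> * V z" by simp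
      then have "k ^ n * V (z + d) \<le> k ^ n * (C * exp \<kappa> * V z)"
        by (intro mult_left_mono) (auto simp: k_def)
      then show "measure \<nu> (ball (z + d) (1 + real n / 2)) \<le> k ^ n * (C * exp \<kappa> * V z)"
        using Suc.IH[of "z + d"] by linarith
    qed
    also have "\<dots> = (real (card D) * (C * exp \<kappa>)) * (k ^ n * V z)" by simp
    also have "\<dots> \<le> k * (k ^ n * V z)"
      using Vpos[of z] by (intro mult_right_mono) (auto simp: k_def)
    finally show ?case by simp
  qed
  then show ?thesis by (intro that[of k]) (auto simp: k_def)
qed

text \<open>The geometric growth \<open>k ^ n\<close> of the balls loses against the Gaussian, whose
  exponent at distance \<open>n / 2\<close> is quadratic in \<open>n\<close>.\<close>

lemma gauss_integral_bound:
  obtains G where "G > 0" "\<And>z. (\<integral>\<^sup>+\<xi>. ennreal (exp (- \<alpha> * (cmod (\<xi> - z))\<^sup>2)) \<partial>\<nu>) \<le> ennreal (G * V z)"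
proof -
  obtain k where k: "k \<ge> 1" "\<And>z n. measure \<nu> (ball z (1 + real n / 2)) \<le> k ^ n * V z"
    using ball_growth by metis
  define t where "t n = exp (- \<alpha> * (real n / 2)\<^sup>2) * k ^ n" for n
  have t0: "t n \<ge> 0" for n using k(1) by (simp add: t_def)
  define L where "L = ln k"
  have "t n \<le> exp ((L + 1)\<^sup>2 / \<alpha>) * exp (- 1) ^ n" for n
  proof -
    have kn: "k ^ n = exp (real n * L)" using k(1) by (simp add: L_def exp_of_nat_mult)
    \<comment> \<open>Completing the square bounds \<open>t n\<close> by a geometric sequence; the
      \<open>+ 1\<close> beside \<open>L\<close> produces its ratio
      \<open>exp (- 1)\<close>.\<close>
    have "0 \<le> (\<alpha> * real n / 2 - (L + 1))\<^sup>2 / \<alpha>" using \<alpha> by simp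
    also have "\<dots> = \<alpha> * (real n / 2)\<^sup>2 - (L + 1) * real n + (L + 1)\<^sup>2 / \<alpha>"
      using \<alpha> by (simp add: power2_eq_square field_simps)
    finally have "- \<alpha> * (real n / 2)\<^sup>2 + real n * L \<le> (L + 1)\<^sup>2 / \<alpha> + real n * (- 1)"
      by (simp add: algebra_simps)
    then show ?thesis unfolding t_def kn exp_of_nat_mult[symmetric] exp_add[symmetric] by simp
  qed
  moreover have "summable (\<lambda>n. exp ((L + 1)\<^sup>2 / \<alpha>) * exp (- 1 :: real) ^ n)"
    by (intro summable_mult summable_geometric) simp
  ultimately have sumt: "summable t"
    using summable_comparison_test'[of "\<lambda>n. exp ((L + 1)\<^sup>2 / \<alpha>) * exp (- 1) ^ n" 0 t] t0 by simp
  define G where "G = suminf t + 1"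
  have G: "G > 0" using suminf_nonneg[OF sumt] t0 by (simp add: G_def add_nonneg_pos)
  have "(\<integral>\<^sup>+\<xi>. ennreal (exp (- \<alpha> * (cmod (\<xi> - z))\<^sup>2)) \<partial>\<nu>) \<le> ennreal (G * V z)" for z
  proof -
    \<comment> \<open>On the annulus \<open>n / 2 \<le> cmod (\<xi> - z) < (n + 1) / 2\<close> the
      summand with this \<open>n\<close> alone dominates the Gaussian.\<close>
    define h where "h n \<xi> = ennreal (exp (- \<alpha> * (real n / 2)\<^sup>2)) * indicator (ball z (1 + real n / 2)) \<xi>"
      for n \<xi>
    have hm: "h n \<in> borel_measurable \<nu>" for n
      unfolding h_def by measurable
    have "(\<integral>\<^sup>+\<xi>. ennreal (exp (- \<alpha> * (cmod (\<xi> - z))\<^sup>2)) \<partial>\<nu>) \<le> (\<integral>\<^sup>+\<xi>. (\<Sum>n. h n \<xi>) \<partial>\<nu>)"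
    proof (rule nn_integral_mono)
      fix \<xi>
      define n where "n = nat \<lfloor>2 * cmod (\<xi> - z)\<rfloor>"
      have n: "real n \<le> 2 * cmod (\<xi> - z)" "2 * cmod (\<xi> - z) < real n + 1"
        unfolding n_def by (auto simp: of_nat_nat)
      have "(real n / 2)\<^sup>2 \<le> (cmod (\<xi> - z))\<^sup>2" using n by (intro power_mono) auto
      then have "exp (- \<alpha> * (cmod (\<xi> - z))\<^sup>2) \<le> exp (- \<alpha> * (real n / 2)\<^sup>2)" using \<alpha> by simp
      moreover have "\<xi> \<in> ball z (1 + real n / 2)" using n by (simp add: dist_norm norm_minus_commute)
      ultimately have "ennreal (exp (- \<alpha> * (cmod (\<xi> - z))\<^sup>2)) \<le> h n \<xi>"
        by (simp add: h_def ennreal_leI)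
      also have "h n \<xi> \<le> (\<Sum>n. h n \<xi>)"
        using sum_le_suminf[of "\<lambda>n. h n \<xi>" "{n}"] by simp
      finally show "ennreal (exp (- \<alpha> * (cmod (\<xi> - z))\<^sup>2)) \<le> (\<Sum>n. h n \<xi>)" .
    qed
    also have "\<dots> = (\<Sum>n. integral\<^sup>N \<nu> (h n))" by (rule nn_integral_suminf[OF hm])
    also have "\<dots> \<le> (\<Sum>n. ennreal (t n * V z))"
    proof (rule suminf_le)
      fix n
      have "integral\<^sup>N \<nu> (h n) = ennreal (exp (- \<alpha> * (real n / 2)\<^sup>2)) * emeasure \<nu> (ball z (1 + real n / 2))"
        unfolding h_def using sets_\<nu> by (subst nn_integral_cmult_indicator) auto
      also have "\<dots> = ennreal (exp (- \<alpha> * (real n / 2)\<^sup>2) * measure \<nu> (ball z (1 + real n / 2)))"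
        unfolding emeasure_ball by (simp add: ennreal_mult)
      also have "\<dots> \<le> ennreal (t n * V z)"
        unfolding t_def using k(2)[where n=n and z=z] by (intro ennreal_leI) (simp add: mult.assoc)
      finally show "integral\<^sup>N \<nu> (h n) \<le> ennreal (t n * V z)" .
    qed auto
    also have "\<dots> = ennreal (suminf t * V z)"
      using t0 Vpos[of z] sumt
      by (subst suminf_ennreal_eq[OF _ sums_mult2[OF summable_sums[OF sumt]]]) (auto simp: less_imp_le)
    also have "\<dots> \<le> ennreal (G * V z)"
      using Vpos[of z] by (intro ennreal_leI mult_right_mono) (auto simp: G_def)
    finally show ?thesis .
  qed
  with G that show ?thesis by blast
qed

text \<open>Maximising \<open>(cmod (g \<xi>))\<^sup>2 * (\<rho> - dist z \<xi>) ^ m\<close> selects a point around which \<open>g\<close> is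
  essentially constant at the scale on which the measure is controlled; this replaces
  subharmonicity, which is useless against a rough weight.\<close>

lemma local_estimate:
  assumes \<rho>: "0 < \<rho>" "\<rho> \<le> 1"
  obtains K where "K > 0" "\<And>g z. g holomorphic_on UNIV \<Longrightarrow>
    ennreal ((cmod (g z))\<^sup>2 * V z) \<le> ennreal K * (\<integral>\<^sup>+\<xi>\<in>ball z \<rho>. ennreal ((cmod (g \<xi>))\<^sup>2) \<partial>\<nu>)"
proof -
  \<comment> \<open>Chosen so that the Lipschitz constant
    \<open>2 ^ m * cmod (g x) / (t / 4)\<close> times \<open>s = \<eta> * t\<close> is exactly half
    of \<open>cmod (g x)\<close>.\<close>
  define \<eta> :: real where "\<eta> = 1 / (8 * 2 ^ m)"
  have "(2::real) ^ m \<ge> 1" by simp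
  then have \<eta>: "\<eta> > 0" "\<eta> \<le> 1/8" by (auto simp: \<eta>_def field_simps)
  define K where "K = 4 * (C * exp \<kappa>) / (\<rho> * \<eta>) ^ m"
  have K: "K > 0" using \<rho> \<eta> C by (simp add: K_def)
  have "ennreal ((cmod (g z))\<^sup>2 * V z) \<le> ennreal K * (\<integral>\<^sup>+\<xi>\<in>ball z \<rho>. ennreal ((cmod (g \<xi>))\<^sup>2) \<partial>\<nu>)"
    if g: "g holomorphic_on UNIV" for g z
  proof (cases "g z = 0")
    case False
    have gc: "continuous_on S g" for S
      using g holomorphic_on_imp_continuous_on continuous_on_subset by blast
    define \<phi> where "\<phi> \<xi> = (cmod (g \<xi>))\<^sup>2 * (\<rho> - dist z \<xi>) ^ m" for \<xi>
    have "continuous_on (cball z \<rho>) \<phi>" unfolding \<phi>_def by (intro continuous_intros gc)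
    then obtain x where x: "x \<in> cball z \<rho>" "\<And>y. y \<in> cball z \<rho> \<Longrightarrow> \<phi> y \<le> \<phi> x"
      using continuous_attains_sup[of "cball z \<rho>" \<phi>] \<rho> by force
    define t where "t = \<rho> - dist z x"
    have max: "(cmod (g z))\<^sup>2 * \<rho> ^ m \<le> (cmod (g x))\<^sup>2 * t ^ m"
      using x(2)[of z] \<rho> by (simp add: \<phi>_def t_def)
    moreover have "0 < (cmod (g z))\<^sup>2 * \<rho> ^ m" using False \<rho> by simp
    ultimately have "0 < (cmod (g x))\<^sup>2 * t ^ m" by linarith
    \<comment> \<open>Here \<open>m > 0\<close> matters: \<open>0 ^ 0 = 1\<close> would let the
      maximum sit on the boundary.\<close>
    then have "t \<noteq> 0" using m by (cases "t = 0") (auto simp: zero_power)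
    moreover have "t \<ge> 0" using x(1) by (simp add: t_def)
    ultimately have t: "t > 0" by simp
    have "t \<le> 1" using \<rho> zero_le_dist[of z x] unfolding t_def by linarith
    \<comment> \<open>At distance \<open>t / 2\<close> from \<open>x\<close> at least half of the
      distance to the boundary is left, so maximality loses at most \<open>2 ^ m\<close> in the
      squared modulus; this is relaxed to a square to avoid a root.\<close>
    have near: "cmod (g y) \<le> 2 ^ m * cmod (g x)" if y: "y \<in> cball x (t / 2)" for y
    proof -
      have dy: "dist z y \<le> \<rho> - t / 2"
        using dist_triangle[of z y x] y by (simp add: t_def field_simps)
      then have "\<phi> y \<le> \<phi> x" using t by (intro x(2)) simp
      moreover have "(cmod (g y))\<^sup>2 * (t / 2) ^ m \<le> \<phi> y"
        unfolding \<phi>_def using dy t by (intro mult_left_mono power_mono) auto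
      ultimately have "(cmod (g y))\<^sup>2 * (t / 2) ^ m \<le> (cmod (g x))\<^sup>2 * t ^ m"
        by (simp add: \<phi>_def t_def)
      then have "(cmod (g y))\<^sup>2 \<le> 2 ^ m * (cmod (g x))\<^sup>2"
        using t by (simp add: power_divide field_simps)
      also have "\<dots> \<le> (2 ^ m)\<^sup>2 * (cmod (g x))\<^sup>2"
        by (intro mult_right_mono) (simp_all add: power2_eq_square)
      finally have "(cmod (g y))\<^sup>2 \<le> (2 ^ m * cmod (g x))\<^sup>2" by (simp add: power_mult_distrib)
      then show ?thesis by (rule power2_le_imp_le) simp
    qed
    define s where "s = \<eta> * t"
    have s: "s > 0" "s \<le> t / 4" "s \<le> 1"
      using \<eta> t \<open>t \<le> 1\<close> mult_right_mono[of \<eta> "1/8" t] by (auto simp: s_def mult_le_one)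
    have half: "cmod (g y) \<ge> cmod (g x) / 2" if y: "y \<in> ball x s" for y
    proof -
      have "cmod (g y - g x) \<le> (2 ^ m * cmod (g x)) / (t / 4) * cmod (y - x)"
        using g near y s t by (intro entire_lipschitz) auto
      also have "\<dots> \<le> (2 ^ m * cmod (g x)) / (t / 4) * s"
        using y t by (intro mult_left_mono) (auto simp: dist_norm norm_minus_commute)
      also have "\<dots> = cmod (g x) / 2" using t by (simp add: s_def \<eta>_def)
      finally show ?thesis using norm_triangle_ineq2[of "g x" "g y"] by (simp add: norm_minus_commute)
    qed
    have sub: "ball x s \<subseteq> ball z \<rho>"
    proof
      fix y assume "y \<in> ball x s"
      then show "y \<in> ball z \<rho>"
        using dist_triangle[of z y x] s t by (simp add: t_def)
    qed
    have dzx: "dist z x \<le> 1" using x(1) \<rho> by simp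
    have 1: "V z * s ^ m \<le> C * exp \<kappa> * measure \<nu> (ball x s)"
    proof -
      have "V z * s ^ m \<le> C * exp (\<kappa> * dist z x) * measure \<nu> (ball x s)"
        unfolding V_def by (rule doubling) (use s in auto)
      also have "\<dots> \<le> C * exp \<kappa> * measure \<nu> (ball x s)"
        using C \<kappa> dzx by (intro mult_right_mono mult_left_mono) (auto intro: mult_left_le)
      finally show ?thesis .
    qed
    \<comment> \<open>The factor \<open>t ^ m\<close> gained from maximality is exactly what
      \<open>doubling\<close> loses at radius \<open>s = \<eta> * t\<close>; this is the origin of
      the exponent in \<open>\<phi>\<close>.\<close>
    have "(cmod (g z))\<^sup>2 * V z * (\<rho> * \<eta>) ^ m = ((cmod (g z))\<^sup>2 * \<rho> ^ m) * (V z * \<eta> ^ m)"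
      by (simp add: power_mult_distrib)
    also have "\<dots> \<le> ((cmod (g x))\<^sup>2 * t ^ m) * (V z * \<eta> ^ m)"
      using Vpos[of z] \<eta> by (intro mult_right_mono max) auto
    also have "\<dots> = (cmod (g x))\<^sup>2 * (V z * s ^ m)"
      by (simp add: s_def power_mult_distrib)
    also have "\<dots> \<le> (cmod (g x))\<^sup>2 * (C * exp \<kappa> * measure \<nu> (ball x s))"
      by (intro mult_left_mono 1) simp
    finally have "(cmod (g z))\<^sup>2 * V z \<le> K * ((cmod (g x) / 2)\<^sup>2 * measure \<nu> (ball x s))"
      using \<rho> \<eta> by (simp add: K_def field_simps power2_eq_square)
    then have "ennreal ((cmod (g z))\<^sup>2 * V z) \<le> ennreal (K * ((cmod (g x) / 2)\<^sup>2 * measure \<nu> (ball x s)))"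
      by (rule ennreal_leI)
    also have "\<dots> = ennreal K * (ennreal ((cmod (g x) / 2)\<^sup>2) * emeasure \<nu> (ball x s))"
      using K by (simp add: ennreal_mult emeasure_ball)
    also have "ennreal ((cmod (g x) / 2)\<^sup>2) * emeasure \<nu> (ball x s)
        = (\<integral>\<^sup>+\<xi>\<in>ball x s. ennreal ((cmod (g x) / 2)\<^sup>2) \<partial>\<nu>)"
      using sets_\<nu> by (subst nn_integral_cmult_indicator) auto
    also have "\<dots> \<le> (\<integral>\<^sup>+\<xi>\<in>ball z \<rho>. ennreal ((cmod (g \<xi>))\<^sup>2) \<partial>\<nu>)"
    proof (rule nn_integral_mono)
      fix \<xi>
      have "(cmod (g x) / 2)\<^sup>2 \<le> (cmod (g \<xi>))\<^sup>2" if "\<xi> \<in> ball x s"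
        using half[OF that] by (intro power_mono) auto
      then show "ennreal ((cmod (g x) / 2)\<^sup>2) * indicator (ball x s) \<xi>
          \<le> ennreal ((cmod (g \<xi>))\<^sup>2) * indicator (ball z \<rho>) \<xi>"
        using sub by (auto split: split_indicator intro!: ennreal_leI)
    qed
    finally show ?thesis by (simp add: mult_left_mono)
  qed simp
  with K that show ?thesis by blast
qed

end


section \<open>Point estimates and kernel bounds in the Gaussian-weighted space\<close>

context doubling_measure
begin

definition N :: "complex measure" where "N = gauss \<alpha> \<nu>"

definition E :: "(complex \<Rightarrow> complex) \<Rightarrow> complex \<Rightarrow> real" where
  "E f z = (cmod (f z))\<^sup>2 * exp (- \<alpha> * (cmod z)\<^sup>2)"

lemma sets_N: "sets N = sets borel" by (simp add: N_def sets_\<nu>)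

lemma E_nonneg: "0 \<le> E f z" by (simp add: E_def)

lemma E_meas: "f holomorphic_on UNIV \<Longrightarrow> E f \<in> borel_measurable borel"
  using entire_borel[of f] unfolding E_def[abs_def] by measurable

lemma nn_integral_E:
  assumes "sets M = sets borel" "f holomorphic_on UNIV" "S \<in> sets borel"
  shows "(\<integral>\<^sup>+\<xi>\<in>S. ennreal ((cmod (f \<xi>))\<^sup>2) \<partial>gauss \<alpha> M) = (\<integral>\<^sup>+\<xi>\<in>S. ennreal (E f \<xi>) \<partial>M)"
proof -
  have [measurable]: "f \<in> borel_measurable borel" "S \<in> sets borel"
    using assms entire_borel by auto
  have "(\<integral>\<^sup>+\<xi>\<in>S. ennreal ((cmod (f \<xi>))\<^sup>2) \<partial>gauss \<alpha> M)
      = (\<integral>\<^sup>+\<xi>. ennreal (exp (- \<alpha> * (cmod \<xi>)\<^sup>2)) * (ennreal ((cmod (f \<xi>))\<^sup>2) * indicator S \<xi>) \<partial>M)"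
    by (rule nn_integral_gauss[OF assms(1)]) measurable
  also have "\<dots> = (\<integral>\<^sup>+\<xi>\<in>S. ennreal (E f \<xi>) \<partial>M)"
    unfolding E_def by (intro nn_integral_cong) (simp add: ennreal_mult mult_ac)
  finally show ?thesis .
qed

text \<open>\<open>local_estimate\<close> is applied to \<open>twist \<alpha> z f\<close>, whose
  squared modulus is \<open>E f\<close> up to a factor between 1 and \<open>exp \<alpha>\<close> on
  the disc, and exactly \<open>E f z\<close> at \<open>z\<close>.\<close>

lemma point_estimate:
  assumes \<rho>: "0 < \<rho>" "\<rho> \<le> 1"
  obtains K where "K > 0" "\<And>f z. f holomorphic_on UNIV \<Longrightarrow>
    ennreal (E f z * V z) \<le> ennreal K * (\<integral>\<^sup>+\<xi>\<in>ball z \<rho>. ennreal ((cmod (f \<xi>))\<^sup>2) \<partial>N)"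
proof -
  obtain K where K: "K > 0" "\<And>g z. g holomorphic_on UNIV \<Longrightarrow>
    ennreal ((cmod (g z))\<^sup>2 * V z) \<le> ennreal K * (\<integral>\<^sup>+\<xi>\<in>ball z \<rho>. ennreal ((cmod (g \<xi>))\<^sup>2) \<partial>\<nu>)"
    using local_estimate[OF \<rho>] by blast
  have "ennreal (E f z * V z) \<le> ennreal (K * exp \<alpha>) * (\<integral>\<^sup>+\<xi>\<in>ball z \<rho>. ennreal ((cmod (f \<xi>))\<^sup>2) \<partial>N)"
    if f: "f holomorphic_on UNIV" for f z
  proof -
    have Em: "(\<lambda>\<xi>. ennreal (E f \<xi>) * indicator (ball z \<rho>) \<xi>) \<in> borel_measurable \<nu>"
      using E_meas[OF f] sets_\<nu> by (simp cong: measurable_cong_sets)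
    have "E f z = (cmod (twist \<alpha> z f z))\<^sup>2"
      unfolding cmod_twist by (simp add: E_def)
    then have "ennreal (E f z * V z) \<le> ennreal K * (\<integral>\<^sup>+\<xi>\<in>ball z \<rho>. ennreal ((cmod (twist \<alpha> z f \<xi>))\<^sup>2) \<partial>\<nu>)"
      using K(2)[OF twist_holomorphic[OF f], of \<alpha> z z] by simp
    also have "\<dots> \<le> ennreal K * (\<integral>\<^sup>+\<xi>. ennreal (exp \<alpha>) * (ennreal (E f \<xi>) * indicator (ball z \<rho>) \<xi>) \<partial>\<nu>)"
    proof (intro mult_left_mono nn_integral_mono)
      fix \<xi>
      show "ennreal ((cmod (twist \<alpha> z f \<xi>))\<^sup>2) * indicator (ball z \<rho>) \<xi>
        \<le> ennreal (exp \<alpha>) * (ennreal (E f \<xi>) * indicator (ball z \<rho>) \<xi>)"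
      proof (cases "\<xi> \<in> ball z \<rho>")
        case True
        then have "(cmod (\<xi> - z))\<^sup>2 \<le> 1"
          using \<rho> by (intro power_le_one) (auto simp: dist_norm norm_minus_commute)
        then have "exp (\<alpha> * (cmod (\<xi> - z))\<^sup>2) \<le> exp \<alpha>" using \<alpha> by (simp add: mult_left_le)
        then have "(cmod (twist \<alpha> z f \<xi>))\<^sup>2 \<le> E f \<xi> * exp \<alpha>"
          unfolding cmod_twist E_def by (intro mult_left_mono) auto
        then have "ennreal ((cmod (twist \<alpha> z f \<xi>))\<^sup>2) \<le> ennreal (exp \<alpha> * E f \<xi>)"
          by (intro ennreal_leI) (simp add: mult.commute)
        then show ?thesis using True by (simp add: ennreal_mult E_nonneg)
      qed simp
    qed simp
    also have "\<dots> = ennreal (K * exp \<alpha>) * (\<integral>\<^sup>+\<xi>\<in>ball z \<rho>. ennreal (E f \<xi>) \<partial>\<nu>)"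
      using K(1) by (subst nn_integral_cmult[OF Em]) (simp add: ennreal_mult mult.assoc)
    finally show ?thesis unfolding N_def using nn_integral_E[OF sets_\<nu> f] by simp
  qed
  then show ?thesis using K(1) by (intro that[of "K * exp \<alpha>"]) auto
qed

lemma point_estimate_global:
  obtains K where "K > 0" "\<And>f z. f holomorphic_on UNIV \<Longrightarrow> integrable N (\<lambda>x. (cmod (f x))\<^sup>2) \<Longrightarrow>
    E f z * V z \<le> K * sqn N f"
proof -
  obtain K where K: "K > 0" "\<And>f z. f holomorphic_on UNIV \<Longrightarrow>
    ennreal (E f z * V z) \<le> ennreal K * (\<integral>\<^sup>+\<xi>\<in>ball z 1. ennreal ((cmod (f \<xi>))\<^sup>2) \<partial>N)"
    using point_estimate[of 1] by auto
  have "E f z * V z \<le> K * sqn N f"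
    if f: "f holomorphic_on UNIV" "integrable N (\<lambda>x. (cmod (f x))\<^sup>2)" for f z
  proof -
    have "sq_int N f"
      unfolding sq_int_def using f entire_borel sets_N by (auto cong: measurable_cong_sets)
    note nn = nn_integral_sq[OF this]
    have "ennreal (E f z * V z) \<le> ennreal K * (\<integral>\<^sup>+\<xi>\<in>ball z 1. ennreal ((cmod (f \<xi>))\<^sup>2) \<partial>N)"
      by (rule K(2)[OF f(1)])
    also have "\<dots> \<le> ennreal K * (\<integral>\<^sup>+\<xi>. ennreal ((cmod (f \<xi>))\<^sup>2) \<partial>N)"
      by (intro mult_left_mono nn_integral_mono) (auto split: split_indicator)
    also have "\<dots> = ennreal (K * sqn N f)" using K(1) by (simp add: nn ennreal_mult sqn_nonneg)
    finally show ?thesis using K(1) sqn_nonneg[of N f] by (subst (asm) ennreal_le_iff) auto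
  qed
  with K(1) that show ?thesis by blast
qed

sublocale entire_space N
proof
  show "sets N = sets borel" by (rule sets_N)
  fix R :: real
  obtain K where K: "K > 0" "\<And>f z. f holomorphic_on UNIV \<Longrightarrow> integrable N (\<lambda>x. (cmod (f x))\<^sup>2) \<Longrightarrow>
    E f z * V z \<le> K * sqn N f"
    using point_estimate_global by blast
  show "\<exists>K. \<forall>f z. f holomorphic_on UNIV \<longrightarrow>
      integrable N (\<lambda>x. (cmod (f x))\<^sup>2) \<longrightarrow> cmod z \<le> R \<longrightarrow> (cmod (f z))\<^sup>2 \<le> K * sqn N f"
  proof (intro exI allI impI)
    fix f z assume f: "f holomorphic_on UNIV" "integrable N (\<lambda>x. (cmod (f x))\<^sup>2)" and z: "cmod z \<le> R"
    have v: "V 0 / (C * exp (\<kappa> * R)) \<le> V z"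
      using V_le[of 0 z R] z C by (simp add: field_simps)
    have vp: "V 0 / (C * exp (\<kappa> * R)) > 0" using Vpos[of 0] C by simp
    have e: "exp (- \<alpha> * R\<^sup>2) \<le> exp (- \<alpha> * (cmod z)\<^sup>2)"
      using z \<alpha> by (simp add: power_mono)
    have "(cmod (f z))\<^sup>2 * (exp (- \<alpha> * R\<^sup>2) * (V 0 / (C * exp (\<kappa> * R))))
        \<le> (cmod (f z))\<^sup>2 * (exp (- \<alpha> * (cmod z)\<^sup>2) * V z)"
      using v vp e by (intro mult_left_mono mult_mono) auto
    also have "\<dots> \<le> K * sqn N f" using K(2)[OF f, of z] by (simp add: E_def mult.assoc)
    finally have le: "(cmod (f z))\<^sup>2 * (exp (- \<alpha> * R\<^sup>2) * (V 0 / (C * exp (\<kappa> * R)))) \<le> K * sqn N f" .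
    show "(cmod (f z))\<^sup>2 \<le> (K / (exp (- \<alpha> * R\<^sup>2) * (V 0 / (C * exp (\<kappa> * R))))) * sqn N f"
    proof -
      define q where "q = exp (- \<alpha> * R\<^sup>2) * (V 0 / (C * exp (\<kappa> * R)))"
      have "q > 0" unfolding q_def by (rule mult_pos_pos[OF exp_gt_zero vp])
      then show ?thesis using le unfolding q_def[symmetric] by (simp add: pos_le_divide_eq)
    qed
  qed
qed

lemma A_hol: "f \<in> A \<Longrightarrow> f holomorphic_on UNIV" by (simp add: A_def)

text \<open>The test function is, up to a constant, the kernel of the unweighted Fock space. Its
  weighted modulus is a Gaussian bump of height \<open>exp (\<alpha> * (cmod z)\<^sup>2)\<close>
  about \<open>z\<close>, so \<open>gauss_integral_bound\<close> controls its norm by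
  \<open>V z\<close>.\<close>

lemma kernel_lower:
  obtains G where "G > 0" "\<And>z. exp (\<alpha> * (cmod z)\<^sup>2) \<le> G * V z * sqn N (kernel z)"
proof -
  obtain G where G: "G > 0" "\<And>z. (\<integral>\<^sup>+\<xi>. ennreal (exp (- \<alpha> * (cmod (\<xi> - z))\<^sup>2)) \<partial>\<nu>) \<le> ennreal (G * V z)"
    using gauss_integral_bound by metis
  have "exp (\<alpha> * (cmod z)\<^sup>2) \<le> G * V z * sqn N (kernel z)" for z
  proof -
    define f where "f \<xi> = exp (of_real \<alpha> * (\<xi> * cnj z))" for \<xi>
    have hol: "f holomorphic_on UNIV" unfolding f_def by (intro holomorphic_intros)
    have f2: "(cmod (f \<xi>))\<^sup>2 = exp (2 * \<alpha> * Re (\<xi> * cnj z))" for \<xi>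
    proof -
      have "Re (of_real \<alpha> * w) = \<alpha> * Re w" for w by simp
      then show ?thesis unfolding f_def norm_exp_eq_Re by (simp only: exp_double[symmetric] mult.assoc)
    qed
    have Ef: "E f \<xi> = exp (\<alpha> * (cmod z)\<^sup>2) * exp (- \<alpha> * (cmod (\<xi> - z))\<^sup>2)" for \<xi>
      unfolding E_def f2 cmod_diff_square exp_add[symmetric] by (simp add: algebra_simps del: times_complex.sel)
    have gm: "(\<lambda>\<xi>. ennreal (exp (- \<alpha> * (cmod (\<xi> - z))\<^sup>2))) \<in> borel_measurable \<nu>"
      using sets_\<nu> by (simp cong: measurable_cong_sets)
    have "(\<integral>\<^sup>+\<xi>. ennreal ((cmod (f \<xi>))\<^sup>2) \<partial>N) = (\<integral>\<^sup>+\<xi>. ennreal (E f \<xi>) \<partial>\<nu>)"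
      using nn_integral_E[OF sets_\<nu> hol, of UNIV] by (simp add: N_def)
    also have "\<dots> = ennreal (exp (\<alpha> * (cmod z)\<^sup>2)) * (\<integral>\<^sup>+\<xi>. ennreal (exp (- \<alpha> * (cmod (\<xi> - z))\<^sup>2)) \<partial>\<nu>)"
      unfolding Ef by (subst nn_integral_cmult[OF gm, symmetric]) (simp add: ennreal_mult)
    also have "\<dots> \<le> ennreal (exp (\<alpha> * (cmod z)\<^sup>2)) * ennreal (G * V z)"
      by (intro mult_left_mono G) simp
    also have "\<dots> = ennreal (exp (\<alpha> * (cmod z)\<^sup>2) * (G * V z))"
      using G(1) Vpos[of z] by (simp add: ennreal_mult)
    finally have *: "(\<integral>\<^sup>+\<xi>. ennreal ((cmod (f \<xi>))\<^sup>2) \<partial>N) \<le> ennreal (exp (\<alpha> * (cmod z)\<^sup>2) * (G * V z))" .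
    have fm: "f \<in> borel_measurable N"
      using entire_borel[OF hol] sets_N by (simp cong: measurable_cong_sets)
    have "0 \<le> exp (\<alpha> * (cmod z)\<^sup>2) * (G * V z)" using G(1) Vpos[of z] by simp
    note sq = sq_intI_nn[OF fm * this]
    have fA: "f \<in> A" using A_I[OF hol sq(1)] .
    \<comment> \<open>The squared value at \<open>z\<close> contains this exponential twice, the
      bound for \<open>sqn N f\<close> only once; one factor survives.\<close>
    have "exp (\<alpha> * (cmod z)\<^sup>2) * exp (\<alpha> * (cmod z)\<^sup>2) = (cmod (f z))\<^sup>2"
      unfolding f2 exp_add[symmetric] by (simp add: complex_mult_cnj cmod_power2)
    also have "\<dots> \<le> sqn N f * sqn N (kernel z)"
    proof -
      have "(cmod (f z))\<^sup>2 \<le> (sqrt (sqn N f) * sqrt (sqn N (kernel z)))\<^sup>2"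
        by (intro power_mono kernel_bound fA) simp
      then show ?thesis by (simp add: power_mult_distrib sqn_nonneg)
    qed
    also have "\<dots> \<le> (exp (\<alpha> * (cmod z)\<^sup>2) * (G * V z)) * sqn N (kernel z)"
      by (intro mult_right_mono sq sqn_nonneg)
    finally show ?thesis by (simp add: mult.assoc)
  qed
  with G(1) that show ?thesis by blast
qed

lemma kernel_pos: "sqn N (kernel z) > 0"
proof -
  obtain G where G: "G > 0" "\<And>z. exp (\<alpha> * (cmod z)\<^sup>2) \<le> G * V z * sqn N (kernel z)"
    using kernel_lower by metis
  have "0 < G * V z * sqn N (kernel z)" using G(2)[of z] exp_gt_zero less_le_trans by blast
  moreover have "0 < G * V z" using G(1) Vpos[of z] by simp
  ultimately show ?thesis by (simp only: zero_less_mult_pos)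
qed

lemma nkernel_square: "(cmod (nkernel z \<xi>))\<^sup>2 = (cmod (kernel z \<xi>))\<^sup>2 / sqn N (kernel z)"
  using sqn_nonneg[of N "kernel z"] by (simp add: nkernel_def norm_divide power_divide)

text \<open>Near \<open>z\<close> the squared twisted kernel times \<open>V z\<close> is at most
  linear in \<open>S\<close>, while its square at \<open>z\<close> is quadratic in \<open>S\<close>;
  \<open>kernel_lower\<close> pays for the missing factor. So \<open>g\<close> is bounded near
  \<open>z\<close> by a multiple \<open>Q\<close> of its value at \<open>z\<close>, uniformly in
  \<open>z\<close>, and cannot drop below half of that value close to \<open>z\<close>.\<close>

lemma nkernel_lower:
  obtains \<delta> c where "0 < \<delta>" "\<delta> < 1" "c > 0"
    "\<And>z \<xi>. \<xi> \<in> ball z \<delta> \<Longrightarrow> c \<le> E (nkernel z) \<xi> * V z"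
proof -
  obtain G where G: "G > 0" "\<And>z. exp (\<alpha> * (cmod z)\<^sup>2) \<le> G * V z * sqn N (kernel z)"
    using kernel_lower by metis
  obtain K where K: "K > 0" "\<And>f z. f holomorphic_on UNIV \<Longrightarrow> integrable N (\<lambda>x. (cmod (f x))\<^sup>2) \<Longrightarrow>
    E f z * V z \<le> K * sqn N f"
    using point_estimate_global by blast
  \<comment> \<open>Collects the constants of the twist, the point estimate, the passage from
    \<open>V x\<close> to \<open>V z\<close> and the kernel bound.\<close>
  define Q where "Q = sqrt (exp \<alpha> * (K * (C * exp \<kappa>) * G))"
  have Q: "Q > 0" "Q\<^sup>2 = exp \<alpha> * (K * (C * exp \<kappa>) * G)" using K G C by (simp_all add: Q_def)
  \<comment> \<open>On the disc of radius 1/2 the Lipschitz constant is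
    \<open>2 * Q * cmod (g z)\<close>; within \<open>\<delta>\<close> it permits a change of at most
    half of \<open>cmod (g z)\<close>.\<close>
  define \<delta> where "\<delta> = min (1/2) (1 / (4 * Q))"
  have \<delta>: "0 < \<delta>" "\<delta> < 1" "\<delta> \<le> 1/2" "2 * Q * \<delta> \<le> 1/2"
  proof -
    have "2 * Q * \<delta> \<le> 2 * Q * (1 / (4 * Q))" using Q(1) by (intro mult_left_mono) (auto simp: \<delta>_def)
    then show "2 * Q * \<delta> \<le> 1/2" using Q(1) by simp
  qed (use Q(1) in \<open>auto simp: \<delta>_def\<close>)
  define c where "c = exp (- \<alpha>) / (4 * G)"
  have "c \<le> E (nkernel z) \<xi> * V z" if \<xi>: "\<xi> \<in> ball z \<delta>" for z \<xi>
  proof -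
    define S where "S = sqn N (kernel z)"
    have S: "S > 0" using kernel_pos by (simp add: S_def)
    have hol: "kernel z holomorphic_on UNIV" using kernel_A A_hol by blast
    define g where "g = twist \<alpha> z (kernel z)"
    have gE: "(cmod (g x))\<^sup>2 = E (kernel z) x * exp (\<alpha> * (cmod (x - z))\<^sup>2)" for x
      by (simp add: g_def cmod_twist E_def)
    have gz: "(cmod (g z))\<^sup>2 = S\<^sup>2 * exp (- \<alpha> * (cmod z)\<^sup>2)"
      unfolding gE E_def by (simp add: kernel_diag S_def)
    have GVS: "exp (\<alpha> * (cmod z)\<^sup>2) \<le> G * V z * S" using G(2) by (simp add: S_def)
    have 1: "1 \<le> G * V z * S * exp (- \<alpha> * (cmod z)\<^sup>2)"
      using mult_right_mono[OF GVS, of "exp (- \<alpha> * (cmod z)\<^sup>2)"] by (simp add: exp_minus_inverse exp_add[symmetric])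
    have near: "cmod (g x) \<le> Q * cmod (g z)" if x: "x \<in> cball z 1" for x
    proof -
      have "E (kernel z) x * V z \<le> E (kernel z) x * (C * exp \<kappa> * V x)"
        using V_le[of z x 1] x by (intro mult_left_mono E_nonneg) simp
      also have "\<dots> = (C * exp \<kappa>) * (E (kernel z) x * V x)" by simp
      also have "\<dots> \<le> (C * exp \<kappa>) * (K * S)"
      proof (rule mult_left_mono)
        show "E (kernel z) x * V x \<le> K * S"
          unfolding S_def using kernel_A[of z] by (intro K(2) hol) (simp add: A_def)
      qed (use C in simp)
      finally have 2: "E (kernel z) x * V z \<le> K * (C * exp \<kappa>) * S" by (simp add: mult_ac)
      have ex: "exp (\<alpha> * (cmod (x - z))\<^sup>2) \<le> exp \<alpha>"
        using x \<alpha> by (simp add: dist_norm norm_minus_commute power_le_one mult_left_le)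
      have "(cmod (g x))\<^sup>2 * V z = (E (kernel z) x * V z) * exp (\<alpha> * (cmod (x - z))\<^sup>2)"
        by (simp add: gE)
      also have "\<dots> \<le> (K * (C * exp \<kappa>) * S) * exp \<alpha>"
        using K(1) C S by (intro mult_mono[OF 2 ex]) auto
      \<comment> \<open>A factor that is at least 1 supplies the second \<open>S\<close> and the
        Gaussian that appear in \<open>gz\<close>.\<close>
      also have "\<dots> \<le> ((K * (C * exp \<kappa>) * S) * exp \<alpha>) * (G * V z * S * exp (- \<alpha> * (cmod z)\<^sup>2))"
      proof -
        have "0 \<le> (K * (C * exp \<kappa>) * S) * exp \<alpha>" using K(1) C S by simp
        from mult_left_mono[OF 1 this] show ?thesis by (simp only: mult_1_right)
      qed
      also have "\<dots> = (Q * cmod (g z))\<^sup>2 * V z"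
        unfolding power_mult_distrib gz Q(2) power2_eq_square[of S] by (simp only: mult_ac)
      finally have "(cmod (g x))\<^sup>2 \<le> (Q * cmod (g z))\<^sup>2" by (rule mult_right_le_imp_le[OF _ Vpos])
      then show ?thesis by (rule power2_le_imp_le) (use Q(1) in simp)
    qed
    have "cmod (g \<xi> - g z) \<le> (Q * cmod (g z)) / (1/2) * cmod (\<xi> - z)"
    proof (rule entire_lipschitz)
      show "g holomorphic_on UNIV" unfolding g_def by (rule twist_holomorphic[OF hol])
      show "cmod (g x) \<le> Q * cmod (g z)" if "x \<in> cball z (2 * (1/2))" for x
        using that by (intro near) simp
      show "\<xi> \<in> cball z (1/2)" using \<xi> \<delta>(3) by simp
    qed simp
    also have "\<dots> \<le> (Q * cmod (g z)) / (1/2) * \<delta>"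
    proof (rule mult_left_mono)
      show "cmod (\<xi> - z) \<le> \<delta>" using \<xi> by (simp add: dist_norm norm_minus_commute)
    qed (use Q(1) in simp)
    also have "\<dots> = (2 * Q * \<delta>) * cmod (g z)" by simp
    also have "\<dots> \<le> 1/2 * cmod (g z)" by (intro mult_right_mono \<delta>) simp
    finally have "cmod (g z) / 2 \<le> cmod (g \<xi>)"
      using norm_triangle_ineq2[of "g z" "g \<xi>"] by (simp add: norm_minus_commute)
    then have "(cmod (g z) / 2)\<^sup>2 \<le> (cmod (g \<xi>))\<^sup>2" by (intro power_mono) auto
    also have "\<dots> \<le> E (kernel z) \<xi> * exp \<alpha>"
      unfolding gE using \<xi> \<alpha> \<delta>
      by (intro mult_left_mono E_nonneg) (auto simp: dist_norm norm_minus_commute intro!: mult_left_le power_le_one)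
    finally have "S\<^sup>2 * exp (- \<alpha> * (cmod z)\<^sup>2) / 4 \<le> E (kernel z) \<xi> * exp \<alpha>"
      by (simp add: power_divide gz)
    then have "exp (- \<alpha>) * (S\<^sup>2 * exp (- \<alpha> * (cmod z)\<^sup>2) / 4) \<le> exp (- \<alpha>) * (E (kernel z) \<xi> * exp \<alpha>)"
      by (intro mult_left_mono) auto
    then have 3: "exp (- \<alpha>) * S\<^sup>2 * exp (- \<alpha> * (cmod z)\<^sup>2) / 4 \<le> E (kernel z) \<xi>"
      by (simp add: exp_minus field_simps)
    have "c * 1 \<le> c * (G * V z * S * exp (- \<alpha> * (cmod z)\<^sup>2))"
      using 1 G(1) by (intro mult_left_mono) (auto simp: c_def)
    also have "\<dots> = (exp (- \<alpha>) * S\<^sup>2 * exp (- \<alpha> * (cmod z)\<^sup>2) / 4) / S * V z"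
      using G(1) S by (simp add: c_def power2_eq_square)
    also have "\<dots> \<le> E (kernel z) \<xi> / S * V z"
      using 3 S Vpos[of z] by (intro mult_right_mono divide_right_mono) auto
    also have "\<dots> = E (nkernel z) \<xi> * V z"
      unfolding E_def nkernel_square by (simp add: S_def)
    finally show ?thesis by simp
  qed
  moreover have "c > 0" using G(1) by (simp add: c_def)
  ultimately show ?thesis using that \<delta>(1,2) by blast
qed

lemma tail_tendsto_0:
  assumes f: "f \<in> A"
  shows "(\<lambda>n. \<integral>\<^sup>+x\<in>-cball 0 (real n). ennreal ((cmod (f x))\<^sup>2) \<partial>N) \<longlonglongrightarrow> 0"
proof -
  have [measurable]: "f \<in> borel_measurable N" using A_sq_int[OF f] by (simp add: sq_int_def)
  have [measurable]: "- cball 0 r \<in> sets N" for r :: real using sets_N by simp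
  have "(\<lambda>n. \<integral>\<^sup>+x. ennreal ((cmod (f x))\<^sup>2) * indicator (-cball 0 (real n)) x \<partial>N) \<longlonglongrightarrow> (\<integral>\<^sup>+x. 0 \<partial>N)"
  proof (rule nn_integral_dominated_convergence)
    show "(\<integral>\<^sup>+x. ennreal ((cmod (f x))\<^sup>2) \<partial>N) < \<infinity>"
      by (simp add: nn_integral_sq[OF A_sq_int[OF f]])
    show "AE x in N. (\<lambda>n. ennreal ((cmod (f x))\<^sup>2) * indicator (-cball 0 (real n)) x) \<longlonglongrightarrow> 0"
    proof (intro AE_I2 tendsto_eventually)
      fix x :: complex
      have "eventually (\<lambda>n. cmod x \<le> real n) sequentially"
        using filterlim_real_sequentially eventually_compose_filterlim eventually_ge_at_top by blast
      then show "eventually (\<lambda>n. ennreal ((cmod (f x))\<^sup>2) * indicator (-cball 0 (real n)) x = 0) sequentially"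
        by eventually_elim simp
    qed
  qed (auto split: split_indicator)
  then show ?thesis by simp
qed

text \<open>The point estimate sees only the mass of \<open>f\<close> in the unit disc about
  \<open>z\<close>, a tail of a convergent integral; \<open>kernel_lower\<close> converts the
  remaining \<open>V z\<close> into the kernel norm. In Hilbert space terms, the normalised kernels
  tend weakly to 0.\<close>

lemma kernel_vanish:
  assumes f: "f \<in> A"
  shows "((\<lambda>z. (cmod (f z))\<^sup>2 / sqn N (kernel z)) \<longlongrightarrow> 0) at_infinity"
proof -
  obtain G where G: "G > 0" "\<And>z. exp (\<alpha> * (cmod z)\<^sup>2) \<le> G * V z * sqn N (kernel z)"
    using kernel_lower by metis
  obtain K where K: "K > 0" "\<And>f z. f holomorphic_on UNIV \<Longrightarrow>
    ennreal (E f z * V z) \<le> ennreal K * (\<integral>\<^sup>+\<xi>\<in>ball z 1. ennreal ((cmod (f \<xi>))\<^sup>2) \<partial>N)"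
    using point_estimate[of 1] by auto
  show ?thesis
    unfolding tendsto_iff eventually_at_infinity
  proof (intro allI impI)
    fix e :: real assume e: "e > 0"
    have "eventually (\<lambda>n. (\<integral>\<^sup>+x\<in>-cball 0 (real n). ennreal ((cmod (f x))\<^sup>2) \<partial>N) < ennreal (e / (2 * G * K))) sequentially"
      using tail_tendsto_0[OF f] e G(1) K(1) by (intro order_tendstoD) (auto simp: ennreal_zero_less_divide)
    then obtain n :: nat where n: "(\<integral>\<^sup>+x\<in>-cball 0 (real n). ennreal ((cmod (f x))\<^sup>2) \<partial>N) < ennreal (e / (2 * G * K))"
      by (auto simp: eventually_sequentially)
    \<comment> \<open>The \<open>+ 1\<close> keeps the unit disc about \<open>z\<close> off
      \<open>cball 0 (real n)\<close>.\<close>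
    have "dist ((cmod (f z))\<^sup>2 / sqn N (kernel z)) 0 < e" if z: "real n + 1 \<le> cmod z" for z
    proof -
      have sub: "ball z 1 \<subseteq> - cball 0 (real n)"
      proof
        fix x assume "x \<in> ball z 1"
        then show "x \<in> - cball 0 (real n)"
          using z norm_triangle_sub[of z x] by (simp add: dist_norm)
      qed
      have "ennreal (E f z * V z) \<le> ennreal K * (\<integral>\<^sup>+\<xi>\<in>ball z 1. ennreal ((cmod (f \<xi>))\<^sup>2) \<partial>N)"
        by (rule K(2)[OF A_hol[OF f]])
      also have "\<dots> \<le> ennreal K * (\<integral>\<^sup>+\<xi>\<in>-cball 0 (real n). ennreal ((cmod (f \<xi>))\<^sup>2) \<partial>N)"
        using sub by (intro mult_left_mono nn_integral_mono) (auto split: split_indicator)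
      also have "\<dots> \<le> ennreal K * ennreal (e / (2 * G * K))"
        using n by (intro mult_left_mono) auto
      also have "\<dots> = ennreal (K * (e / (2 * G * K)))"
        using e G(1) K(1) by (intro ennreal_mult[symmetric]) auto
      also have "K * (e / (2 * G * K)) = e / (2 * G)" using K(1) by simp
      finally have 1: "E f z * V z \<le> e / (2 * G)"
        using e G(1) by (subst (asm) ennreal_le_iff) auto
      have S: "sqn N (kernel z) > 0" by (rule kernel_pos)
      have "(cmod (f z))\<^sup>2 = E f z * exp (\<alpha> * (cmod z)\<^sup>2)"
        by (simp add: E_def mult.assoc exp_add[symmetric])
      also have "\<dots> \<le> E f z * (G * V z * sqn N (kernel z))"
        by (intro mult_left_mono G E_nonneg)
      also have "\<dots> = (E f z * V z) * (G * sqn N (kernel z))" by simp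
      also have "\<dots> \<le> e / (2 * G) * (G * sqn N (kernel z))"
        using S G(1) by (intro mult_right_mono 1) auto
      also have "\<dots> = e / 2 * sqn N (kernel z)" using G(1) by simp
      finally have "(cmod (f z))\<^sup>2 / sqn N (kernel z) \<le> e / 2" using S by (simp add: pos_divide_le_eq)
      then have "(cmod (f z))\<^sup>2 / sqn N (kernel z) < e" using e by linarith
      then show ?thesis using S by simp
    qed
    then show "\<exists>b. \<forall>z. b \<le> cmod z \<longrightarrow> dist ((cmod (f z))\<^sup>2 / sqn N (kernel z)) 0 < e" by blast
  qed
qed

end


section \<open>Carleson estimates\<close>

lemma sigma_finite_if_finite_on_cballs:
  fixes \<tau> :: "complex measure"
  assumes "sets \<tau> = sets borel" "\<And>R. emeasure \<tau> (cball 0 R) < \<infinity>"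
  shows "sigma_finite_measure \<tau>"
proof
  have "\<Union>(range (\<lambda>n. cball (0::complex) (real n))) = UNIV"
    using real_arch_simple by (auto simp: dist_norm)
  then show "\<exists>S. countable S \<and> S \<subseteq> sets \<tau> \<and> \<Union>S = space \<tau> \<and> (\<forall>a\<in>S. emeasure \<tau> a \<noteq> \<infinity>)"
    using assms sets_eq_imp_space_eq[OF assms(1)]
    by (intro exI[of _ "range (\<lambda>n. cball 0 (real n))"]) (auto simp: less_top)
qed

context doubling_measure
begin

declare ball_sets [measurable del]

lemma gauss_finite:
  assumes "sets \<mu> = sets borel" "\<And>R. emeasure \<mu> (cball 0 R) < \<infinity>"
  shows "emeasure (gauss \<alpha> \<mu>) (cball 0 R) < \<infinity>"
proof -
  have "emeasure (gauss \<alpha> \<mu>) (cball 0 R) = (\<integral>\<^sup>+x. indicator (cball 0 R) x \<partial>gauss \<alpha> \<mu>)"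
    using assms by simp
  also have "\<dots> = (\<integral>\<^sup>+x. ennreal (exp (- \<alpha> * (cmod x)\<^sup>2)) * indicator (cball 0 R) x \<partial>\<mu>)"
    by (rule nn_integral_gauss[OF assms(1)]) (rule borel_measurable_indicator, simp)
  also have "\<dots> \<le> (\<integral>\<^sup>+x. indicator (cball 0 R) x \<partial>\<mu>)"
    using \<alpha> by (intro nn_integral_mono) (auto split: split_indicator simp: ennreal_le_1)
  also have "\<dots> = emeasure \<mu> (cball 0 R)" using assms by simp
  also have "\<dots> < \<infinity>" by (rule assms)
  finally show ?thesis .
qed

text \<open>For Fubini with the weight \<open>1 / V\<close>: \<open>V z\<close> is the measure of a
  section of the open set of pairs at distance below 1.\<close>

lemma V_measurable: "V \<in> borel_measurable borel"
proof -
  interpret sigma_finite_measure \<nu>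
    by (rule sigma_finite_if_finite_on_cballs[OF sets_\<nu> fin])
  define U where "U = {p :: complex \<times> complex. dist (fst p) (snd p) < 1}"
  have "open U" unfolding U_def by (intro open_Collect_less continuous_intros)
  then have "U \<in> sets (borel \<Otimes>\<^sub>M \<nu>)"
    unfolding sets_pair_measure_cong[OF refl sets_\<nu>] borel_prod by simp
  then have "(\<lambda>z. emeasure \<nu> (Pair z -` U)) \<in> borel_measurable borel"
    by (rule measurable_emeasure_Pair)
  moreover have "Pair z -` U = ball z 1" for z by (auto simp: U_def)
  ultimately show ?thesis unfolding V_def[abs_def] measure_def by simp
qed

text \<open>\<open>K\<close> is fixed before \<open>\<tau>\<close>, \<open>B\<close> and
  \<open>f\<close>, so that the estimate serves both a measure and its restriction to the outside of
  a large disc, where \<open>B\<close> is small.\<close>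

lemma carleson:
  assumes r: "0 < r" "r \<le> 1"
  obtains K where "K > 0" "\<And>\<tau> B f. sets \<tau> = sets borel \<Longrightarrow> (\<And>R. emeasure \<tau> (cball 0 R) < \<infinity>) \<Longrightarrow> B \<ge> 0 \<Longrightarrow>
    (\<And>u. emeasure \<tau> (ball u r) \<le> ennreal (B * V u)) \<Longrightarrow> f \<in> A \<Longrightarrow>
    (\<integral>\<^sup>+\<xi>. ennreal (E f \<xi>) \<partial>\<tau>) \<le> ennreal (K * B * sqn N f)"
proof -
  obtain K where K: "K > 0" "\<And>f z. f holomorphic_on UNIV \<Longrightarrow>
    ennreal (E f z * V z) \<le> ennreal K * (\<integral>\<^sup>+\<xi>\<in>ball z r. ennreal ((cmod (f \<xi>))\<^sup>2) \<partial>N)"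
    using point_estimate[OF r] by metis
  define D where "D = C * exp \<kappa>"
  have D: "D > 0" using C by (simp add: D_def)
  have "(\<integral>\<^sup>+\<xi>. ennreal (E f \<xi>) \<partial>\<tau>) \<le> ennreal (K * D * B * sqn N f)"
    if sets_\<tau>: "sets \<tau> = sets borel" and fin_\<tau>: "\<And>R. emeasure \<tau> (cball 0 R) < \<infinity>" and B: "B \<ge> 0"
      and bd: "\<And>u. emeasure \<tau> (ball u r) \<le> ennreal (B * V u)" and f: "f \<in> A" for \<tau> B f
  proof -
    have [measurable]: "f \<in> borel_measurable borel" using A_hol[OF f] entire_borel by blast
    have [measurable]: "V \<in> borel_measurable borel" by (rule V_measurable)
    have [measurable_cong]: "sets N = sets borel" "sets \<tau> = sets borel" by (simp_all add: sets_N sets_\<tau>)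
    interpret S1: sigma_finite_measure \<tau>
      by (rule sigma_finite_if_finite_on_cballs[OF sets_\<tau> fin_\<tau>])
    have "emeasure N (cball 0 R) < \<infinity>" for R
      unfolding N_def by (rule gauss_finite[OF sets_\<nu> fin])
    then interpret S2: sigma_finite_measure N
      by (intro sigma_finite_if_finite_on_cballs sets_N)
    interpret P: pair_sigma_finite N \<tau> ..
    \<comment> \<open>\<open>1 / V \<xi>\<close> is replaced by \<open>D / V u\<close> before the
      swap, so that afterwards the inner integral is just the measure of \<open>ball u r\<close> and
      the \<open>V u\<close> of its bound cancels.\<close>
    define h where "h u = ennreal (K * D) * ennreal ((cmod (f u))\<^sup>2 / V u)" for u
    have [measurable]: "h \<in> borel_measurable borel" unfolding h_def by measurable
    have swap: "(\<lambda>(u, \<xi>). h u * indicator {p :: complex \<times> complex. dist (fst p) (snd p) < r} (u, \<xi>)) \<in> borel_measurable (N \<Otimes>\<^sub>M \<tau>)"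
    proof -
      have "open {p :: complex \<times> complex. dist (fst p) (snd p) < r}" by (intro open_Collect_less continuous_intros)
      then have [measurable]: "{p :: complex \<times> complex. dist (fst p) (snd p) < r} \<in> sets (N \<Otimes>\<^sub>M \<tau>)"
        unfolding sets_pair_measure_cong[OF sets_N sets_\<tau>] borel_prod by simp
      show ?thesis unfolding case_prod_beta prod.collapse by measurable
    qed
    have ind: "indicator {p :: complex \<times> complex. dist (fst p) (snd p) < r} (u, \<xi>) = (indicator (ball \<xi> r) u :: ennreal)"
      "indicator {p :: complex \<times> complex. dist (fst p) (snd p) < r} (u, \<xi>) = (indicator (ball u r) \<xi> :: ennreal)" for u \<xi>
      by (auto split: split_indicator simp: dist_commute)
    have "(\<integral>\<^sup>+\<xi>. ennreal (E f \<xi>) \<partial>\<tau>) \<le> (\<integral>\<^sup>+\<xi>. (\<integral>\<^sup>+u. h u * indicator (ball \<xi> r) u \<partial>N) \<partial>\<tau>)"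
    proof (rule nn_integral_mono)
      fix \<xi>
      have "ennreal (E f \<xi>) = ennreal (1 / V \<xi>) * ennreal (E f \<xi> * V \<xi>)"
        using Vpos[of \<xi>] E_nonneg[of f \<xi>] by (subst ennreal_mult[symmetric]) auto
      also have "\<dots> \<le> ennreal (1 / V \<xi>) * (ennreal K * (\<integral>\<^sup>+u\<in>ball \<xi> r. ennreal ((cmod (f u))\<^sup>2) \<partial>N))"
        by (intro mult_left_mono K(2) A_hol f) simp
      also have "\<dots> = (\<integral>\<^sup>+u. ennreal (1 / V \<xi>) * ennreal K * (ennreal ((cmod (f u))\<^sup>2) * indicator (ball \<xi> r) u) \<partial>N)"
      proof -
        have "(\<lambda>u. ennreal ((cmod (f u))\<^sup>2) * indicator (ball \<xi> r) u) \<in> borel_measurable N"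
          by (rule borel_measurable_times_ennreal; (rule borel_measurable_indicator)?)
            (simp_all add: sets_N)
        from nn_integral_cmult[OF this] show ?thesis by (simp only: mult.assoc[symmetric])
      qed
      also have "\<dots> \<le> (\<integral>\<^sup>+u. h u * indicator (ball \<xi> r) u \<partial>N)"
      proof (rule nn_integral_mono)
        fix u
        have "1 / V \<xi> \<le> D / V u" if "u \<in> ball \<xi> r"
          using V_le[of u \<xi> 1] that r Vpos[of u] Vpos[of \<xi>] by (simp add: D_def field_simps dist_commute)
        then have "1 / V \<xi> * K * (cmod (f u))\<^sup>2 \<le> (K * D) * ((cmod (f u))\<^sup>2 / V u)" if "u \<in> ball \<xi> r"
          using mult_right_mono[of "1 / V \<xi>" "D / V u" "K * (cmod (f u))\<^sup>2"] that K(1) by (simp add: mult_ac)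
        then have "ennreal (1 / V \<xi> * K * (cmod (f u))\<^sup>2) \<le> h u" if "u \<in> ball \<xi> r"
          unfolding h_def using that K(1) D Vpos[of u]
          by (subst ennreal_mult[symmetric]) (auto intro!: ennreal_leI simp del: times_divide_eq_left times_divide_eq_right)
        then show "ennreal (1 / V \<xi>) * ennreal K * (ennreal ((cmod (f u))\<^sup>2) * indicator (ball \<xi> r) u) \<le> h u * indicator (ball \<xi> r) u"
          using Vpos[of \<xi>] K(1) by (auto split: split_indicator simp: ennreal_mult[symmetric] mult.assoc)
      qed
      finally show "ennreal (E f \<xi>) \<le> (\<integral>\<^sup>+u. h u * indicator (ball \<xi> r) u \<partial>N)" .
    qed
    also have "\<dots> = (\<integral>\<^sup>+\<xi>. (\<integral>\<^sup>+u. h u * indicator {p. dist (fst p) (snd p) < r} (u, \<xi>) \<partial>N) \<partial>\<tau>)"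
      by (simp only: ind(1))
    also have "\<dots> = (\<integral>\<^sup>+u. (\<integral>\<^sup>+\<xi>. h u * indicator {p. dist (fst p) (snd p) < r} (u, \<xi>) \<partial>\<tau>) \<partial>N)"
      by (rule P.Fubini'[OF swap])
    also have "\<dots> = (\<integral>\<^sup>+u. (\<integral>\<^sup>+\<xi>. h u * indicator (ball u r) \<xi> \<partial>\<tau>) \<partial>N)"
      by (simp only: ind(2))
    also have "\<dots> = (\<integral>\<^sup>+u. h u * emeasure \<tau> (ball u r) \<partial>N)"
      using sets_\<tau> by (intro nn_integral_cong nn_integral_cmult_indicator) simp
    also have "\<dots> \<le> (\<integral>\<^sup>+u. ennreal (K * D * B) * ennreal ((cmod (f u))\<^sup>2) \<partial>N)"
    proof (rule nn_integral_mono)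
      fix u
      have "h u * emeasure \<tau> (ball u r) \<le> h u * ennreal (B * V u)" by (intro mult_left_mono bd) simp
      also have "\<dots> = ennreal ((K * D) * ((cmod (f u))\<^sup>2 / V u) * (B * V u))"
        unfolding h_def using K(1) D B Vpos[of u] by (simp add: ennreal_mult del: times_divide_eq_left times_divide_eq_right)
      also have "(K * D) * ((cmod (f u))\<^sup>2 / V u) * (B * V u) = (K * D * B) * (cmod (f u))\<^sup>2"
        using Vpos[of u] by simp
      finally show "h u * emeasure \<tau> (ball u r) \<le> ennreal (K * D * B) * ennreal ((cmod (f u))\<^sup>2)"
        using K(1) D B by (simp add: ennreal_mult)
    qed
    also have "\<dots> = ennreal (K * D * B * sqn N f)"
      using K(1) D B by (subst nn_integral_cmult) (auto simp: nn_integral_sq[OF A_sq_int[OF f]] ennreal_mult sqn_nonneg)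
    finally show ?thesis .
  qed
  then show ?thesis using K(1) D by (intro that[of "K * D"]) auto
qed

definition avgf :: "complex measure \<Rightarrow> real \<Rightarrow> complex \<Rightarrow> ennreal" where
  "avgf \<mu> r z = emeasure \<mu> (ball z r) / emeasure \<nu> (ball z r)"

text \<open>In \<open>ennreal\<close> the division in \<open>avgf\<close> can be undone only for a
  positive finite denominator; positivity comes from \<open>doubling\<close> at equal centres. Then
  \<open>V z\<close> bounds the mass of the smaller disc.\<close>

lemma avgf_small:
  assumes "avgf \<mu> r z \<le> ennreal e" "r > 0" "r \<le> 1" "e \<ge> 0"
  shows "emeasure \<mu> (ball z r) \<le> ennreal (e * V z)"
proof -
  have p: "measure \<nu> (ball z r) > 0"
  proof -
    have "0 < V z * r ^ m" using Vpos assms by simp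
    also have "\<dots> \<le> C * exp (\<kappa> * dist z z) * measure \<nu> (ball z r)"
      unfolding V_def using assms by (intro doubling) auto
    finally show ?thesis using C by (simp add: zero_less_mult_iff)
  qed
  have le: "measure \<nu> (ball z r) \<le> V z"
    unfolding V_def using assms by (intro measure_mono_fmeasurable ball_fmeasurable) (auto simp: sets_\<nu>)
  have "emeasure \<mu> (ball z r) = avgf \<mu> r z * emeasure \<nu> (ball z r)"
  proof -
    have "inverse (ennreal (measure \<nu> (ball z r))) * ennreal (measure \<nu> (ball z r)) = 1"
      using p by (simp add: inverse_ennreal ennreal_mult[symmetric])
    then show ?thesis unfolding avgf_def emeasure_ball divide_ennreal_def by (simp add: mult.assoc)
  qed
  also have "\<dots> \<le> ennreal e * ennreal (V z)"
    unfolding emeasure_ball using assms le by (intro mult_mono ennreal_leI) auto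
  finally show ?thesis using assms Vpos[of z] by (simp add: ennreal_mult)
qed

end


section \<open>Implications between averages, Berezin transform and compactness\<close>

context doubling_measure
begin

text \<open>Integrating \<open>nkernel_lower\<close> over \<open>ball z r\<close> bounds the
  \<open>\<mu>\<close>-mass of this disc by a multiple of \<open>V z\<close> times the transform;
  \<open>doubling\<close> compares \<open>V z\<close> with the \<open>\<nu>\<close>-mass of the disc
  at the price of \<open>r ^ m\<close>. The radius \<open>\<delta>\<close> is that of
  \<open>nkernel_lower\<close>, hence independent of \<open>\<mu>\<close>.\<close>

lemma avgf_tendsto_0_if_ber:
  obtains \<delta> where "0 < \<delta>" "\<delta> < 1"
    "\<And>\<mu> r. sets \<mu> = sets borel \<Longrightarrow> (ber (gauss \<alpha> \<mu>) \<longlongrightarrow> 0) at_infinity \<Longrightarrow> 0 < r \<Longrightarrow> r < \<delta> \<Longrightarrow>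
      (avgf \<mu> r \<longlongrightarrow> 0) at_infinity"
proof -
  obtain \<delta> c where \<delta>: "0 < \<delta>" "\<delta> < 1" and c: "c > 0"
    "\<And>z \<xi>. \<xi> \<in> ball z \<delta> \<Longrightarrow> c \<le> E (nkernel z) \<xi> * V z"
    using nkernel_lower by metis
  have "(avgf \<mu> r \<longlongrightarrow> 0) at_infinity"
    if sets: "sets \<mu> = sets borel" and lim: "(ber (gauss \<alpha> \<mu>) \<longlongrightarrow> 0) at_infinity" and r: "0 < r" "r < \<delta>" for \<mu> r
  proof (rule tendsto_sandwich[OF _ _ tendsto_const])
    have "avgf \<mu> r z \<le> ennreal (C / (c * r ^ m)) * ber (gauss \<alpha> \<mu>) z" for z
    proof -
      define q where "q = measure \<nu> (ball z r)"
      have dq: "V z * r ^ m \<le> C * q"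
        using doubling[of r z z] r \<delta> by (simp add: V_def q_def)
      have "0 < V z * r ^ m" using Vpos r by simp
      with dq have "0 < C * q" by linarith
      then have q: "q > 0" using C by (simp only: zero_less_mult_pos)
      have hol: "nkernel z holomorphic_on UNIV"
        using A_hol[OF kernel_A[of z]] kernel_pos[of z] unfolding nkernel_def by (intro holomorphic_intros) auto
      have "ennreal (c / V z) * emeasure \<mu> (ball z r) = (\<integral>\<^sup>+\<xi>\<in>ball z r. ennreal (c / V z) \<partial>\<mu>)"
        using sets by (subst nn_integral_cmult_indicator) auto
      also have "\<dots> \<le> (\<integral>\<^sup>+\<xi>\<in>UNIV. ennreal (E (nkernel z) \<xi>) \<partial>\<mu>)"
      proof (rule nn_integral_mono)
        fix \<xi>
        have "c / V z \<le> E (nkernel z) \<xi>" if "\<xi> \<in> ball z r"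
          using c(2)[of \<xi> z] that r Vpos[of z] by (simp add: pos_divide_le_eq)
        then show "ennreal (c / V z) * indicator (ball z r) \<xi> \<le> ennreal (E (nkernel z) \<xi>) * indicator UNIV \<xi>"
          by (auto split: split_indicator intro!: ennreal_leI)
      qed
      also have "\<dots> = ber (gauss \<alpha> \<mu>) z"
        unfolding ber_def using nn_integral_E[OF sets hol, of UNIV] by simp
      finally have 1: "ennreal (c / V z) * emeasure \<mu> (ball z r) \<le> ber (gauss \<alpha> \<mu>) z" .
      have "avgf \<mu> r z = ennreal (1 / q) * emeasure \<mu> (ball z r)"
        unfolding avgf_def emeasure_ball divide_ennreal_def q_def[symmetric]
        using q by (simp add: inverse_ennreal inverse_eq_divide mult.commute)
      also have "\<dots> = ennreal (V z / (c * q)) * (ennreal (c / V z) * emeasure \<mu> (ball z r))"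
        unfolding mult.assoc[symmetric]
        by (subst ennreal_mult[symmetric]) (use q c(1) Vpos[of z] in \<open>auto simp: field_simps\<close>)
      also have "\<dots> \<le> ennreal (C / (c * r ^ m)) * ber (gauss \<alpha> \<mu>) z"
      proof (intro mult_mono 1 ennreal_leI)
        show "V z / (c * q) \<le> C / (c * r ^ m)"
          using dq q c(1) r by (simp add: divide_simps mult_ac)
      qed auto
      finally show ?thesis .
    qed
    then show "eventually (\<lambda>z. avgf \<mu> r z \<le> ennreal (C / (c * r ^ m)) * ber (gauss \<alpha> \<mu>) z) at_infinity"
      by simp
    have "((\<lambda>z. ennreal (C / (c * r ^ m)) * ber (gauss \<alpha> \<mu>) z) \<longlongrightarrow> ennreal (C / (c * r ^ m)) * 0) at_infinity"
      by (rule ennreal_tendsto_cmult[OF _ lim]) simp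
    then show "((\<lambda>z. ennreal (C / (c * r ^ m)) * ber (gauss \<alpha> \<mu>) z) \<longlongrightarrow> 0) at_infinity"
      by simp
  qed simp
  with \<delta> that show ?thesis by blast
qed

lemma avgf_eventually:
  assumes lim: "(avgf \<mu> r \<longlongrightarrow> 0) at_infinity" and r: "0 < r" "r \<le> 1" and e: "e > 0"
  obtains R where "R \<ge> 0" "\<And>z. cmod z \<ge> R \<Longrightarrow> emeasure \<mu> (ball z r) \<le> ennreal (e * V z)"
proof -
  have "eventually (\<lambda>z. avgf \<mu> r z < ennreal e) at_infinity"
    using e by (intro order_tendstoD[OF lim]) simp
  then obtain R where R: "\<And>z. cmod z \<ge> R \<Longrightarrow> avgf \<mu> r z < ennreal e"
    unfolding eventually_at_infinity by blast
  then have "emeasure \<mu> (ball z r) \<le> ennreal (e * V z)" if "cmod z \<ge> max R 0" for z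
    using that e r by (intro avgf_small) (auto intro: less_imp_le)
  then show ?thesis by (intro that[of "max R 0"]) auto
qed

lemma toep_compact_if_avgf:
  assumes sets: "sets \<mu> = sets borel" and fin_\<mu>: "\<And>R. emeasure \<mu> (cball 0 R) < \<infinity>"
    and r: "0 < r" "r < 1" and lim: "(avgf \<mu> r \<longlongrightarrow> 0) at_infinity"
  shows "\<And>f. f \<in> A \<Longrightarrow> sq_int (gauss \<alpha> \<mu>) f" "compact_op (toep (gauss \<alpha> \<mu>))"
proof -
  obtain K where K: "K > 0" "\<And>\<tau> B f. sets \<tau> = sets borel \<Longrightarrow> (\<And>R. emeasure \<tau> (cball 0 R) < \<infinity>) \<Longrightarrow> B \<ge> 0 \<Longrightarrow>
    (\<And>u. emeasure \<tau> (ball u r) \<le> ennreal (B * V u)) \<Longrightarrow> f \<in> A \<Longrightarrow>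
    (\<integral>\<^sup>+\<xi>. ennreal (E f \<xi>) \<partial>\<tau>) \<le> ennreal (K * B * sqn N f)"
    using carleson[of r] r by (metis less_imp_le)
  obtain R1 where R1: "R1 \<ge> 0" "\<And>z. cmod z \<ge> R1 \<Longrightarrow> emeasure \<mu> (ball z r) \<le> ennreal (1 * V z)"
    using avgf_eventually[OF lim, of 1] r by auto
  define M1 where "M1 = measure \<mu> (cball 0 (R1 + 1))"
  have M1: "emeasure \<mu> (cball 0 (R1 + 1)) = ennreal M1"
    using fin_\<mu>[of "R1 + 1"] by (simp add: M1_def emeasure_eq_ennreal_measure less_top[symmetric])
  have M10: "M1 \<ge> 0" by (simp add: M1_def)
  define D where "D = C * exp (\<kappa> * R1)"
  have D: "D > 0" using C by (simp add: D_def)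
  \<comment> \<open>Centres beyond \<open>R1\<close> are handled by averages at most 1. The discs
    about the others lie in \<open>cball 0 (R1 + 1)\<close>, where \<open>\<mu>\<close> is finite,
    and \<open>V\<close> is bounded below at these centres.\<close>
  define B where "B = 1 + M1 * D / V 0"
  have B0: "B \<ge> 1" using M10 D Vpos[of 0] by (simp add: B_def)
  have bd: "emeasure \<mu> (ball u r) \<le> ennreal (B * V u)" for u
  proof (cases "cmod u \<ge> R1")
    case True
    have "1 * V u \<le> B * V u" using B0 Vpos[of u] by (intro mult_right_mono) auto
    then show ?thesis using R1(2)[OF True] ennreal_leI order_trans by blast
  next
    case False
    have "ball u r \<subseteq> cball 0 (R1 + 1)"
    proof
      fix x assume "x \<in> ball u r"
      then show "x \<in> cball 0 (R1 + 1)"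
        using False r norm_triangle_sub[of x u] by (simp add: dist_norm norm_minus_commute)
    qed
    then have "emeasure \<mu> (ball u r) \<le> ennreal M1"
      unfolding M1[symmetric] using sets by (intro emeasure_mono) auto
    also have "M1 \<le> B * V u"
    proof -
      have "V 0 \<le> D * V u" using V_le[of 0 u R1] False by (simp add: D_def)
      then have "1 \<le> D / V 0 * V u" using Vpos[of 0] by (simp add: field_simps)
      then have "M1 * 1 \<le> M1 * (D / V 0 * V u)" using M10 by (intro mult_left_mono)
      also have "\<dots> \<le> B * V u" using Vpos[of u] by (simp add: B_def distrib_right)
      finally show ?thesis by simp
    qed
    finally show ?thesis by (simp add: ennreal_leI)
  qed
  have nn: "(\<integral>\<^sup>+\<xi>. ennreal ((cmod (f \<xi>))\<^sup>2) \<partial>gauss \<alpha> \<mu>) \<le> ennreal (K * B * sqn N f)" if f: "f \<in> A" for f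
    using K(2)[OF sets fin_\<mu> _ bd f] B0 nn_integral_E[OF sets A_hol[OF f], of UNIV] by simp
  have fm: "f \<in> borel_measurable (gauss \<alpha> \<mu>)" if "f \<in> A" for f
    using entire_borel[OF A_hol[OF that]] sets by (simp cong: measurable_cong_sets)
  have p: "0 \<le> K * B * sqn N f" for f using K(1) B0 sqn_nonneg[of N f] by simp
  show sq: "sq_int (gauss \<alpha> \<mu>) f" if f: "f \<in> A" for f
    by (rule sq_intI_nn(1)[OF fm nn p]) (rule f)+
  show "compact_op (toep (gauss \<alpha> \<mu>))"
  proof (rule toep_compact)
    show "sets (gauss \<alpha> \<mu>) = sets borel" using sets by simp
    show "emeasure (gauss \<alpha> \<mu>) (cball 0 R) < \<infinity>" for R by (rule gauss_finite[OF sets fin_\<mu>])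
    show "sq_int (gauss \<alpha> \<mu>) f" if "f \<in> A" for f by (rule sq[OF that])
    show "sqn (gauss \<alpha> \<mu>) f \<le> (K * B) * sqn N f" if f: "f \<in> A" for f
      by (rule sq_intI_nn(2)[OF fm nn p]) (rule f)+
    fix e :: real assume e: "e > 0"
    define e' where "e' = e / K"
    have e': "e' > 0" "K * e' = e" using e K(1) by (auto simp: e'_def)
    obtain R where R: "R \<ge> 0" "\<And>z. cmod z \<ge> R \<Longrightarrow> emeasure \<mu> (ball z r) \<le> ennreal (e' * V z)"
      using avgf_eventually[OF lim r(1) less_imp_le[OF r(2)] e'(1)] by blast
    \<comment> \<open>Cutting at \<open>R + 1\<close> rather than \<open>R\<close> leaves nothing in
      the discs of radius \<open>r < 1\<close> centred inside \<open>R\<close>, so the small bound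
      \<open>e'\<close> holds at all centres.\<close>
    define T where "T = - cball (0::complex) (R + 1)"
    have T[measurable]: "T \<in> sets \<mu>" "T \<in> sets borel" using sets by (auto simp: T_def)
    define \<tau> where "\<tau> = density \<mu> (indicator T)"
    have sets_\<tau>: "sets \<tau> = sets borel" using sets by (simp add: \<tau>_def)
    have em: "emeasure \<tau> S = emeasure \<mu> (T \<inter> S)" if "S \<in> sets borel" for S
      unfolding \<tau>_def using that sets T by (subst emeasure_density) (auto simp: indicator_inter_arith[symmetric])
    have "(\<integral>\<^sup>+x\<in>-cball 0 (R + 1). ennreal ((cmod (f x))\<^sup>2) \<partial>gauss \<alpha> \<mu>) \<le> ennreal (e * sqn N f)"
      if f: "f \<in> A" for f
    proof -
      have "(\<integral>\<^sup>+x\<in>T. ennreal ((cmod (f x))\<^sup>2) \<partial>gauss \<alpha> \<mu>) = (\<integral>\<^sup>+x\<in>T. ennreal (E f x) \<partial>\<mu>)"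
        by (rule nn_integral_E[OF sets A_hol[OF f] T(2)])
      also have "\<dots> = (\<integral>\<^sup>+x. ennreal (E f x) \<partial>\<tau>)"
      proof -
        have "(\<lambda>x. ennreal (E f x)) \<in> borel_measurable \<mu>"
          using E_meas[OF A_hol[OF f]] sets by (simp cong: measurable_cong_sets)
        then show ?thesis unfolding \<tau>_def
          by (subst nn_integral_density) (auto simp: mult.commute)
      qed
      also have "\<dots> \<le> ennreal (K * e' * sqn N f)"
      proof (rule K(2)[OF sets_\<tau> _ _ _ f])
        show "emeasure \<tau> (cball 0 R') < \<infinity>" for R'
        proof -
          have "emeasure \<tau> (cball 0 R') \<le> emeasure \<mu> (cball 0 R')"
            using sets by (simp add: em emeasure_mono)
          then show ?thesis using fin_\<mu>[of R'] le_less_trans by blast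
        qed
        show "emeasure \<tau> (ball u r) \<le> ennreal (e' * V u)" for u
        proof (cases "cmod u \<ge> R")
          case True
          have "emeasure \<tau> (ball u r) \<le> emeasure \<mu> (ball u r)"
            using sets by (simp add: em emeasure_mono)
          then show ?thesis using R(2)[OF True] order_trans by blast
        next
          case False
          have "x \<notin> T" if "x \<in> ball u r" for x
            using that False r norm_triangle_sub[of x u] by (simp add: T_def dist_norm norm_minus_commute)
          then have "T \<inter> ball u r = {}" by auto
          then show ?thesis by (simp add: em)
        qed
      qed (use e' in simp)
      finally show ?thesis using e'(2) by (simp add: T_def)
    qed
    then show "\<exists>R. \<forall>f\<in>A. (\<integral>\<^sup>+x\<in>-cball 0 R. ennreal ((cmod (f x))\<^sup>2) \<partial>gauss \<alpha> \<mu>) \<le> ennreal (e * sqn N f)"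
      by blast
  qed
qed

lemma ber_tendsto_0_if_compact:
  assumes "compact_op (toep (gauss \<alpha> \<mu>))"
    and "\<And>f z. f \<in> A \<Longrightarrow> integrable (gauss \<alpha> \<mu>) (\<lambda>\<xi>. f \<xi> * cnj (kernel z \<xi>))"
  shows "(ber (gauss \<alpha> \<mu>) \<longlongrightarrow> 0) at_infinity"
  using assms by (intro ber_tendsto_0 kernel_pos kernel_vanish) auto

end


section \<open>Restricted Muckenhoupt weights\<close>

lemma weight_measurable:
  assumes "weight w"
  shows "w \<in> borel_measurable lebesgue"
proof (rule borel_measurable_LIMSEQ_real)
  fix n :: nat
  have "w absolutely_integrable_on cball 0 (real n)" using assms by (simp add: weight_def)
  then show "(\<lambda>z. indicator (cball 0 (real n)) z *\<^sub>R w z) \<in> borel_measurable lebesgue"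
    unfolding set_integrable_def by (rule borel_measurable_integrable)
next
  fix z :: complex
  have "eventually (\<lambda>n. cmod z \<le> real n) sequentially"
    using filterlim_real_sequentially eventually_compose_filterlim eventually_ge_at_top by blast
  then have "eventually (\<lambda>n. indicator (cball 0 (real n)) z *\<^sub>R w z = w z) sequentially"
    by eventually_elim simp
  then show "(\<lambda>n. indicator (cball 0 (real n)) z *\<^sub>R w z) \<longlonglongrightarrow> w z"
    by (rule tendsto_eventually)
qed

text \<open>\<open>w\<close> is only Lebesgue measurable; pushing forward along the identity
  restricts its measure to the Borel sets, as \<open>doubling_measure\<close> demands.\<close>

definition weight_measure :: "(complex \<Rightarrow> real) \<Rightarrow> complex measure" where
  "weight_measure w = distr (density lebesgue (\<lambda>z. ennreal (w z))) borel (\<lambda>z. z)"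

lemma sets_weight_measure [simp]: "sets (weight_measure w) = sets borel"
  by (simp add: weight_measure_def)

lemma id_measurable_density: "(\<lambda>z. z) \<in> measurable (density lebesgue f) (borel :: complex measure)"
  by (simp add: measurable_completion)

lemma emeasure_weight_measure:
  assumes "weight w" "S \<in> sets borel"
  shows "emeasure (weight_measure w) S = wmass w S"
proof -
  have "S \<in> sets lebesgue" using assms by (simp add: sets_completionI_sets)
  then show ?thesis
    unfolding weight_measure_def wmass_def using assms weight_measurable[OF assms(1)]
    by (subst emeasure_distr[OF id_measurable_density]) (auto simp: emeasure_density)
qed

lemma weight_measure_finite:
  assumes "weight w"
  shows "emeasure (weight_measure w) (cball 0 R) < \<infinity>"
proof -
  have "integrable lebesgue (\<lambda>z. indicator (cball 0 R) z *\<^sub>R w z)"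
    using assms by (simp add: weight_def set_integrable_def)
  then have "(\<integral>\<^sup>+z. ennreal (indicator (cball 0 R) z *\<^sub>R w z) \<partial>lebesgue) < \<infinity>"
    using assms by (subst nn_integral_eq_integral) (auto simp: weight_def)
  also have "(\<integral>\<^sup>+z. ennreal (indicator (cball 0 R) z *\<^sub>R w z) \<partial>lebesgue) = wmass w (cball 0 R)"
    unfolding wmass_def by (intro nn_integral_cong) (auto split: split_indicator)
  finally show ?thesis by (simp add: emeasure_weight_measure[OF assms])
qed

section \<open>Squares, and mass comparison from the Muckenhoupt condition\<close>

lemma ball_subset_square:
  assumes "cmod (x - (a + Complex (r/2) (r/2))) + s \<le> r / 2"
  shows "ball x s \<subseteq> square a r"
proof
  fix y assume "y \<in> ball x s"
  then have "cmod (y - (a + Complex (r/2) (r/2))) \<le> r / 2"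
  proof -
    have "y - (a + Complex (r/2) (r/2)) = (y - x) + (x - (a + Complex (r/2) (r/2)))" by simp
    then have "cmod (y - (a + Complex (r/2) (r/2))) \<le> cmod (y - x) + cmod (x - (a + Complex (r/2) (r/2)))"
      using norm_triangle_ineq by metis
    moreover have "cmod (y - x) < s" using \<open>y \<in> ball x s\<close> by (simp add: dist_norm norm_minus_commute)
    ultimately show ?thesis using assms by linarith
  qed
  then show "y \<in> square a r"
    using abs_Re_le_cmod[of "y - (a + Complex (r/2) (r/2))"] abs_Im_le_cmod[of "y - (a + Complex (r/2) (r/2))"]
    by (simp add: square_def in_cbox_complex_iff abs_le_iff)
qed

lemma square_lebesgue: "square a r \<in> sets lebesgue" "square a r \<in> sets borel"
  by (simp_all add: square_def)

lemma bounded_square: "bounded (square a r)"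
  by (simp add: square_def bounded_cbox)

lemma emeasure_square_pos:
  assumes "r > 0"
  obtains q where "q > 0" "\<And>a. emeasure lebesgue (square a r) = ennreal q"
proof -
  define q where "q = measure lborel (square 0 r)"
  have sq: "square a r = (\<lambda>x. a + x) ` square 0 r" for a
    unfolding square_def by (simp add: cbox_translation[symmetric])
  have e: "emeasure lebesgue (square a r) = ennreal (measure lebesgue (square a r))" for a
    by (rule emeasure_eq_measure2) (simp add: square_def)
  have "measure lebesgue (square a r) = measure lebesgue (square 0 r)" for a
    unfolding sq[of a] by (rule measure_translation)
  moreover have "measure lebesgue (square 0 r) > 0"
  proof -
    have "ball (Complex (r/2) (r/2)) (r/2) \<subseteq> square 0 r"
      by (rule ball_subset_square) simp
    then have "measure lebesgue (ball (Complex (r/2) (r/2)) (r/2)) \<le> measure lebesgue (square 0 r)"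
      by (intro measure_mono_fmeasurable) (auto simp: square_def)
    moreover have "measure lebesgue (ball (Complex (r/2) (r/2)) (r/2)) > 0"
      using assms by (simp add: content_ball_pos)
    ultimately show ?thesis by linarith
  qed
  ultimately show ?thesis using that[of "measure lebesgue (square 0 r)"] e by metis
qed

lemma measure_disc:
  assumes "s > 0"
  shows "measure lebesgue (ball (x :: complex) s) = pi * s\<^sup>2"
  using assms by (simp add: content_ball unit_ball_vol_2)

lemma avg_finite_cases:
  assumes q: "q > 0" "emeasure lebesgue Q = ennreal q" and t: "t > 0" and M: "M \<ge> 0"
    and le: "avg Q (\<lambda>z. ennreal (w z)) * ennreal t \<le> ennreal M"
  shows "wmass w Q \<le> ennreal (q * M / t)"
proof -
  define W where "W = wmass w Q"
  have "W * ennreal (t / q) \<le> ennreal M"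
  proof -
    have 1: "ennreal (t / q) = ennreal (inverse q) * ennreal t"
      using q t by (subst ennreal_mult[symmetric]) (auto simp: divide_inverse mult.commute)
    have "W * ennreal (t / q) = avg Q (\<lambda>z. ennreal (w z)) * ennreal t"
      unfolding 1 avg_def W_def wmass_def q(2) divide_ennreal_def
      using q(1) by (simp add: inverse_ennreal mult.assoc)
    then show ?thesis using le by simp
  qed
  then have "W * ennreal (t / q) * ennreal (q / t) \<le> ennreal M * ennreal (q / t)"
    by (rule mult_right_mono) simp
  also have "W * ennreal (t / q) * ennreal (q / t) = W"
    unfolding mult.assoc using q t by (subst ennreal_mult[symmetric]) auto
  also have "ennreal M * ennreal (q / t) = ennreal (q * M / t)"
    using q t M by (subst ennreal_mult[symmetric]) (auto simp: mult.commute)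
  finally show ?thesis by (simp add: W_def)
qed

lemma SUP_finite_bound:
  fixes F :: "'b \<Rightarrow> ennreal"
  assumes "(SUP a. F a) < \<infinity>"
  shows "\<exists>M\<ge>0. \<forall>a. F a \<le> ennreal M"
proof -
  obtain M where "(SUP a. F a) = ennreal M" "M \<ge> 0" using assms by (cases "SUP a. F a") auto
  then show ?thesis using SUP_upper[OF UNIV_I, of F] by (intro exI[of _ M]) simp
qed

text \<open>The classical comparison of \<open>(area E / area Q) powr P\<close> with
  \<open>w(E) / w(Q)\<close>, multiplied out so that nothing is divided by 0; the common area of the
  squares is absorbed in \<open>c\<close>.\<close>

definition mass_share :: "(complex \<Rightarrow> real) \<Rightarrow> real \<Rightarrow> real \<Rightarrow> real \<Rightarrow> bool" where
  "mass_share w r P c \<longleftrightarrow> (\<forall>a E. E \<in> sets lebesgue \<longrightarrow> E \<subseteq> square a r \<longrightarrow>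
     wmass w (square a r) * ennreal (measure lebesgue E powr P) \<le> ennreal c * wmass w E)"

text \<open>Almost everywhere on the square 1 is at most \<open>e * w\<close>, with \<open>e\<close>
  the essential supremum of the reciprocal; integrate over \<open>E\<close> and bound
  \<open>W * e\<close> by the condition.\<close>

lemma mass_share_A1:
  assumes "w \<in> A1_restricted"
  obtains r c where "r > 0" "c \<ge> 0" "mass_share w r 1 c"
proof -
  obtain r where r: "r > 0" and sup: "(SUP a. avg (square a r) (\<lambda>z. ennreal (w z)) *
      esssup (restrict_space lebesgue (square a r)) (\<lambda>z. inverse (ennreal (w z)))) < \<infinity>"
    and w: "weight w"
    using assms unfolding A1_restricted_def mem_Collect_eq by blast
  define F where "F a = avg (square a r) (\<lambda>z. ennreal (w z)) *
      esssup (restrict_space lebesgue (square a r)) (\<lambda>z. inverse (ennreal (w z)))" for a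
  have "(SUP a. F a) < \<infinity>" unfolding F_def by (rule sup)
  then obtain M where M0: "M \<ge> 0" and "\<forall>a. F a \<le> ennreal M"
    using SUP_finite_bound[of F] by blast
  note M = this(2)[unfolded F_def, rule_format]
  obtain q where q: "q > 0" "\<And>a. emeasure lebesgue (square a r) = ennreal q"
    using emeasure_square_pos[OF r] by blast
  have wm[measurable]: "w \<in> borel_measurable lebesgue" by (rule weight_measurable[OF w])
  have "wmass w (square a r) * ennreal (measure lebesgue E powr 1) \<le> ennreal (q * M) * wmass w E"
    if E: "E \<in> sets lebesgue" "E \<subseteq> square a r" for a E
  proof -
    have [measurable]: "E \<in> sets lebesgue" by (rule E(1))
    define e where "e = esssup (restrict_space lebesgue (square a r)) (\<lambda>z. inverse (ennreal (w z)))"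
    define W where "W = wmass w (square a r)"
    have "E \<in> lmeasurable"
      by (rule bounded_set_imp_lmeasurable[OF bounded_subset[OF bounded_square E(2)] E(1)])
    then have em: "emeasure lebesgue E = ennreal (measure lebesgue E)" by (rule emeasure_eq_measure2)
    have "AE z in restrict_space lebesgue (square a r). inverse (ennreal (w z)) \<le> e"
      unfolding e_def by (rule esssup_AE)
    then have ae: "AE z in lebesgue. z \<in> square a r \<longrightarrow> inverse (ennreal (w z)) \<le> e"
      using square_lebesgue by (subst (asm) AE_restrict_space_iff) auto
    show ?thesis
    proof (cases "e = \<infinity>")
      \<comment> \<open>An infinite essential supremum is compatible with a finite product only
        through \<open>0 * \<infinity> = 0\<close>, that is, on squares without mass.\<close>
      case True
      have "avg (square a r) (\<lambda>z. ennreal (w z)) = 0"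
      proof (rule ccontr)
        assume "avg (square a r) (\<lambda>z. ennreal (w z)) \<noteq> 0"
        then have "avg (square a r) (\<lambda>z. ennreal (w z)) * e = \<infinity>"
          using True by (simp add: ennreal_mult_top)
        then show False using M[of a] unfolding e_def[symmetric] by (simp add: top_unique)
      qed
      then have "W = 0"
        unfolding avg_def W_def wmass_def q by (simp add: divide_ennreal_def)
      then show ?thesis by (simp add: W_def)
    next
      case False
      then obtain t where t: "e = ennreal t" "t \<ge> 0" by (cases e) auto
      have We: "W * e \<le> ennreal (q * M)"
      proof (cases "t = 0")
        case True
        then show ?thesis using t by simp
      next
        case False
        then have t0: "t > 0" using t by simp
        have "W \<le> ennreal (q * M / t)"
          unfolding W_def
        proof (rule avg_finite_cases[OF q t0 M0])
          show "avg (square a r) (\<lambda>z. ennreal (w z)) * ennreal t \<le> ennreal M"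
            unfolding t(1)[symmetric] e_def by (rule M)
        qed
        then have "W * e \<le> ennreal (q * M / t) * ennreal t" unfolding t(1) by (rule mult_right_mono) simp
        also have "\<dots> = ennreal (q * M)" using t0 q M0 by (subst ennreal_mult[symmetric]) auto
        finally show ?thesis .
      qed
      have "ennreal (measure lebesgue E) = (\<integral>\<^sup>+z. indicator E z \<partial>lebesgue)"
        using E em by simp
      also have "\<dots> \<le> (\<integral>\<^sup>+z. e * (ennreal (w z) * indicator E z) \<partial>lebesgue)"
      proof (rule nn_integral_mono_AE, use ae in eventually_elim)
        fix z assume z: "z \<in> square a r \<longrightarrow> inverse (ennreal (w z)) \<le> e"
        have "1 \<le> e * ennreal (w z)" if "z \<in> E"
        proof -
          have i: "inverse (ennreal (w z)) \<le> e" using z that E by blast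
          then have "w z > 0" using False by (cases "w z > 0") (auto simp: ennreal_neg not_less top_unique)
          then have "inverse (ennreal (w z)) * ennreal (w z) = 1"
            by (simp add: inverse_ennreal ennreal_mult[symmetric])
          then show ?thesis using mult_right_mono[OF i, of "ennreal (w z)"] by simp
        qed
        then show "indicator E z \<le> e * (ennreal (w z) * indicator E z)"
          by (auto split: split_indicator)
      qed
      also have "\<dots> = e * wmass w E" unfolding wmass_def by (intro nn_integral_cmult) measurable
      finally have "W * ennreal (measure lebesgue E) \<le> W * (e * wmass w E)" by (rule mult_left_mono) simp
      also have "\<dots> \<le> ennreal (q * M) * wmass w E"
        unfolding mult.assoc[symmetric] by (intro mult_right_mono We) simp
      finally show ?thesis by (simp add: W_def)
    qed
  qed
  then have "mass_share w r 1 (q * M)" unfolding mass_share_def by blast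
  then show ?thesis by (rule that[OF r mult_nonneg_nonneg[OF less_imp_le[OF q(1)] M0]])
qed

lemma epowr_measurable: "(\<lambda>x. epowr x a) \<in> borel_measurable borel"
  unfolding epowr_def by measurable

text \<open>\<open>g\<close> is the dual weight, the power \<open>- 1 / (p - 1)\<close> of
  \<open>w\<close>. The condition bounds \<open>W * (s / q) powr (p - 1)\<close>, with
  \<open>s\<close> the integral of \<open>g\<close> over the square; what has to be added is a lower
  bound for \<open>w(E)\<close> in terms of \<open>s\<close> and the area \<open>e\<close> of
  \<open>E\<close>.\<close>

lemma mass_share_Ap:
  assumes p: "p > 1" and "w \<in> Ap_restricted p"
  obtains r c where "r > 0" "c \<ge> 0" "mass_share w r p c"
proof -
  define k where "k = conj_exponent p / p"
  have k: "k = 1 / (p - 1)" "p / conj_exponent p = p - 1" "k > 0"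
    using p by (auto simp: k_def conj_exponent_def field_simps)
  define g where "g z = epowr (inverse (ennreal (w z))) k" for z
  obtain r where r: "r > 0" and sup: "(SUP a. avg (square a r) (\<lambda>z. ennreal (w z)) *
      epowr (avg (square a r) g) (p - 1)) < \<infinity>" and w: "weight w"
    using assms(2) unfolding Ap_restricted_def mem_Collect_eq k(2) k_def[symmetric] g_def[symmetric] by blast
  define F where "F a = avg (square a r) (\<lambda>z. ennreal (w z)) *
      epowr (avg (square a r) g) (p - 1)" for a
  have "(SUP a. F a) < \<infinity>" unfolding F_def by (rule sup)
  then obtain M where M0: "M \<ge> 0" and "\<forall>a. F a \<le> ennreal M"
    using SUP_finite_bound[of F] by blast
  note M = this(2)[unfolded F_def, rule_format]
  obtain q where q: "q > 0" "\<And>a. emeasure lebesgue (square a r) = ennreal q"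
    using emeasure_square_pos[OF r] by blast
  have wm[measurable]: "w \<in> borel_measurable lebesgue" by (rule weight_measurable[OF w])
  have gm[measurable]: "g \<in> borel_measurable lebesgue"
    unfolding g_def by (rule measurable_compose[OF _ epowr_measurable]) measurable
  define c where "c = 2 * (2 * q) powr (p - 1) * (q * M)"
  have "wmass w (square a r) * ennreal (measure lebesgue E powr p) \<le> ennreal c * wmass w E"
    if E: "E \<in> sets lebesgue" "E \<subseteq> square a r" for a E
  proof -
    define e where "e = measure lebesgue E"
    define W where "W = wmass w (square a r)"
    define S where "S = (\<integral>\<^sup>+z\<in>square a r. g z \<partial>lebesgue)"
    have [measurable]: "E \<in> sets lebesgue" "square a r \<in> sets lebesgue" using E square_lebesgue by auto
    have "E \<in> lmeasurable"
      by (rule bounded_set_imp_lmeasurable[OF bounded_subset[OF bounded_square E(2)] E(1)])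
    then have em: "emeasure lebesgue E = ennreal e" unfolding e_def by (rule emeasure_eq_measure2)
    have avgS: "avg (square a r) g = S / ennreal q" by (simp add: avg_def S_def q)
    show ?thesis
    proof (cases "W = 0 \<or> e = 0")
      case True
      then show ?thesis using p by (auto simp: W_def e_def)
    next
      case False
      then have e: "e > 0" by (simp add: e_def less_le)
      have Savg: "avg (square a r) (\<lambda>z. ennreal (w z)) \<noteq> 0"
        using False unfolding avg_def W_def wmass_def q by (simp add: divide_ennreal_def)
      have "S \<noteq> \<infinity>"
      proof
        assume "S = \<infinity>"
        then have "epowr (avg (square a r) g) (p - 1) = \<infinity>"
          unfolding avgS by (simp add: epowr_def ennreal_top_divide)
        then show False using M[of a] Savg by (simp add: ennreal_mult_top top_unique)
      qed
      then obtain s where s: "S = ennreal s" "s \<ge> 0" by (cases S) auto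
      \<comment> \<open>\<open>w\<close> takes finite values, so \<open>g\<close> vanishes nowhere,
        and \<open>s = 0\<close> would make the square a null set.\<close>
      have spos: "s > 0"
      proof (rule ccontr)
        assume "\<not> s > 0"
        then have "S = 0" using s by simp
        then have ae: "AE z in lebesgue. g z * indicator (square a r) z = 0"
          unfolding S_def by (subst (asm) nn_integral_0_iff_AE) auto
        have gn: "g z \<noteq> 0" for z
        proof (cases "w z > 0")
          case True
          then show ?thesis by (simp add: g_def epowr_def inverse_ennreal)
        next
          case False
          then show ?thesis by (simp add: g_def epowr_def ennreal_neg)
        qed
        have "AE z in lebesgue. z \<notin> square a r"
          using ae by eventually_elim (use gn in \<open>auto simp: indicator_def split: if_splits\<close>)
        then have "square a r \<in> null_sets lebesgue"
          by (subst AE_iff_null_sets) (simp_all add: square_lebesgue)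
        then show False using q by auto
      qed
      define lam where "lam = (2 * s / e) powr (p - 1)"
      have lam: "lam > 0" "lam powr (- k) = e / (2 * s)"
      proof -
        show "lam > 0" using spos e by (simp add: lam_def)
        have "lam powr (- k) = (2 * s / e) powr (- 1)" using p by (simp add: lam_def powr_powr k)
        also have "\<dots> = e / (2 * s)" using spos e by (simp add: powr_minus_divide)
        finally show "lam powr (- k) = e / (2 * s)" .
      qed
      \<comment> \<open>One of the two terms is at least \<open>1\<close>; integrating this over \<open>E\<close> replaces Hoelder's
        inequality, and \<open>lam\<close> makes the second integral equal to half of the area of \<open>E\<close>.\<close>
      have pw: "1 \<le> ennreal lam * ennreal (w z) + ennreal (e / (2 * s)) * g z" for z
      proof (cases "w z > 0")
        case False
        \<comment> \<open>\<open>epowr\<close> keeps the reciprocal of 0 infinite, so zeros of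
          \<open>w\<close> satisfy the inequality through \<open>g\<close>.\<close>
        then have "g z = \<infinity>" by (simp add: g_def epowr_def ennreal_neg)
        then show ?thesis using e spos by (simp add: ennreal_mult_top)
      next
        case True
        have gz: "g z = ennreal ((1 / w z) powr k)" using True by (simp add: g_def epowr_def inverse_ennreal inverse_eq_divide)
        have "1 \<le> lam * w z + (e / (2 * s)) * (1 / w z) powr k"
        proof (cases "lam * w z \<ge> 1")
          case True
          then show ?thesis using e spos by (simp add: add_increasing2)
        next
          case F2: False
          have "(e / (2 * s)) * (1 / w z) powr k = (1 / (lam * w z)) powr k"
            unfolding lam(2)[symmetric] using lam(1) True
            by (simp add: powr_minus_divide powr_mult powr_divide)
          also have "\<dots> \<ge> 1" using F2 lam(1) True k(3) by (intro ge_one_powr_ge_zero) auto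
          finally show ?thesis using lam(1) True by (simp add: add_increasing)
        qed
        then have "ennreal 1 \<le> ennreal (lam * w z + (e / (2 * s)) * (1 / w z) powr k)"
          by (rule ennreal_leI)
        then show ?thesis using lam(1) True e spos
          by (simp add: gz ennreal_mult ennreal_plus del: times_divide_eq_left)
      qed
      have "ennreal e = (\<integral>\<^sup>+z. indicator E z \<partial>lebesgue)" using em by simp
      also have "\<dots> \<le> (\<integral>\<^sup>+z. ennreal lam * (ennreal (w z) * indicator E z)
          + ennreal (e / (2 * s)) * (g z * indicator (square a r) z) \<partial>lebesgue)"
        using pw E by (intro nn_integral_mono) (auto split: split_indicator)
      also have "\<dots> = ennreal lam * wmass w E + ennreal (e / (2 * s)) * S"
        unfolding wmass_def S_def by (subst nn_integral_add) (auto simp: nn_integral_cmult)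
      also have "ennreal (e / (2 * s)) * S = ennreal (e / 2)"
        using s e spos by (simp add: ennreal_mult[symmetric])
      finally have "ennreal e \<le> ennreal lam * wmass w E + ennreal (e / 2)" .
      then have half: "ennreal (e / 2) \<le> ennreal lam * wmass w E"
        using e by (cases "ennreal lam * wmass w E")
          (auto simp: ennreal_plus[symmetric] simp del: ennreal_plus)
      have W: "W \<le> ennreal (q * M / (s / q) powr (p - 1))"
        unfolding W_def
      proof (rule avg_finite_cases[OF q])
        have "avg (square a r) g = ennreal (s / q)"
          unfolding avgS s(1) using q s by (simp add: divide_ennreal)
        then have "epowr (avg (square a r) g) (p - 1) = ennreal ((s / q) powr (p - 1))"
          using q spos by (simp add: epowr_def)
        then show "avg (square a r) (\<lambda>z. ennreal (w z)) * ennreal ((s / q) powr (p - 1)) \<le> ennreal M"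
          using M[of a] by simp
      qed (use q spos M0 in auto)
      have "W * ennreal (e powr p) \<le> ennreal (q * M / (s / q) powr (p - 1)) * ennreal (e powr p)"
        by (intro mult_right_mono W) simp
      also have "\<dots> = ennreal (q * M / (s / q) powr (p - 1) * 2 * e powr (p - 1)) * ennreal (e / 2)"
      proof -
        have "e powr p = e powr (p - 1) * e" using e powr_add[of e "p - 1" 1] by simp
        then show ?thesis using q M0 e by (simp add: ennreal_mult[symmetric] mult_ac)
      qed
      also have "\<dots> \<le> ennreal (q * M / (s / q) powr (p - 1) * 2 * e powr (p - 1)) * (ennreal lam * wmass w E)"
        by (intro mult_left_mono half) simp
      also have "\<dots> = ennreal (q * M / (s / q) powr (p - 1) * 2 * e powr (p - 1) * lam) * wmass w E"
        unfolding mult.assoc[symmetric] using q M0 lam(1) by (subst ennreal_mult[symmetric]) auto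
      \<comment> \<open>The powers of \<open>s\<close> and \<open>e\<close> cancel against
        \<open>lam\<close>, which makes \<open>c\<close> independent of the square and of
        \<open>E\<close>.\<close>
      also have "q * M / (s / q) powr (p - 1) * 2 * e powr (p - 1) * lam = c"
        using spos q e by (simp add: c_def lam_def powr_mult powr_divide)
      finally show ?thesis by (simp add: W_def e_def)
    qed
  qed
  then have "mass_share w r p c" unfolding mass_share_def by blast
  moreover have "c \<ge> 0" using q M0 by (simp add: c_def)
  ultimately show ?thesis using that r by blast
qed


section \<open>From squares to discs: the doubling estimate for restricted weights\<close>

lemma weight_measure_fmeasurable:
  assumes "weight w" "S \<in> sets borel" "bounded S"
  shows "S \<in> fmeasurable (weight_measure w)"
proof (rule fmeasurableI)
  obtain R where "\<forall>x\<in>S. cmod x \<le> R" using assms(3) unfolding bounded_iff by blast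
  then have "S \<subseteq> cball 0 R" by auto
  then have "emeasure (weight_measure w) S \<le> emeasure (weight_measure w) (cball 0 R)"
    by (intro emeasure_mono) auto
  then show "emeasure (weight_measure w) S < \<infinity>"
    using weight_measure_finite[OF assms(1), of R] by (rule le_less_trans)
qed (use assms in simp)

lemma weight_if_Ainf: "w \<in> Ainf_restricted \<Longrightarrow> weight w"
  unfolding Ainf_restricted_def A1_restricted_def Ap_restricted_def by blast

text \<open>A disc of radius \<open>s\<close> has area at least \<open>s\<^sup>2\<close>, so its
  area to the power \<open>P\<close> is at least \<open>s powr (2 * P)\<close>; rounding the
  exponent up only decreases this for \<open>s \<le> 1\<close>.\<close>

lemma Ainf_ball_share:
  assumes "w \<in> Ainf_restricted"
  obtains r c :: real and n :: nat where "r > 0" "c > 0" "n > 0"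
    "\<And>a x s. 0 < s \<Longrightarrow> s \<le> 1 \<Longrightarrow> ball x s \<subseteq> square a r \<Longrightarrow>
      measure (weight_measure w) (square a r) * s ^ n \<le> c * measure (weight_measure w) (ball x s)"
proof -
  have w: "weight w" by (rule weight_if_Ainf[OF assms])
  have "\<exists>r P c. r > 0 \<and> P \<ge> 1 \<and> c \<ge> 0 \<and> mass_share w r P c"
  proof (cases "w \<in> A1_restricted")
    case True
    from mass_share_A1[OF this] show ?thesis by (metis order_refl)
  next
    case False
    then obtain p where p: "p > 1" "w \<in> Ap_restricted p" using assms by (auto simp: Ainf_restricted_def)
    from mass_share_Ap[OF this] p(1) show ?thesis by (metis less_imp_le)
  qed
  then obtain r P c where r: "r > 0" and P: "P \<ge> 1" and c: "c \<ge> 0" and ms: "mass_share w r P c" by blast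
  define n where "n = nat \<lceil>2 * P\<rceil>"
  have n: "real n \<ge> 2 * P" "n > 0" using P by (auto simp: n_def)
  define m where "m S = measure (weight_measure w) S" for S
  have em: "wmass w S = ennreal (m S)" if "S \<in> sets borel" "bounded S" for S
    unfolding m_def emeasure_weight_measure[OF w that(1), symmetric]
    by (rule emeasure_eq_measure2[OF weight_measure_fmeasurable[OF w that]])
  have m0: "m S \<ge> 0" for S by (simp add: m_def)
  have "m (square a r) * s ^ n \<le> (c + 1) * m (ball x s)"
    if s: "0 < s" "s \<le> 1" and sub: "ball x s \<subseteq> square a r" for a x s
  proof -
    have "s ^ n = s powr real n" using s by (simp add: powr_realpow)
    also have "\<dots> \<le> s powr (2 * P)" using s n by (intro powr_mono') auto
    also have "\<dots> = (s\<^sup>2) powr P" using s by (simp add: powr_powr[symmetric] powr_numeral)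
    also have "\<dots> \<le> (pi * s\<^sup>2) powr P"
      using P s pi_ge_two by (intro powr_mono2) auto
    finally have sn: "s ^ n \<le> measure lebesgue (ball x s) powr P" by (simp add: measure_disc[OF s(1)])
    have "ennreal (m (square a r) * s ^ n) \<le> ennreal (m (square a r)) * ennreal (measure lebesgue (ball x s) powr P)"
      using m0 sn s by (subst ennreal_mult[symmetric]) (auto intro!: ennreal_leI mult_left_mono)
    also have "\<dots> \<le> ennreal c * wmass w (ball x s)"
      unfolding em[OF square_lebesgue(2) bounded_square, symmetric]
      by (rule ms[unfolded mass_share_def, rule_format, OF _ sub]) simp
    also have "\<dots> = ennreal (c * m (ball x s))" using c m0 by (simp add: em ennreal_mult)
    finally have "m (square a r) * s ^ n \<le> c * m (ball x s)" using c m0 by (subst (asm) ennreal_le_iff) auto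
    then show ?thesis using m0[of "ball x s"] by (simp add: distrib_right)
  qed
  then show ?thesis using that[of r "c + 1" n] r c n unfolding m_def by simp
qed

text \<open>A square and its translate by at most half the side share a disc of comparable size; the
  resulting comparison is iterated along the segment from \<open>u\<close> to \<open>v\<close>.\<close>

lemma Ainf_square_growth:
  fixes \<nu> :: "complex measure"
  assumes r: "r > 0" and c: "c > 0" and sets: "sets \<nu> = sets borel"
    and fin: "\<And>S. S \<in> sets borel \<Longrightarrow> bounded S \<Longrightarrow> S \<in> fmeasurable \<nu>"
    and share: "\<And>a x s. 0 < s \<Longrightarrow> s \<le> 1 \<Longrightarrow> ball x s \<subseteq> square a r \<Longrightarrow>
      measure \<nu> (square a r) * s ^ n \<le> c * measure \<nu> (ball x s)"
  obtains C \<kappa> where "C > 0" "\<kappa> \<ge> 0"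
    "\<And>u v. measure \<nu> (square u r) \<le> C * exp (\<kappa> * dist u v) * measure \<nu> (square v r)"
proof -
  define q where "q a = measure \<nu> (square a r)" for a
  \<comment> \<open>The midpoint \<open>x\<close> is at most \<open>r / 4\<close> from both centres,
    so a disc of radius \<open>r / 8\<close> fits into both squares; \<open>share\<close> asks for
    radius at most 1.\<close>
  define s where "s = min 1 (r / 8)"
  have s: "0 < s" "s \<le> 1" "s \<le> r / 8" using r by (auto simp: s_def)
  \<comment> \<open>At least 1, so that \<open>ln B\<close>, and with it \<open>\<kappa>\<close>, is
    nonnegative.\<close>
  define B where "B = max 1 (c / s ^ n)"
  have B: "B \<ge> 1" by (simp add: B_def)
  have step: "q a \<le> B * q (a + d)" if d: "cmod d \<le> r / 2" for a d
  proof -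
    define x where "x = a + d / 2 + Complex (r/2) (r/2)"
    have "ball x s \<subseteq> square a r"
      using d s by (intro ball_subset_square) (simp add: x_def norm_divide)
    moreover have "ball x s \<subseteq> square (a + d) r"
    proof (rule ball_subset_square)
      have "x - (a + d + Complex (r/2) (r/2)) = - (d / 2)" by (simp add: x_def field_simps)
      then show "cmod (x - (a + d + Complex (r/2) (r/2))) + s \<le> r / 2"
        using d s by (simp add: norm_divide)
    qed
    ultimately have "q a * s ^ n \<le> c * q (a + d)"
    proof -
      assume sub: "ball x s \<subseteq> square a r" "ball x s \<subseteq> square (a + d) r"
      have "q a * s ^ n \<le> c * measure \<nu> (ball x s)"
        unfolding q_def by (intro share s sub)
      also have "\<dots> \<le> c * q (a + d)"
        unfolding q_def using c sets
        by (intro mult_left_mono measure_mono_fmeasurable sub fin square_lebesgue bounded_square) auto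
      finally show ?thesis .
    qed
    then have "q a \<le> (c / s ^ n) * q (a + d)" using s by (simp add: field_simps)
    also have "\<dots> \<le> B * q (a + d)" by (intro mult_right_mono) (auto simp: B_def q_def)
    finally show ?thesis .
  qed
  have chain: "q a \<le> B ^ k * q (a + of_nat k * d)" if d: "cmod d \<le> r / 2" for a d k
  proof (induction k)
    case (Suc k)
    have "q (a + of_nat k * d) \<le> B * q (a + of_nat k * d + d)" by (rule step[OF d])
    then have "B ^ k * q (a + of_nat k * d) \<le> B ^ k * (B * q (a + of_nat k * d + d))"
      using B by (intro mult_left_mono) auto
    with Suc show ?case by (simp add: algebra_simps)
  qed simp
  \<comment> \<open>Steps of length at most \<open>r / 2\<close> cost \<open>B\<close> each; at most
    \<open>2 * dist u v / r + 1\<close> of them are used, and the rounding is paid by one extra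
    \<open>B\<close>.\<close>
  define \<kappa> where "\<kappa> = 2 * ln B / r"
  have \<kappa>: "\<kappa> \<ge> 0" using B r by (simp add: \<kappa>_def)
  have "q u \<le> B * exp (\<kappa> * dist u v) * q v" for u v
  proof (cases "u = v")
    case True
    have "1 * q v \<le> B * q v" using B by (intro mult_right_mono) (auto simp: q_def)
    then show ?thesis using True by simp
  next
    case False
    define k where "k = nat \<lceil>2 * dist u v / r\<rceil>"
    have D: "2 * dist u v / r > 0" using False r by simp
    then have k: "real k \<ge> 2 * dist u v / r" "real k \<le> 2 * dist u v / r + 1" "k > 0"
      by (auto simp: k_def of_nat_nat)
    define d where "d = (v - u) / of_nat k"
    have "cmod d = dist u v / real k" by (simp add: d_def norm_divide dist_norm norm_minus_commute)
    also have "\<dots> \<le> r / 2" using k r by (simp add: field_simps)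
    finally have "q u \<le> B ^ k * q (u + of_nat k * d)" by (rule chain)
    also have "u + of_nat k * d = v" using k by (simp add: d_def)
    also have "B ^ k = exp (real k * ln B)" using B by (simp add: exp_of_nat_mult)
    also have "exp (real k * ln B) * q v \<le> exp ((2 * dist u v / r + 1) * ln B) * q v"
      using B k by (intro mult_right_mono) (auto simp: q_def intro!: mult_right_mono)
    also have "(2 * dist u v / r + 1) * ln B = ln B + \<kappa> * dist u v"
      by (simp add: \<kappa>_def distrib_right)
    also have "exp (ln B + \<kappa> * dist u v) = B * exp (\<kappa> * dist u v)" using B by (simp add: exp_add)
    finally show ?thesis .
  qed
  then show ?thesis using that[of B \<kappa>] B \<kappa> unfolding q_def by simp
qed

text \<open>The unit disc about \<open>z\<close> is covered by squares, \<open>growth\<close>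
  compares each with the square centred at \<open>\<zeta>\<close>, and \<open>disc\<close> passes
  from that square to \<open>ball \<zeta> s\<close>.\<close>

lemma Ainf_doubling_measure:
  assumes "w \<in> Ainf_restricted" and \<alpha>: "\<alpha> > 0"
  obtains C \<kappa> n where "doubling_measure \<alpha> C \<kappa> n (weight_measure w)"
proof -
  define \<nu> where "\<nu> = weight_measure w"
  have w: "weight w" by (rule weight_if_Ainf[OF assms(1)])
  obtain r c n where r: "r > 0" and c: "c > 0" and n: "n > 0" and
    share: "\<And>a x s. 0 < s \<Longrightarrow> s \<le> 1 \<Longrightarrow> ball x s \<subseteq> square a r \<Longrightarrow>
      measure \<nu> (square a r) * s ^ n \<le> c * measure \<nu> (ball x s)"
    using Ainf_ball_share[OF assms(1)] unfolding \<nu>_def by blast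
  have sets: "sets \<nu> = sets borel" by (simp add: \<nu>_def)
  have fm: "S \<in> fmeasurable \<nu>" if "S \<in> sets borel" "bounded S" for S
    unfolding \<nu>_def by (rule weight_measure_fmeasurable[OF w that])
  obtain B \<kappa> where B: "B > 0" and \<kappa>: "\<kappa> \<ge> 0"
    and growth: "\<And>u v. measure \<nu> (square u r) \<le> B * exp (\<kappa> * dist u v) * measure \<nu> (square v r)"
  proof (rule Ainf_square_growth[OF r c sets])
    show "S \<in> fmeasurable \<nu>" if "S \<in> sets borel" "bounded S" for S
      by (rule fm[OF that])
    show "measure \<nu> (square a r) * s ^ n \<le> c * measure \<nu> (ball x s)"
      if "0 < s" "s \<le> 1" "ball x s \<subseteq> square a r" for a x s
      by (rule share[OF that])
  qed (rule that)
  \<comment> \<open>\<open>square\<close> is given by its lower left corner; subtracting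
    \<open>h\<close> centres it.\<close>
  define h where "h = Complex (r/2) (r/2)"
  have centred: "ball x s \<subseteq> square (x - h) r" if "s \<le> r / 2" for x s
    using that by (intro ball_subset_square) (simp add: h_def)
  have cover: "\<exists>k. \<forall>z \<zeta>. measure \<nu> (ball z R) \<le> real k * (B * exp (\<kappa> * (dist z \<zeta> + R)) * measure \<nu> (square (\<zeta> - h) r))"
    if R: "R > 0" for R
  proof -
    have "compact (cball (0::complex) R)" by simp
    then obtain D :: "complex set" where D: "finite D" "D \<subseteq> cball 0 R" "cball 0 R \<subseteq> (\<Union>d\<in>D. ball d (r/2))"
      using compactE_image[of "cball (0::complex) R" "cball (0::complex) R" "\<lambda>d. ball d (r/2)"] r by force
    have "measure \<nu> (ball z R) \<le> real (card D) * (B * exp (\<kappa> * (dist z \<zeta> + R)) * measure \<nu> (square (\<zeta> - h) r))" for z \<zeta>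
    proof -
      have sub: "ball z R \<subseteq> (\<Union>d\<in>D. square (z + d - h) r)"
      proof
        fix y assume "y \<in> ball z R"
        then have "y - z \<in> cball 0 R" by (simp add: dist_norm norm_minus_commute)
        then obtain d where d: "d \<in> D" "y - z \<in> ball d (r/2)" using D(3) by blast
        then have "y \<in> ball (z + d) (r/2)" by (simp add: dist_norm algebra_simps)
        then show "y \<in> (\<Union>d\<in>D. square (z + d - h) r)"
          using centred[of "r/2" "z + d"] d(1) by auto
      qed
      have "measure \<nu> (ball z R) \<le> measure \<nu> (\<Union>d\<in>D. square (z + d - h) r)"
        using D(1) sets by (intro measure_mono_fmeasurable sub fmeasurable.finite_UN fm square_lebesgue bounded_square) auto
      also have "\<dots> \<le> (\<Sum>d\<in>D. measure \<nu> (square (z + d - h) r))"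
        using D(1) sets square_lebesgue by (intro measure_UNION_le) auto
      also have "\<dots> \<le> (\<Sum>d\<in>D. B * exp (\<kappa> * (dist z \<zeta> + R)) * measure \<nu> (square (\<zeta> - h) r))"
      proof (rule sum_mono)
        fix d assume "d \<in> D"
        then have dR: "cmod d \<le> R" using D(2) by auto
        have "dist (z + d - h) (\<zeta> - h) \<le> dist z \<zeta> + R"
          using norm_triangle_ineq[of "z - \<zeta>" d] dR by (simp add: dist_norm algebra_simps)
        then have "B * exp (\<kappa> * dist (z + d - h) (\<zeta> - h)) * measure \<nu> (square (\<zeta> - h) r)
            \<le> B * exp (\<kappa> * (dist z \<zeta> + R)) * measure \<nu> (square (\<zeta> - h) r)"
          using B \<kappa> by (intro mult_right_mono mult_left_mono) (auto intro: mult_left_mono)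
        then show "measure \<nu> (square (z + d - h) r) \<le> B * exp (\<kappa> * (dist z \<zeta> + R)) * measure \<nu> (square (\<zeta> - h) r)"
          using growth[of "z + d - h" "\<zeta> - h"] by linarith
      qed
      finally show ?thesis by simp
    qed
    then show ?thesis by blast
  qed
  \<comment> \<open>By \<open>cover\<close>, a single square without mass would leave every disc,
    hence the plane, without mass, so that \<open>w = 0\<close> almost everywhere;
    \<open>weight\<close> excludes this.\<close>
  have sq_pos: "measure \<nu> (square v r) > 0" for v
  proof (rule ccontr)
    assume "\<not> measure \<nu> (square v r) > 0"
    then have v0: "measure \<nu> (square v r) = 0" using measure_nonneg[of \<nu> "square v r"] by linarith
    have "emeasure \<nu> (ball 0 (real (Suc k))) = 0" for k
    proof -
      obtain N where "\<And>z \<zeta>. measure \<nu> (ball z (real (Suc k))) \<le>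
          real N * (B * exp (\<kappa> * (dist z \<zeta> + real (Suc k))) * measure \<nu> (square (\<zeta> - h) r))"
        using cover[of "real (Suc k)"] by auto
      from this[of 0 "v + h"] have "measure \<nu> (ball 0 (real (Suc k))) \<le> 0" using v0 by simp
      then have "measure \<nu> (ball 0 (real (Suc k))) = 0"
        using measure_nonneg[of \<nu> "ball 0 (real (Suc k))"] by linarith
      then show ?thesis by (subst emeasure_eq_measure2[OF fm]) auto
    qed
    then have "(\<Union>k. ball 0 (real (Suc k))) \<in> null_sets \<nu>"
      using sets by (intro null_sets_UN) (auto simp: null_sets_def)
    moreover have "(\<Union>k. ball (0::complex) (real (Suc k))) = UNIV"
    proof -
      have "\<exists>k. cmod x < real (Suc k)" for x
        using reals_Archimedean2[of "cmod x"] by (metis less_Suc_eq_le less_trans of_nat_less_iff order_refl)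
      then show ?thesis by auto
    qed
    ultimately have "emeasure \<nu> UNIV = 0" by auto
    moreover have "UNIV \<in> sets (borel :: complex measure)" by simp
    ultimately have "(\<integral>\<^sup>+z. ennreal (w z) \<partial>lebesgue) = 0"
      unfolding \<nu>_def by (simp add: emeasure_weight_measure[OF w] wmass_def)
    then have "AE z in lebesgue. w z = 0"
      using weight_measurable[OF w] w by (subst (asm) nn_integral_0_iff_AE) (auto simp: weight_def ennreal_eq_0_iff antisym_conv)
    then show False using w by (simp add: weight_def)
  qed
  \<comment> \<open>A disc of radius up to 1 need not fit into a square of side \<open>r\<close>;
    shrinking by the fixed factor \<open>s1\<close> makes it fit at the price of the constant
    \<open>s1 ^ n\<close>.\<close>
  define s1 where "s1 = min 1 (r / 2)"
  have s1: "0 < s1" "s1 \<le> 1" "s1 \<le> r / 2" using r by (auto simp: s1_def)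
  have disc: "measure \<nu> (square (\<zeta> - h) r) * (s * s1) ^ n \<le> c * measure \<nu> (ball \<zeta> s)"
    if s: "0 < s" "s \<le> 1" for \<zeta> s
  proof -
    have ss: "s * s1 \<le> s1" "s * s1 \<le> s" using s s1 by (simp_all add: mult_left_le mult_left_le_one_le)
    have "measure \<nu> (square (\<zeta> - h) r) * (s * s1) ^ n \<le> c * measure \<nu> (ball \<zeta> (s * s1))"
    proof (intro share centred)
      show "0 < s * s1" using s s1 by simp
      show "s * s1 \<le> 1" "s * s1 \<le> r / 2" using ss(1) s1 by linarith+
    qed
    also have "\<dots> \<le> c * measure \<nu> (ball \<zeta> s)"
      using c ss sets by (intro mult_left_mono measure_mono_fmeasurable fm) auto
    finally show ?thesis .
  qed
  obtain k where k: "\<And>z \<zeta>. measure \<nu> (ball z 1) \<le> real k * (B * exp (\<kappa> * (dist z \<zeta> + 1)) * measure \<nu> (square (\<zeta> - h) r))"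
    using cover[of 1] by auto
  define C where "C = (real k + 1) * B * exp \<kappa> * c / s1 ^ n"
  have "doubling_measure \<alpha> C \<kappa> n \<nu>"
  proof
    show "n > 0" "\<alpha> > 0" "\<kappa> \<ge> 0" "sets \<nu> = sets borel" by (rule n \<alpha> \<kappa> sets)+
    show "C > 0" using B c s1 by (simp add: C_def add_nonneg_pos)
    show "emeasure \<nu> (cball 0 R) < \<infinity>" for R unfolding \<nu>_def by (rule weight_measure_finite[OF w])
    show "measure \<nu> (ball z 1) > 0" for z
    proof -
      have "0 < measure \<nu> (square (z - h) r) * (1 * s1) ^ n" using sq_pos s1 by simp
      also have "\<dots> \<le> c * measure \<nu> (ball z 1)" by (rule disc) auto
      finally show ?thesis using c by (simp only: zero_less_mult_pos)
    qed
    fix z \<zeta> :: complex and s :: real assume s: "0 < s" "s \<le> 1"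
    define q where "q = measure \<nu> (square (\<zeta> - h) r)"
    have q: "q > 0" using sq_pos by (simp add: q_def)
    have "measure \<nu> (ball z 1) * s ^ n \<le> real k * (B * exp (\<kappa> * (dist z \<zeta> + 1)) * q) * s ^ n"
      unfolding q_def using s by (intro mult_right_mono k) auto
    also have "\<dots> \<le> (real k + 1) * (B * exp (\<kappa> * (dist z \<zeta> + 1)) * q) * s ^ n"
      using B q s by (intro mult_right_mono) auto
    also have "\<dots> = (real k + 1) * B * exp \<kappa> / s1 ^ n * exp (\<kappa> * dist z \<zeta>) * (q * (s * s1) ^ n)"
      using s1 by (simp add: power_mult_distrib exp_add distrib_left)
    also have "\<dots> \<le> (real k + 1) * B * exp \<kappa> / s1 ^ n * exp (\<kappa> * dist z \<zeta>) * (c * measure \<nu> (ball \<zeta> s))"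
      unfolding q_def using B s1 by (intro mult_left_mono disc s) auto
    also have "\<dots> = C * exp (\<kappa> * dist z \<zeta>) * measure \<nu> (ball \<zeta> s)" by (simp add: C_def)
    finally show "measure \<nu> (ball z 1) * s ^ n \<le> C * exp (\<kappa> * dist z \<zeta>) * measure \<nu> (ball \<zeta> s)" .
  qed
  then show ?thesis using that unfolding \<nu>_def by blast
qed


section \<open>The Fock space of a restricted weight\<close>

lemma
  fixes F :: "complex \<Rightarrow> 'b :: {banach, second_countable_topology}"
  assumes "sets \<mu> = sets borel" and F: "F \<in> borel_measurable borel"
  shows integrable_gauss: "integrable (gauss a \<mu>) F \<longleftrightarrow>
      integrable \<mu> (\<lambda>z. exp (- a * (cmod z)\<^sup>2) *\<^sub>R F z)"
    and integral_gauss: "integral\<^sup>L (gauss a \<mu>) F =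
      (LINT z|\<mu>. exp (- a * (cmod z)\<^sup>2) *\<^sub>R F z)"
proof -
  have m: "F \<in> borel_measurable \<mu>" "(\<lambda>z. exp (- a * (cmod z)\<^sup>2)) \<in> borel_measurable \<mu>"
    using assms by (simp_all cong: measurable_cong_sets)
  show "integrable (gauss a \<mu>) F \<longleftrightarrow> integrable \<mu> (\<lambda>z. exp (- a * (cmod z)\<^sup>2) *\<^sub>R F z)"
    unfolding gauss_def by (rule integrable_density[OF m]) simp
  show "integral\<^sup>L (gauss a \<mu>) F = (LINT z|\<mu>. exp (- a * (cmod z)\<^sup>2) *\<^sub>R F z)"
    unfolding gauss_def by (rule integral_density[OF m]) simp
qed

lemma
  fixes F :: "complex \<Rightarrow> 'b :: {banach, second_countable_topology}"
  assumes w: "weight w" and F: "F \<in> borel_measurable borel"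
  shows integrable_weight_measure: "integrable (weight_measure w) F \<longleftrightarrow> integrable lebesgue (\<lambda>z. w z *\<^sub>R F z)"
    and integral_weight_measure: "integral\<^sup>L (weight_measure w) F = (LINT z|lebesgue. w z *\<^sub>R F z)"
proof -
  have m: "F \<in> borel_measurable lebesgue" "w \<in> borel_measurable lebesgue"
    using F weight_measurable[OF w] by (simp_all add: measurable_completion)
  have nn: "AE z in lebesgue. 0 \<le> w z" using w by (simp add: weight_def)
  show "integrable (weight_measure w) F \<longleftrightarrow> integrable lebesgue (\<lambda>z. w z *\<^sub>R F z)"
    unfolding weight_measure_def integrable_distr_eq[OF id_measurable_density F]
    by (rule integrable_density[OF m nn])
  show "integral\<^sup>L (weight_measure w) F = (LINT z|lebesgue. w z *\<^sub>R F z)"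
    unfolding weight_measure_def integral_distr[OF id_measurable_density F]
    by (rule integral_density[OF m nn])
qed

locale weighted_fock = doubling_measure \<alpha> C \<kappa> m "weight_measure w"
  for \<alpha> C \<kappa> :: real and m :: nat and w :: "complex \<Rightarrow> real" +
  assumes weight: "weight w"
begin

lemma
  fixes F :: "complex \<Rightarrow> 'b :: {banach, second_countable_topology}"
  assumes F: "F \<in> borel_measurable borel"
  shows integrable_N: "integrable N F \<longleftrightarrow> integrable lebesgue (\<lambda>z. (exp (- \<alpha> * (cmod z)\<^sup>2) * w z) *\<^sub>R F z)"
    and integral_N: "integral\<^sup>L N F = (LINT z|lebesgue. (exp (- \<alpha> * (cmod z)\<^sup>2) * w z) *\<^sub>R F z)"
proof -
  have G: "(\<lambda>z. exp (- \<alpha> * (cmod z)\<^sup>2) *\<^sub>R F z) \<in> borel_measurable borel"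
    using F borel_gauss_weight[of \<alpha>] by (rule borel_measurable_scaleR[rotated])
  show "integrable N F \<longleftrightarrow> integrable lebesgue (\<lambda>z. (exp (- \<alpha> * (cmod z)\<^sup>2) * w z) *\<^sub>R F z)"
    unfolding N_def integrable_gauss[OF sets_\<nu> F] integrable_weight_measure[OF weight G]
    by (simp add: mult.commute)
  show "integral\<^sup>L N F = (LINT z|lebesgue. (exp (- \<alpha> * (cmod z)\<^sup>2) * w z) *\<^sub>R F z)"
    unfolding N_def integral_gauss[OF sets_\<nu> F] integral_weight_measure[OF weight G]
    by (simp add: mult.commute)
qed

lemma square_measurable:
  assumes "f holomorphic_on UNIV"
  shows "(\<lambda>z. (cmod (f z))\<^sup>2) \<in> borel_measurable borel"
  using entire_borel[OF assms] by measurable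

lemma product_measurable:
  assumes "f holomorphic_on UNIV" "g holomorphic_on UNIV"
  shows "(\<lambda>z. f z * cnj (g z)) \<in> borel_measurable borel"
  using assms holomorphic_on_imp_continuous_on
  by (intro borel_measurable_continuous_onI continuous_intros) auto

lemma fock_eq: "fock \<alpha> w = A"
  unfolding fock_def A_def
  by (intro Collect_cong conj_cong refl) (simp add: integrable_N[OF square_measurable] mult_ac)

lemma fock_norm_eq:
  assumes "f \<in> A"
  shows "fock_norm \<alpha> w f = sqrt (sqn N f)"
  unfolding fock_norm_def sqn_def integral_N[OF square_measurable[OF A_hol[OF assms]]]
  by (simp add: mult_ac)

lemma fock_dist_eq:
  assumes "f \<in> A" "g \<in> A"
  shows "fock_dist \<alpha> w f g = d f g"
  unfolding fock_dist_def d_def by (rule fock_norm_eq[OF A_diff[OF assms]])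

lemma fock_inner_eq:
  assumes "f \<in> A" "g \<in> A"
  shows "fock_inner \<alpha> w f g = ip N f g"
  unfolding fock_inner_def ip_def integral_N[OF product_measurable[OF A_hol[OF assms(1)] A_hol[OF assms(2)]]]
  by (simp add: scaleR_conv_of_real mult_ac)

lemma fock_kernel_eq: "fock_kernel \<alpha> w z = kernel z"
  unfolding fock_kernel_def kernel_def fock_eq
  by (rule arg_cong[where f = The], rule ext) (metis fock_inner_eq)

lemma fock_kernel_normalized_eq: "fock_kernel_normalized \<alpha> w z = nkernel z"
  unfolding fock_kernel_normalized_def nkernel_def fock_kernel_eq fock_norm_eq[OF kernel_A] ..

lemma nkernel_hol: "nkernel z holomorphic_on UNIV"
  using A_hol[OF kernel_A[of z]] kernel_pos[of z] unfolding nkernel_def by (intro holomorphic_intros) auto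

lemma berezin_eq:
  assumes "sets \<mu> = sets borel"
  shows "berezin \<alpha> w \<mu> = ber (gauss \<alpha> \<mu>)"
proof
  fix z
  have "ber (gauss \<alpha> \<mu>) z = (\<integral>\<^sup>+\<xi>. ennreal (E (nkernel z) \<xi>) \<partial>\<mu>)"
    unfolding ber_def using nn_integral_E[OF assms nkernel_hol, of UNIV z] by simp
  then show "berezin \<alpha> w \<mu> z = ber (gauss \<alpha> \<mu>) z"
    unfolding berezin_def fock_kernel_normalized_eq E_def by simp
qed

lemma average_function_eq: "average_function w \<mu> r = avgf \<mu> r"
  unfolding average_function_def avgf_def by (simp add: emeasure_weight_measure[OF weight])

text \<open>The two distances are identified on \<open>A\<close> only, not as functions; equality of
  the balls is enough, since \<open>mball\<close> is confined to \<open>A\<close>.\<close>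

lemma fock_topology_eq: "Metric_space.mtopology A (fock_dist \<alpha> w) = mspace.mtopology"
proof -
  interpret F: Metric_space A "fock_dist \<alpha> w"
  proof
    fix f g h
    show "0 \<le> fock_dist \<alpha> w f g"
      using weight by (simp add: fock_dist_def fock_norm_def weight_def)
    show "fock_dist \<alpha> w f g = fock_dist \<alpha> w g f"
      by (simp add: fock_dist_def fock_norm_def norm_minus_commute)
    show "fock_dist \<alpha> w f g = 0 \<longleftrightarrow> f = g" if "f \<in> A" "g \<in> A"
      using that by (simp add: fock_dist_eq)
    show "fock_dist \<alpha> w f h \<le> fock_dist \<alpha> w f g + fock_dist \<alpha> w g h" if "f \<in> A" "g \<in> A" "h \<in> A"
      using that mspace.triangle by (simp add: fock_dist_eq)
  qed
  have "F.mball f r = mspace.mball f r" for f r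
    unfolding F.mball_def mspace.mball_def by (auto simp: fock_dist_eq)
  then show ?thesis
    unfolding F.mtopology_def mspace.mtopology_def F.mopen_def mspace.mopen_def by simp
qed

text \<open>Needed since \<open>toeplitz\<close> and \<open>toep\<close> are compared only on
  \<open>A\<close>; the linearity clause transfers because \<open>A\<close> is closed under linear
  combinations.\<close>

lemma compact_operator_eq:
  assumes TS: "\<And>f. f \<in> A \<Longrightarrow> T f = S f"
  shows "compact_operator_on_fock \<alpha> w T \<longleftrightarrow> compact_op S"
proof -
  have 1: "T ` A = S ` A" using TS by (intro image_cong) auto
  have "{f \<in> A. fock_norm \<alpha> w f \<le> 1} = {f \<in> A. sqrt (sqn N f) \<le> 1}"
    by (intro Collect_cong conj_cong refl) (simp add: fock_norm_eq)
  then have 2: "T ` {f \<in> A. fock_norm \<alpha> w f \<le> 1} = S ` {f \<in> A. sqrt (sqn N f) \<le> 1}"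
    using TS by (intro image_cong) auto
  have 3: "(T (\<lambda>z. a * f z + b * g z) = (\<lambda>z. a * T f z + b * T g z)) \<longleftrightarrow>
      (S (\<lambda>z. a * f z + b * g z) = (\<lambda>z. a * S f z + b * S g z))" if "f \<in> A" "g \<in> A" for a b f g
    unfolding TS[OF that(1)] TS[OF that(2)] TS[OF A_lincomb[OF that]] ..
  have 4: "(\<forall>f\<in>A. \<forall>g\<in>A. \<forall>a b. T (\<lambda>z. a * f z + b * g z) = (\<lambda>z. a * T f z + b * T g z)) \<longleftrightarrow>
      (\<forall>f\<in>A. \<forall>g\<in>A. \<forall>a b. S (\<lambda>z. a * f z + b * g z) = (\<lambda>z. a * S f z + b * S g z))"
    by (intro ball_cong all_cong1 refl 3)
  show ?thesis
    unfolding compact_operator_on_fock_def compact_op_def fock_eq fock_topology_eq Let_def 1 2 4 ..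
qed

lemma toeplitz_integrand_eq:
  "toeplitz_integrand \<alpha> w f z = (\<lambda>\<xi>. exp (- \<alpha> * (cmod \<xi>)\<^sup>2) *\<^sub>R (f \<xi> * cnj (kernel z \<xi>)))"
  by (rule ext) (simp add: toeplitz_integrand_def fock_kernel_eq scaleR_conv_of_real mult_ac)

lemma toeplitz_compact_iff:
  assumes "sets \<mu> = sets borel"
  shows "toeplitz_compact \<alpha> w \<mu> \<longleftrightarrow>
    (\<forall>f\<in>A. \<forall>z. integrable (gauss \<alpha> \<mu>) (\<lambda>\<xi>. f \<xi> * cnj (kernel z \<xi>))) \<and> compact_op (toep (gauss \<alpha> \<mu>))"
proof -
  have pm: "(\<lambda>\<xi>. f \<xi> * cnj (kernel z \<xi>)) \<in> borel_measurable borel" if "f \<in> A" for f z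
    by (rule product_measurable[OF A_hol[OF that] A_hol[OF kernel_A]])
  have T: "toeplitz \<alpha> w \<mu> f = toep (gauss \<alpha> \<mu>) f" if "f \<in> A" for f
    unfolding toeplitz_def[abs_def] toep_def[abs_def] ip_def toeplitz_integrand_eq
      integral_gauss[OF assms pm[OF that]] ..
  have I: "integrable \<mu> (toeplitz_integrand \<alpha> w f z) \<longleftrightarrow>
      integrable (gauss \<alpha> \<mu>) (\<lambda>\<xi>. f \<xi> * cnj (kernel z \<xi>))" if "f \<in> A" for f z
    unfolding toeplitz_integrand_eq integrable_gauss[OF assms pm[OF that]] ..
  have "(\<forall>f\<in>A. \<forall>z. integrable \<mu> (toeplitz_integrand \<alpha> w f z)) \<longleftrightarrow>
      (\<forall>f\<in>A. \<forall>z. integrable (gauss \<alpha> \<mu>) (\<lambda>\<xi>. f \<xi> * cnj (kernel z \<xi>)))"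
    by (intro ball_cong all_cong1 refl I)
  moreover have "compact_operator_on_fock \<alpha> w (toeplitz \<alpha> w \<mu>) \<longleftrightarrow> compact_op (toep (gauss \<alpha> \<mu>))"
    by (rule compact_operator_eq[OF T])
  ultimately show ?thesis
    unfolding toeplitz_compact_def fock_eq by (intro arg_cong2[where f = "(\<and>)"])
qed

text \<open>\<open>\<delta>\<close> is chosen before \<open>\<mu>\<close> and \<open>r\<close>. The
  bound \<open>r < \<delta>\<close> enters the second implication through
  \<open>nkernel_lower\<close> and the third through \<open>\<delta> < 1\<close>.\<close>

lemma compactness_characterization:
  obtains \<delta> where "0 < \<delta>" "\<delta> < 1"
    "\<And>\<mu>. positive_borel_measure \<mu> \<Longrightarrow> toeplitz_compact \<alpha> w \<mu> \<Longrightarrow> (berezin \<alpha> w \<mu> \<longlongrightarrow> 0) at_infinity"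
    "\<And>\<mu> r. positive_borel_measure \<mu> \<Longrightarrow> (berezin \<alpha> w \<mu> \<longlongrightarrow> 0) at_infinity \<Longrightarrow> 0 < r \<Longrightarrow> r < \<delta> \<Longrightarrow>
      (average_function w \<mu> r \<longlongrightarrow> 0) at_infinity"
    "\<And>\<mu> r. positive_borel_measure \<mu> \<Longrightarrow> 0 < r \<Longrightarrow> r < \<delta> \<Longrightarrow>
      (average_function w \<mu> r \<longlongrightarrow> 0) at_infinity \<Longrightarrow> toeplitz_compact \<alpha> w \<mu>"
proof -
  obtain \<delta> where \<delta>: "0 < \<delta>" "\<delta> < 1" and bc:
    "\<And>\<mu> r. sets \<mu> = sets borel \<Longrightarrow> (ber (gauss \<alpha> \<mu>) \<longlongrightarrow> 0) at_infinity \<Longrightarrow> 0 < r \<Longrightarrow> r < \<delta> \<Longrightarrow>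
      (avgf \<mu> r \<longlongrightarrow> 0) at_infinity"
    using avgf_tendsto_0_if_ber by blast
  show ?thesis
  proof (rule that[OF \<delta>])
    fix \<mu> assume \<mu>: "positive_borel_measure \<mu>"
    have sets: "sets \<mu> = sets borel" and fin: "emeasure \<mu> (cball 0 R) < \<infinity>" for R
      using \<mu> by (auto simp: positive_borel_measure_def)
    show "(berezin \<alpha> w \<mu> \<longlongrightarrow> 0) at_infinity" if "toeplitz_compact \<alpha> w \<mu>"
      unfolding berezin_eq[OF sets]
    proof (rule ber_tendsto_0_if_compact)
      show "compact_op (toep (gauss \<alpha> \<mu>))"
        using that unfolding toeplitz_compact_iff[OF sets] by (rule conjunct2)
      show "integrable (gauss \<alpha> \<mu>) (\<lambda>\<xi>. f \<xi> * cnj (kernel z \<xi>))" if "f \<in> A" for f z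
        using \<open>toeplitz_compact \<alpha> w \<mu>\<close>[unfolded toeplitz_compact_iff[OF sets], THEN conjunct1] that by blast
    qed
    show "(average_function w \<mu> r \<longlongrightarrow> 0) at_infinity"
      if "(berezin \<alpha> w \<mu> \<longlongrightarrow> 0) at_infinity" "0 < r" "r < \<delta>" for r
      using that unfolding average_function_eq berezin_eq[OF sets] by (intro bc sets)
    show "toeplitz_compact \<alpha> w \<mu>"
      if "0 < r" "r < \<delta>" "(average_function w \<mu> r \<longlongrightarrow> 0) at_infinity" for r
    proof -
      have r: "0 < r" "r < 1" using that \<delta> by auto
      note c = toep_compact_if_avgf[OF sets fin r that(3)[unfolded average_function_eq]]
      show ?thesis
        unfolding toeplitz_compact_iff[OF sets]
        by (intro conjI ballI allI integrable_ip c kernel_A)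
    qed
  qed
qed

end

theorem corollary1p3:
  fixes \<alpha> :: real and w :: "complex \<Rightarrow> real" and \<mu> :: "complex measure"
  assumes "\<alpha> > 0"
    and "w \<in> Ainf_restricted"
    and "positive_borel_measure \<mu>"
  shows "\<exists>\<delta>\<in>{0<..<1}.
     (toeplitz_compact \<alpha> w \<mu> \<longleftrightarrow> (berezin \<alpha> w \<mu> \<longlongrightarrow> 0) at_infinity) \<and>
     ((berezin \<alpha> w \<mu> \<longlongrightarrow> 0) at_infinity \<longleftrightarrow>
        (\<exists>r\<in>{0<..<\<delta>}. (average_function w \<mu> r \<longlongrightarrow> 0) at_infinity)) \<and>
     ((berezin \<alpha> w \<mu> \<longlongrightarrow> 0) at_infinity \<longleftrightarrow>
        (\<forall>r\<in>{0<..<\<delta>}. (average_function w \<mu> r \<longlongrightarrow> 0) at_infinity))"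
proof -
  obtain C \<kappa> n where "doubling_measure \<alpha> C \<kappa> n (weight_measure w)"
    using Ainf_doubling_measure[OF assms(2,1)] by blast
  then interpret weighted_fock \<alpha> C \<kappa> n w
    by (intro weighted_fock.intro weighted_fock_axioms.intro weight_if_Ainf assms(2))
  obtain \<delta> where \<delta>: "0 < \<delta>" "\<delta> < 1"
    and ab: "\<And>\<mu>. positive_borel_measure \<mu> \<Longrightarrow> toeplitz_compact \<alpha> w \<mu> \<Longrightarrow> (berezin \<alpha> w \<mu> \<longlongrightarrow> 0) at_infinity"
    and bc: "\<And>\<mu> r. positive_borel_measure \<mu> \<Longrightarrow> (berezin \<alpha> w \<mu> \<longlongrightarrow> 0) at_infinity \<Longrightarrow> 0 < r \<Longrightarrow> r < \<delta> \<Longrightarrow>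
      (average_function w \<mu> r \<longlongrightarrow> 0) at_infinity"
    and ca: "\<And>\<mu> r. positive_borel_measure \<mu> \<Longrightarrow> 0 < r \<Longrightarrow> r < \<delta> \<Longrightarrow>
      (average_function w \<mu> r \<longlongrightarrow> 0) at_infinity \<Longrightarrow> toeplitz_compact \<alpha> w \<mu>"
    using compactness_characterization by blast
  note ab = ab[OF assms(3)] and bc = bc[OF assms(3)] and ca = ca[OF assms(3)]
  \<comment> \<open>The radius \<open>\<delta> / 2\<close> closes the cycle from the Berezin
    transform through averages to compactness, and witnesses the existential form.\<close>
  have half: "\<delta> / 2 \<in> {0<..<\<delta>}" using \<delta> by simp
  have "toeplitz_compact \<alpha> w \<mu> \<longleftrightarrow> (berezin \<alpha> w \<mu> \<longlongrightarrow> 0) at_infinity"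
    using ab bc[of "\<delta> / 2"] ca[of "\<delta> / 2"] half by auto
  moreover have "(berezin \<alpha> w \<mu> \<longlongrightarrow> 0) at_infinity \<longleftrightarrow>
      (\<exists>r\<in>{0<..<\<delta>}. (average_function w \<mu> r \<longlongrightarrow> 0) at_infinity)"
    using ab bc[of "\<delta> / 2"] ca half by (meson greaterThanLessThan_iff)
  moreover have "(berezin \<alpha> w \<mu> \<longlongrightarrow> 0) at_infinity \<longleftrightarrow>
      (\<forall>r\<in>{0<..<\<delta>}. (average_function w \<mu> r \<longlongrightarrow> 0) at_infinity)"
    using ab bc ca[of "\<delta> / 2"] half by (meson greaterThanLessThan_iff)
  ultimately show ?thesis using \<delta> by (intro bexI[of _ \<delta>] conjI) simp_all
qed

end
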